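(* (1) Let $\lambda,\theta_1,\theta$ be infinite cardinals and suppose that (a) $\lambda=\mathrm{cf}(\lambda)>\theta_1^+>\theta_1\ge\theta=\mathrm{cf}(\theta)>\aleph_1$ and $\lambda\ge 2^{\aleph_0}$; (b) $S^*\subseteq S^{\lambda^+}_\theta$ is stationary in $\lambda^+$, and moreover the set $$S_1=\{\delta<\lambda^+ : \mathrm{cf}(\delta)=\theta_1^+ \text{ and } S^*\cap\delta \text{ is stationary in }\delta\}$$ is stationary in $\lambda^+$. Then there are a stationary set $S'\subseteq S^*$ and a sequence $\langle E_\delta:\delta\in S'\rangle$ such that (i) for every $\delta\in S'$, $E_\delta$ is a club of $\delta$ with $\mathrm{otp}(E_\delta)\le\lambda^\omega\times\theta_1^+$; (ii) for every unbounded $A\subseteq\lambda^+$ with $A\subseteq S^{\lambda^+}_\lambda$, there are stationarily many $\delta\in S'$ such that $$\delta=\sup(A\cap\mathrm{nacc}(E_\delta)).$$ (2) If $S^*=S^{\lambda^+}_\theta$, then the assumption $\lambda\ge 2^{\aleph_0}$ can be omitted in (1); that is, the conclusion of (1) holds under all the other hypotheses in (a) and (b).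
   Context: For a regular cardinal $\kappa<\delta$, $S^\delta_\kappa=\{\alpha<\delta:\mathrm{cf}(\alpha)=\kappa\}$. For a set $C$ of ordinals, $\mathrm{acc}(C)=\{\beta\in C:\beta=\sup(C\cap\beta)\}$ and $\mathrm{nacc}(C)=C\setminus\mathrm{acc}(C)$. A club of $\delta$ is a closed unbounded subset of $\delta$; $\mathrm{otp}$ denotes order type. In the bound $\lambda^\omega\times\theta_1^+$, the power and the product are ordinal operations (ordinal exponentiation, and the ordinal product consisting of $\theta_1^+$ successive copies of $\lambda^\omega$). "Stationarily many $\delta\in S'$" means that the set of such $\delta$ is a stationary subset of $\lambda^+$. The framework is ZFC. *)

theory Defs
  imports Main
begin

unbundle cardinal_syntax

text \<open>
  Cardinals and ordinals are represented by (reflexive) well-order relations on arbitrary types: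
  an infinite cardinal \<open>\<kappa>\<close> is a relation with \<^const>\<open>cinfinite\<close> and
  \<open>Card_order \<kappa>\<close>, compared with others by \<open>=o\<close>, \<open>\<le>o\<close>, \<open><o\<close>. If \<open>R\<close> is a well-order of type
  \<open>\<rho>\<close>, the elements of \<open>Field R\<close> stand for the ordinals below \<open>\<rho>\<close>, and the ordinal \<open>\<delta>\<close> itself,
  as a set of ordinals, is \<open>underS R \<delta>\<close> with the order inherited from \<open>R\<close>.
\<close>

definition below :: "'a rel \<Rightarrow> 'a \<Rightarrow> 'a rel" where
  "below R \<delta> = Restr R (underS R \<delta>)"

definition unbounded_in :: "'a rel \<Rightarrow> 'a set \<Rightarrow> bool" where
  "unbounded_in r A \<longleftrightarrow> A \<subseteq> Field r \<and> (\<forall>a\<in>Field r. \<exists>b\<in>A. (a, b) \<in> r)"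

text \<open>
  The library's \<^const>\<open>cofinal\<close> asks for strictly larger elements, so that a successor ordinal has
  no cofinal subset; with the non-strict version a successor ordinal has cofinality 1.
\<close>

definition cf :: "'a rel \<Rightarrow> 'a rel" where
  "cf r = (SOME c. (\<exists>A. unbounded_in r A \<and> c = |A| ) \<and> (\<forall>B. unbounded_in r B \<longrightarrow> c \<le>o |B| ))"

lemma cf_spec:
  assumes "Refl r"
  shows "(\<exists>A. unbounded_in r A \<and> cf r = |A| ) \<and> (\<forall>B. unbounded_in r B \<longrightarrow> cf r \<le>o |B| )"
proof -
  have "unbounded_in r (Field r)"
    using assms by (auto simp: unbounded_in_def refl_on_def)
  then have "\<exists>c\<in>{|A| |A. unbounded_in r A}. \<forall>c'\<in>{|A| |A. unbounded_in r A}. c \<le>o c'"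
    by (intro exists_minim_Card_order) (auto simp: card_of_Card_order)
  then have "\<exists>c. (\<exists>A. unbounded_in r A \<and> c = |A| ) \<and> (\<forall>B. unbounded_in r B \<longrightarrow> c \<le>o |B| )"
    by blast
  then show ?thesis
    unfolding cf_def by (rule someI_ex)
qed

definition cof_points :: "'a rel \<Rightarrow> 'b rel \<Rightarrow> 'a set" where
  "cof_points R \<kappa> = {\<alpha> \<in> Field R. cf (below R \<alpha>) =o \<kappa>}"

text \<open>
  \<open>wo_rel.supr r\<close> is the least upper bound in \<open>r\<close>; in particular \<open>sup {} = 0\<close>. It is only applied
  to sets which are bounded in \<open>Field r\<close>.
\<close>

definition acc_points :: "'a rel \<Rightarrow> 'a set \<Rightarrow> 'a set" where
  "acc_points r C = {\<beta> \<in> C. \<beta> = wo_rel.supr r (C \<inter> underS r \<beta>)}"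

definition nacc_points :: "'a rel \<Rightarrow> 'a set \<Rightarrow> 'a set" where
  "nacc_points r C = C - acc_points r C"

definition closed_in :: "'a rel \<Rightarrow> 'a set \<Rightarrow> bool" where
  "closed_in r C \<longleftrightarrow>
     (\<forall>\<beta>\<in>Field r. C \<inter> underS r \<beta> \<noteq> {} \<and> \<beta> = wo_rel.supr r (C \<inter> underS r \<beta>) \<longrightarrow> \<beta> \<in> C)"

definition club_in :: "'a rel \<Rightarrow> 'a set \<Rightarrow> bool" where
  "club_in r C \<longleftrightarrow> unbounded_in r C \<and> closed_in r C"

definition stationary_in :: "'a rel \<Rightarrow> 'a set \<Rightarrow> bool" where
  "stationary_in r S \<longleftrightarrow> S \<subseteq> Field r \<and> (\<forall>C. club_in r C \<longrightarrow> S \<inter> C \<noteq> {})"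

text \<open>The ordinal product \<open>r \<times> s\<close>: \<open>s\<close> successive copies of \<open>r\<close>.\<close>

definition ord_prod :: "'a rel \<Rightarrow> 'b rel \<Rightarrow> ('a \<times> 'b) rel" where
  "ord_prod r s = {((x, y), (x', y')).
     x \<in> Field r \<and> x' \<in> Field r \<and> y \<in> Field s \<and> y' \<in> Field s \<and>
     ((y, y') \<in> s - Id \<or> y = y' \<and> (x, x') \<in> r)}"

text \<open>
  Ordinal exponentiation in its non-recursive form: \<open>r\<^sup>s\<close> is the order type of the finitely supported
  functions from \<open>s\<close> to \<open>r\<close>, compared at the largest argument where they differ
  (neither the cardinal power nor the set of all functions).
\<close>

definition finsupp_funs :: "'a rel \<Rightarrow> 'b rel \<Rightarrow> ('b \<Rightarrow> 'a) set" where
  "finsupp_funs r s =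
     {f \<in> Func (Field s) (Field r). finite {x \<in> Field s. f x \<noteq> wo_rel.minim r (Field r)}}"

definition ord_pow :: "'a rel \<Rightarrow> 'b rel \<Rightarrow> ('b \<Rightarrow> 'a) rel" where
  "ord_pow r s = {(f, g). f \<in> finsupp_funs r s \<and> g \<in> finsupp_funs r s \<and>
     (f = g \<or> (\<exists>m\<in>Field s. (f m, g m) \<in> r - Id \<and> (\<forall>x. (m, x) \<in> s - Id \<longrightarrow> f x = g x)))}"

text \<open>
  The two properties demanded of \<open>\<langle>E\<^sub>\<delta> : \<delta> \<in> S'\<rangle>\<close>, where \<open>\<Lambda>\<close> is the cardinal \<open>\<lambda>\<close>; only the values of
  \<open>E\<close> on \<open>S'\<close> matter. \<open>Restr (cardSuc \<Lambda>) (E \<delta>)\<close> represents the order type of \<open>E \<delta>\<close>.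
\<close>

definition guessing_sequence :: "'a rel \<Rightarrow> 'b rel \<Rightarrow> 'a set set \<Rightarrow> ('a set \<Rightarrow> 'a set set) \<Rightarrow> bool" where
  "guessing_sequence \<Lambda> \<theta>\<^sub>1 S' E \<longleftrightarrow>
     (\<forall>\<delta>\<in>S'. club_in (below (cardSuc \<Lambda>) \<delta>) (E \<delta>) \<and>
        Restr (cardSuc \<Lambda>) (E \<delta>) \<le>o ord_prod (ord_pow \<Lambda> natLeq) (cardSuc \<theta>\<^sub>1)) \<and>
     (\<forall>A. unbounded_in (cardSuc \<Lambda>) A \<and> A \<subseteq> cof_points (cardSuc \<Lambda>) \<Lambda> \<longrightarrow>
        stationary_in (cardSuc \<Lambda>)
          {\<delta> \<in> S'. \<delta> = wo_rel.supr (cardSuc \<Lambda>) (A \<inter> nacc_points (cardSuc \<Lambda>) (E \<delta>))})"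

end

theory Submission
  imports Defs "HOL-Library.Countable_Set_Type"
begin

text \<open>
  Give every \<open>\<alpha> < \<lambda>\<^sup>+\<close> an injection into \<open>\<lambda>\<close>. Its left-to-right maxima form a ladder of type at most
  \<open>\<lambda>\<close>, and its sublevels \<open>a\<^sub>i\<^sup>\<alpha>\<close>, \<open>i < \<lambda>\<close>, exhaust \<open>\<alpha>\<close> by sets of size less than \<open>\<lambda>\<close>. For each \<open>d\<close> of
  cofinality \<open>\<theta>\<^sub>1\<^sup>+\<close> there is \<open>i\<close>, a supremum of \<open>\<omega>\<close> closure steps, such that \<open>a\<^sub>i\<^sup>d\<close> is cofinal in \<open>d\<close>
  and \<open>a\<^sub>i\<^sup>\<delta> = a\<^sub>i\<^sup>d \<inter> \<delta>\<close> at every limit \<open>\<delta> < d\<close> of \<open>a\<^sub>i\<^sup>d\<close> of uncountable cofinality; fix an \<open>i\<close> which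
  works for stationarily many \<open>d\<close>.

  Walking from \<open>a\<^sub>i\<^sup>\<delta>\<close> down the ladders, every \<open>x < \<delta>\<close> is reached in finitely many steps, and a point of
  cofinality \<open>\<lambda>\<close> is isolated in the set of points reached no later than itself. The club \<open>E\<^sub>\<delta>\<close> is the
  closure of the set of points reached within \<open>h(\<delta>)\<close> steps; recording the steps of a walk as digits
  bounds its order type by \<open>\<lambda>\<^sup>\<omega>\<close>. For \<open>d\<close> as above and \<open>A\<close> unbounded in \<open>d\<close>, some \<open>n\<close> is the number of steps
  to unboundedly many points of \<open>A\<close>, and then almost every \<open>\<delta> < d\<close> with \<open>h(\<delta>) = n\<close> is as required.

  So \<open>h\<close> has to take each value stationarily often below stationarily many \<open>d\<close>. It is made a function
  of the order type of \<open>a\<^sub>i\<^sup>\<delta>\<close>. Ulam's matrix for \<open>\<theta>\<^sub>1\<^sup>+\<close> gives, for each \<open>d\<close>, uncountably many disjoint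
  stationary sets of order types. If \<open>2\<^sup>\<omega> \<le> \<lambda>\<close>, then \<open>\<lambda>\<close> many maps to \<open>\<omega>\<close> suffice to map each
  uncountable index set onto \<open>\<omega>\<close>, and one of them works for stationarily many \<open>d\<close>. If \<open>S\<close> consists of
  all points of cofinality \<open>\<theta>\<close>, then any two \<open>d\<close> with isomorphic \<open>a\<^sub>i\<^sup>d\<close> have the same stationary sets of
  order types, so a map chosen for one \<open>d\<close> works for the others.
\<close>

subsection \<open>Cofinality and stationarity in a well-order\<close>

context wellorder
begin

definition down_closed :: "'a set \<Rightarrow> bool" where
  "down_closed D \<longleftrightarrow> (\<forall>x\<in>D. \<forall>y<x. y \<in> D)"

definition cofin :: "'a set \<Rightarrow> 'a set \<Rightarrow> bool" where
  "cofin D X \<longleftrightarrow> X \<subseteq> D \<and> (\<forall>x\<in>D. \<exists>y\<in>X. x \<le> y)"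

text \<open>For infinite \<open>K\<close> this says that the cofinality is at least
  \<open>K\<close>; since the bounds are strict, a largest element is excluded as well.\<close>

definition cof_ge :: "'k rel \<Rightarrow> 'a set \<Rightarrow> bool" where
  "cof_ge K D \<longleftrightarrow> (\<forall>X\<subseteq>D. |X| <o K \<longrightarrow> (\<exists>b\<in>D. \<forall>x\<in>X. x < b))"

definition cof_gt :: "'k rel \<Rightarrow> 'a set \<Rightarrow> bool" where
  "cof_gt K D \<longleftrightarrow> (\<forall>X\<subseteq>D. |X| \<le>o K \<longrightarrow> (\<exists>b\<in>D. \<forall>x\<in>X. x < b))"

definition mono_map :: "'a set \<Rightarrow> ('a \<Rightarrow> 'a) \<Rightarrow> bool" where
  "mono_map D G \<longleftrightarrow> G ` D \<subseteq> D \<and> (\<forall>x\<in>D. \<forall>y\<in>D. x \<le> y \<longrightarrow> G x \<le> G y)"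

definition closed_under :: "('a \<Rightarrow> 'a) \<Rightarrow> 'a \<Rightarrow> bool" where
  "closed_under G \<beta> \<longleftrightarrow> (\<forall>x<\<beta>. G x < \<beta>)"

text \<open>
  The points closed under a monotone map form a club as soon as the cofinality is uncountable, and
  every club contains all points closed under some monotone map. So this is stationarity, in a form
  which makes sense without closed sets.
\<close>

definition stat :: "'a set \<Rightarrow> 'a set \<Rightarrow> bool" where
  "stat D T \<longleftrightarrow> T \<subseteq> D \<and> (\<forall>G. mono_map D G \<longrightarrow> (\<exists>\<beta>\<in>T. closed_under G \<beta>))"

definition next_in :: "'a set \<Rightarrow> 'a \<Rightarrow> 'a" where
  "next_in X x = (LEAST y. y \<in> X \<and> x < y)"

lemma down_closed_lessThan: "down_closed {..<x}"
  by (auto simp: down_closed_def)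

lemma cof_gtD: "cof_gt K D \<Longrightarrow> X \<subseteq> D \<Longrightarrow> |X| \<le>o K \<Longrightarrow> \<exists>b\<in>D. \<forall>x\<in>X. x < b"
  by (simp add: cof_gt_def)

lemma cof_geD: "cof_ge K D \<Longrightarrow> X \<subseteq> D \<Longrightarrow> |X| <o K \<Longrightarrow> \<exists>b\<in>D. \<forall>x\<in>X. x < b"
  by (simp add: cof_ge_def)

lemma cof_gt_mono:
  assumes "cof_gt K D" "K' \<le>o K"
  shows "cof_gt K' D"
  using assms ordLeq_transitive unfolding cof_gt_def by blast

lemma cof_ge_imp_gt:
  assumes "cof_ge K D" "K' <o K"
  shows "cof_gt K' D"
  using assms ordLeq_ordLess_trans unfolding cof_ge_def cof_gt_def by blast

lemma cof_gt_ex_greater: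
  assumes "cof_gt K D" "Card_order K" "Field K \<noteq> {}" "x \<in> D"
  shows "\<exists>b\<in>D. x < b"
proof -
  have "|{x}| \<le>o K"
    using assms(2,3) by (rule Card_order_singl_ordLeq)
  then show ?thesis
    using assms(1,4) unfolding cof_gt_def by (metis insert_subset empty_subsetI singletonI)
qed

lemma cof_gt_lessThan_gt:
  assumes "cof_gt natLeq {..<\<delta>}" "x < \<delta>"
  shows "\<exists>b<\<delta>. x < b"
  using cof_gt_ex_greater[OF assms(1) natLeq_Card_order, of x] assms(2) by (auto simp: Field_natLeq)

lemma cof_gt_lessThan_nonempty:
  assumes "cof_gt natLeq {..<\<delta>}"
  shows "\<exists>b. b < \<delta>"
proof -
  have "|{}::'a set| \<le>o natLeq"
    by (metis Card_order_empty natLeq_Card_order)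
  then show ?thesis
    using assms unfolding cof_gt_def by (metis empty_subsetI lessThan_iff)
qed

lemma countable_range: "|range (s :: nat \<Rightarrow> 'b)| \<le>o natLeq"
  by (metis card_of_image card_of_nat ordLeq_ordIso_trans)

lemma cof_gt_seq_bound:
  assumes "cof_gt natLeq D" "range (s :: nat \<Rightarrow> 'a) \<subseteq> D"
  shows "\<exists>b\<in>D. \<forall>n. s n < b"
  using cof_gtD[OF assms countable_range] by simp

text \<open>Supplies the limits of constructions in \<omega> steps: a bound in \<open>D\<close>
  exists by uncountable cofinality, and the least one is in \<open>D\<close> because
  \<open>D\<close> is down-closed.\<close>

lemma cof_gt_lub:
  assumes "cof_gt natLeq D" "down_closed D" "range (s :: nat \<Rightarrow> 'a) \<subseteq> D"
  shows "\<exists>b\<in>D. (\<forall>n. s n < b) \<and> (\<forall>x<b. \<exists>n. x \<le> s n)"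
proof -
  define b where "b = (LEAST b. \<forall>n. s n < b)"
  obtain c where c: "c \<in> D" "\<forall>n. s n < c"
    using cof_gt_seq_bound[OF assms(1,3)] by blast
  have 1: "\<forall>n. s n < b"
    unfolding b_def by (rule LeastI[of "\<lambda>b. \<forall>n. s n < b", OF c(2)])
  have "b \<le> c"
    unfolding b_def by (rule Least_le, rule c(2))
  then have "b \<in> D"
    using assms(2) c(1) unfolding down_closed_def by (metis le_less)
  moreover have "\<exists>n. x \<le> s n" if "x < b" for x
    using not_less_Least[of x "\<lambda>b. \<forall>n. s n < b"] that unfolding b_def by (auto simp: not_less)
  ultimately show ?thesis
    using 1 by blast
qed

lemma next_in:
  assumes "y \<in> X" "x < y"
  shows "next_in X x \<in> X" "x < next_in X x" "next_in X x \<le> y"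
proof -
  show "next_in X x \<in> X" "x < next_in X x"
    using LeastI[of "\<lambda>y. y \<in> X \<and> x < y" y] assms unfolding next_in_def by auto
  show "next_in X x \<le> y"
    unfolding next_in_def using assms by (intro Least_le) simp
qed

lemma cofin_next_in:
  assumes "cofin D X" "x \<in> D" "\<forall>x\<in>D. \<exists>y\<in>D. x < y"
  shows "next_in X x \<in> X" "x < next_in X x" "next_in X x \<in> D"
proof -
  obtain y where "y \<in> D" "x < y"
    using assms by blast
  then obtain z where "z \<in> X" "x < z"
    using assms(1) unfolding cofin_def by (metis less_le_trans)
  then show "next_in X x \<in> X" "x < next_in X x" "next_in X x \<in> D"
    using next_in[of z X x] assms(1) unfolding cofin_def by auto
qed

lemma cofin_trans:
  assumes "cofin D X" "cofin X Y"
  shows "cofin D Y"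
  unfolding cofin_def
proof (intro conjI ballI)
  show "Y \<subseteq> D"
    using assms by (auto simp: cofin_def)
  fix x assume "x \<in> D"
  then obtain y where "y \<in> X" "x \<le> y"
    using assms(1) by (auto simp: cofin_def)
  then show "\<exists>z\<in>Y. x \<le> z"
    using assms(2) by (meson cofin_def order_trans)
qed

text \<open>A point closed under \<open>next_in X\<close>, other than the least one, is a limit of
  \<open>X\<close>; so this map stands for the club of limit points of \<open>X\<close>.\<close>

lemma mono_map_next_in:
  assumes "cofin D X" "\<forall>x\<in>D. \<exists>y\<in>D. x < y"
  shows "mono_map D (next_in X)"
  unfolding mono_map_def
proof (intro conjI ballI impI)
  show "next_in X ` D \<subseteq> D"
    using cofin_next_in[OF assms(1) _ assms(2)] by blast
  fix x y assume "x \<in> D" "y \<in> D" "x \<le> y"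
  then show "next_in X x \<le> next_in X y"
    using next_in(3)[of "next_in X y" X x] cofin_next_in[OF assms(1) _ assms(2), of y] by auto
qed

lemma mono_map_max:
  assumes "mono_map D G" "mono_map D H"
  shows "mono_map D (\<lambda>x. max (G x) (H x))"
  using assms unfolding mono_map_def by (auto simp: max_def image_subset_iff) (meson dual_order.trans linear)+

lemma mono_map_const: "c \<in> D \<Longrightarrow> mono_map D (\<lambda>x. c)"
  by (auto simp: mono_map_def)

lemma closed_under_max:
  "closed_under (\<lambda>x. max (G x) (H x)) \<beta> \<longleftrightarrow> closed_under G \<beta> \<and> closed_under H \<beta>"
  by (auto simp: closed_under_def)

text \<open>The pointwise maximum of two monotone maps stands for the intersection of their
  clubs.\<close>

lemma stat_closed_under:
  assumes "stat D T" "mono_map D G"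
  shows "stat D {\<beta> \<in> T. closed_under G \<beta>}"
  unfolding stat_def
proof (intro conjI allI impI)
  show "{\<beta> \<in> T. closed_under G \<beta>} \<subseteq> D"
    using assms(1) by (auto simp: stat_def)
  fix H assume "mono_map D H"
  then have "mono_map D (\<lambda>x. max (G x) (H x))"
    using assms(2) by (rule mono_map_max[rotated])
  then obtain \<beta> where "\<beta> \<in> T" "closed_under (\<lambda>x. max (G x) (H x)) \<beta>"
    using assms(1) unfolding stat_def by blast
  then show "\<exists>\<beta>\<in>{\<beta> \<in> T. closed_under G \<beta>}. closed_under H \<beta>"
    by (auto simp: closed_under_max)
qed

lemma stat_mono: "stat D T \<Longrightarrow> T \<subseteq> T' \<Longrightarrow> T' \<subseteq> D \<Longrightarrow> stat D T'"
  unfolding stat_def by blast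

text \<open>Pointwise suprema of fewer than \<open>cf D\<close> monotone maps are again monotone maps of \<open>D\<close>.\<close>

lemma stat_UN:
  assumes "stat D (\<Union>j\<in>I. T j)" "cof_gt |I| D" "down_closed D"
  shows "\<exists>j\<in>I. stat D (T j)"
proof (rule ccontr)
  assume "\<not> ?thesis"
  moreover have "T j \<subseteq> D" if "j \<in> I" for j
    using assms(1) that unfolding stat_def by blast
  ultimately have "\<forall>j\<in>I. \<exists>G. mono_map D G \<and> (\<forall>\<beta>\<in>T j. \<not> closed_under G \<beta>)"
    unfolding stat_def by blast
  then obtain G where G: "\<And>j. j \<in> I \<Longrightarrow> mono_map D (G j)"
      and no: "\<And>j \<beta>. j \<in> I \<Longrightarrow> \<beta> \<in> T j \<Longrightarrow> \<not> closed_under (G j) \<beta>"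
    by metis
  define H where "H x = (LEAST b. \<forall>j\<in>I. G j x < b)" for x
  have H_ex: "\<exists>b\<in>D. \<forall>j\<in>I. G j x < b" if "x \<in> D" for x
  proof -
    have "(\<lambda>j. G j x) ` I \<subseteq> D"
      using G that unfolding mono_map_def by blast
    from cof_gtD[OF assms(2) this card_of_image] show ?thesis
      by simp
  qed
  have H1: "G j x < H x" if x: "x \<in> D" and j: "j \<in> I" for x j
  proof -
    obtain b where "\<forall>j\<in>I. G j x < b"
      using H_ex[OF x] by blast
    then have "\<forall>j\<in>I. G j x < H x"
      unfolding H_def by (rule LeastI)
    then show ?thesis
      using j by blast
  qed
  have H2: "H x \<le> b" if "\<forall>j\<in>I. G j x < b" for x b
    unfolding H_def using that by (rule Least_le)
  have "mono_map D H"
    unfolding mono_map_def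
  proof (intro conjI ballI impI)
    show "H ` D \<subseteq> D"
    proof
      fix y assume "y \<in> H ` D"
      then obtain x where x: "x \<in> D" "y = H x"
        by blast
      then obtain b where b: "b \<in> D" "\<forall>j\<in>I. G j x < b"
        using H_ex by blast
      then have "y \<le> b"
        using H2 x(2) by blast
      then show "y \<in> D"
        using b(1) assms(3) unfolding down_closed_def by (cases "y = b") auto
    qed
    fix x y assume xy: "x \<in> D" "y \<in> D" "x \<le> y"
    then have "G j x \<le> G j y" if "j \<in> I" for j
      using G that unfolding mono_map_def by blast
    then have "\<forall>j\<in>I. G j x < H y"
      using H1 xy by (meson le_less_trans)
    then show "H x \<le> H y"
      by (rule H2)
  qed
  then obtain \<beta> j where \<beta>: "closed_under H \<beta>" "j \<in> I" "\<beta> \<in> T j"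
    using assms(1) unfolding stat_def by blast
  then have "\<beta> \<in> D"
    using assms(1) unfolding stat_def by blast
  then have "closed_under (G j) \<beta>"
    using \<beta> H1 assms(3) unfolding closed_under_def down_closed_def by (meson less_trans)
  then show False
    using no \<beta> by blast
qed

end

subsection \<open>Order types of sets of ordinals\<close>

context wellorder
begin

lemma ex_least: "P x \<Longrightarrow> \<exists>y. P y \<and> (\<forall>z. P z \<longrightarrow> y \<le> z)"
  by (intro exI[of _ "Least P"] conjI allI impI) (auto intro: LeastI Least_le)

definition incr_on :: "'a set \<Rightarrow> ('a \<Rightarrow> 'a) \<Rightarrow> bool" where
  "incr_on X g \<longleftrightarrow> (\<forall>x\<in>X. \<forall>y\<in>X. x < y \<longrightarrow> g x < g y)"

text \<open>Order types are named by points of the type itself. For a set bounded by some \<delta>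
  the identity shows that a suitable point exists.\<close>

definition ot :: "'a set \<Rightarrow> 'a" where
  "ot X = (LEAST p. \<exists>g. incr_on X g \<and> g ` X \<subseteq> {..<p})"

lemma incr_on_subset: "incr_on X g \<Longrightarrow> Y \<subseteq> X \<Longrightarrow> incr_on Y g"
  unfolding incr_on_def by blast

lemma incr_on_inj: "incr_on X g \<Longrightarrow> inj_on g X"
  unfolding incr_on_def inj_on_def by (metis less_irrefl linorder_cases)

lemma incr_on_le: "incr_on X g \<Longrightarrow> x \<in> X \<Longrightarrow> y \<in> X \<Longrightarrow> x \<le> y \<Longrightarrow> g x \<le> g y"
  unfolding incr_on_def by (cases "x = y") (auto simp: less_le)

lemma incr_on_less_iff: "incr_on X g \<Longrightarrow> x \<in> X \<Longrightarrow> y \<in> X \<Longrightarrow> g x < g y \<longleftrightarrow> x < y"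
  by (metis incr_on_def incr_on_le not_less)

lemma ot_le: "incr_on X g \<Longrightarrow> g ` X \<subseteq> {..<p} \<Longrightarrow> ot X \<le> p"
  unfolding ot_def by (rule Least_le) blast

lemma ot_ex:
  assumes "X \<subseteq> {..<\<delta>}"
  shows "\<exists>g. incr_on X g \<and> g ` X \<subseteq> {..<ot X}"
proof -
  have "\<exists>g. incr_on X g \<and> g ` X \<subseteq> {..<\<delta>}"
    using assms by (intro exI[of _ "\<lambda>x. x"]) (auto simp: incr_on_def)
  then show ?thesis
    unfolding ot_def by (rule LeastI)
qed

lemma ot_mono:
  assumes "X \<subseteq> Y" "Y \<subseteq> {..<\<delta>}"
  shows "ot X \<le> ot Y"
proof -
  obtain g where "incr_on Y g" "g ` Y \<subseteq> {..<ot Y}"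
    using ot_ex[OF assms(2)] by blast
  then show ?thesis
    using assms(1) by (intro ot_le[of X g]) (auto intro: incr_on_subset)
qed

text \<open>An increasing map \<open>g\<close> of \<open>X\<close> into its order type sends the
  points before \<open>x\<close> below \<open>g x\<close>, so \<open>g x\<close> already bounds the
  type of the segment.\<close>

lemma ot_initial_less:
  assumes "X \<subseteq> {..<\<delta>}" "x \<in> X"
  shows "ot (X \<inter> {..<x}) < ot X"
proof -
  obtain g where g: "incr_on X g" "g ` X \<subseteq> {..<ot X}"
    using ot_ex[OF assms(1)] by blast
  have "ot (X \<inter> {..<x}) \<le> g x"
  proof (rule ot_le[of _ g])
    show "incr_on (X \<inter> {..<x}) g"
      using g(1) by (rule incr_on_subset) blast
    show "g ` (X \<inter> {..<x}) \<subseteq> {..<g x}"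
      using g(1) assms(2) unfolding incr_on_def by blast
  qed
  also have "\<dots> < ot X"
    using g(2) assms(2) by blast
  finally show ?thesis .
qed

lemma incr_on_ot:
  assumes "X \<subseteq> {..<\<delta>}"
  shows "incr_on X (\<lambda>x. ot (X \<inter> {..<x}))"
  unfolding incr_on_def
proof (intro ballI impI)
  fix x y assume "x \<in> X" "y \<in> X" "x < y"
  then have "X \<inter> {..<y} \<inter> {..<x} = X \<inter> {..<x}" "x \<in> X \<inter> {..<y}"
    by auto
  then show "ot (X \<inter> {..<x}) < ot (X \<inter> {..<y})"
    using ot_initial_less[of "X \<inter> {..<y}" \<delta> x] assms by (simp add: le_infI1)
qed

text \<open>The first \<open>x\<close> whose segment has type at least \<open>p\<close> works: the
  segments of earlier points have type below \<open>p\<close>, and these types map the segment of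
  \<open>x\<close> into \<open>p\<close>.\<close>

lemma ot_surj:
  assumes "X \<subseteq> {..<\<delta>}" "p < ot X"
  shows "\<exists>x\<in>X. ot (X \<inter> {..<x}) = p"
proof -
  let ?P = "\<lambda>x. x \<in> X \<and> p \<le> ot (X \<inter> {..<x})"
  have "\<exists>x. ?P x"
  proof (rule ccontr)
    assume "\<nexists>x. ?P x"
    then have "(\<lambda>x. ot (X \<inter> {..<x})) ` X \<subseteq> {..<p}"
      by (auto simp: not_le)
    with incr_on_ot[OF assms(1)] have "ot X \<le> p"
      by (rule ot_le)
    then show False
      using assms(2) by simp
  qed
  then obtain x where x: "?P x" and least: "\<And>z. ?P z \<Longrightarrow> x \<le> z"
    using ex_least[of ?P] by blast
  have "ot (X \<inter> {..<x}) \<le> p"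
  proof (rule ot_le)
    show "incr_on (X \<inter> {..<x}) (\<lambda>z. ot (X \<inter> {..<z}))"
      using incr_on_ot[OF assms(1)] by (rule incr_on_subset) blast
    show "(\<lambda>z. ot (X \<inter> {..<z})) ` (X \<inter> {..<x}) \<subseteq> {..<p}"
      using least by (auto simp: not_le[symmetric])
  qed
  then show ?thesis
    using x by (metis order_antisym)
qed

lemma bij_betw_ot:
  assumes "X \<subseteq> {..<\<delta>}"
  shows "bij_betw (\<lambda>x. ot (X \<inter> {..<x})) X {..<ot X}"
  unfolding bij_betw_def
proof
  show "inj_on (\<lambda>x. ot (X \<inter> {..<x})) X"
    by (rule incr_on_inj[OF incr_on_ot[OF assms]])
  show "(\<lambda>x. ot (X \<inter> {..<x})) ` X = {..<ot X}"
    using ot_initial_less[OF assms] ot_surj[OF assms] by (auto simp: image_iff)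
qed

lemma ot_less_of_card:
  assumes "X \<subseteq> {..<\<delta>}" "|X| <o |{..<l}|"
  shows "ot X < l"
proof (rule ccontr)
  assume "\<not> ot X < l"
  then have "|{..<l}| \<le>o |{..<ot X}|"
    by (intro card_of_mono1) auto
  also have "|{..<ot X}| =o |X|"
    using bij_betw_ot[OF assms(1)] card_of_ordIso ordIso_symmetric by blast
  finally show False
    using assms(2) not_ordLess_ordLeq by blast
qed

section \<open>Left-to-right maxima of an enumeration\<close>

definition lr_max :: "'a set \<Rightarrow> ('a \<Rightarrow> 'a) \<Rightarrow> 'a set" where
  "lr_max Z g = {z \<in> Z. \<forall>y\<in>Z. g y < g z \<longrightarrow> y < z}"

lemma incr_on_lr_max: "inj_on g Z \<Longrightarrow> incr_on (lr_max Z g) g"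
  unfolding incr_on_def lr_max_def inj_on_def by (metis (no_types, lifting) less_asym less_irrefl linorder_cases mem_Collect_eq)

text \<open>Among the points of \<open>Z\<close> at or above \<open>x\<close>, one with the least
  value of \<open>g\<close> is a left-to-right maximum: every point with a smaller value lies below
  \<open>x\<close>.\<close>

lemma cofin_lr_max: "cofin Z (lr_max Z g)"
  unfolding cofin_def
proof (intro conjI ballI)
  show "lr_max Z g \<subseteq> Z"
    by (auto simp: lr_max_def)
  fix x assume "x \<in> Z"
  then have "\<exists>y. y \<in> Z \<and> x \<le> y \<and> g y = g x"
    by blast
  from ex_least[of "\<lambda>v. \<exists>y. y \<in> Z \<and> x \<le> y \<and> g y = v", OF this]
  obtain y where y: "y \<in> Z" "x \<le> y" and min: "\<And>z. z \<in> Z \<Longrightarrow> x \<le> z \<Longrightarrow> g y \<le> g z"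
    by blast
  have "z < y" if "z \<in> Z" "g z < g y" for z
    using min[of z] that y(2) by (meson leD le_less_trans not_le less_le_trans)
  then show "\<exists>y\<in>lr_max Z g. x \<le> y"
    using y by (auto simp: lr_max_def)
qed

lemma card_initial_of_incr:
  assumes "incr_on X g" "x \<in> X"
  shows "|X \<inter> {..<x}| \<le>o |{..<g x}|"
proof (rule card_of_ordLeqI[of g])
  show "inj_on g (X \<inter> {..<x})"
    using assms(1) by (meson incr_on_inj incr_on_subset inf_le1)
  show "\<And>a. a \<in> X \<inter> {..<x} \<Longrightarrow> g a \<in> {..<g x}"
    using assms unfolding incr_on_def by blast
qed

end

subsection \<open>Walks along ladders\<close>

context wellorder
begin

definition least_above :: "'a set \<Rightarrow> 'a \<Rightarrow> 'a" where
  "least_above c x = (LEAST y. y \<in> c \<and> x \<le> y)"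

definition ladder :: "('a \<Rightarrow> 'a \<Rightarrow> 'a) \<Rightarrow> 'a \<Rightarrow> 'a set" where
  "ladder f \<alpha> = lr_max {..<\<alpha>} (f \<alpha>)"

text \<open>
  Descend to \<open>x\<close> along a walk: first to the least point of \<open>c\<close> above \<open>x\<close>, then through the
  ladders. \<open>reach f n c x\<close> says that the walk arrives after at most \<open>n\<close> further steps.
\<close>

primrec reach :: "('a \<Rightarrow> 'a \<Rightarrow> 'a) \<Rightarrow> nat \<Rightarrow> 'a set \<Rightarrow> 'a \<Rightarrow> bool" where
  "reach f 0 c x \<longleftrightarrow> x \<in> c"
| "reach f (Suc n) c x \<longleftrightarrow> x \<in> c \<or> reach f n (ladder f (least_above c x)) x"

lemma least_above:
  assumes "y \<in> c" "x \<le> y"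
  shows "least_above c x \<in> c" "x \<le> least_above c x" "least_above c x \<le> y"
proof -
  show "least_above c x \<in> c" "x \<le> least_above c x"
    using LeastI[of "\<lambda>y. y \<in> c \<and> x \<le> y" y] assms unfolding least_above_def by auto
  show "least_above c x \<le> y"
    unfolding least_above_def using assms by (intro Least_le) simp
qed

lemma least_above_eq: "x \<in> c \<Longrightarrow> least_above c x = x"
  using least_above[of x c x] by (simp add: order_antisym)

lemma least_above_greater: "y \<in> c \<Longrightarrow> x \<le> y \<Longrightarrow> x \<notin> c \<Longrightarrow> x < least_above c x"
  using least_above[of y c x] by (metis le_less)

lemma least_above_cong:
  assumes "y \<in> c" "z \<le> y" "x \<le> z" "\<And>w. w \<in> c \<Longrightarrow> x \<le> w \<Longrightarrow> z \<le> w"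
  shows "least_above c x = least_above c z"
proof (rule order_antisym)
  show "least_above c x \<le> least_above c z"
    using least_above[OF assms(1,2)] assms(3) by (intro least_above(3)) auto
  have "x \<le> y"
    using assms(2,3) by simp
  from least_above[OF assms(1) this] show "least_above c z \<le> least_above c x"
    using assms(4) by (intro least_above(3)) auto
qed

lemma cofin_ladder: "cofin {..<\<alpha>} (ladder f \<alpha>)"
  unfolding ladder_def by (rule cofin_lr_max)

lemma ladder_subset: "ladder f \<alpha> \<subseteq> {..<\<alpha>}"
  using cofin_ladder unfolding cofin_def by blast

lemma ladder_above: "x < \<alpha> \<Longrightarrow> \<exists>y\<in>ladder f \<alpha>. x \<le> y"
  using cofin_ladder unfolding cofin_def by blast

lemma incr_on_ladder: "inj_on (f \<alpha>) {..<\<alpha>} \<Longrightarrow> incr_on (ladder f \<alpha>) (f \<alpha>)"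
  unfolding ladder_def by (rule incr_on_lr_max)

text \<open>Each step of the walk leads to a smaller ordinal that is still above \<open>x\<close>
  until \<open>x\<close> is met, so the walk ends.\<close>

lemma ex_reach_ladder: "x < \<alpha> \<Longrightarrow> \<exists>n. reach f n (ladder f \<alpha>) x"
proof (induction \<alpha> rule: less_induct)
  case (less \<alpha>)
  show ?case
  proof (cases "x \<in> ladder f \<alpha>")
    case True
    then show ?thesis
      by (intro exI[of _ 0]) simp
  next
    case False
    obtain y where y: "y \<in> ladder f \<alpha>" "x \<le> y"
      using ladder_above[OF less.prems] by blast
    from least_above(1)[OF y] have "least_above (ladder f \<alpha>) x < \<alpha>"
      using ladder_subset by blast
    moreover have "x < least_above (ladder f \<alpha>) x"
      by (rule least_above_greater[OF y False])
    ultimately obtain n where "reach f n (ladder f (least_above (ladder f \<alpha>) x)) x"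
      using less.IH by blast
    then show ?thesis
      by (intro exI[of _ "Suc n"]) simp
  qed
qed

lemma ex_reach:
  assumes "y \<in> c" "x \<le> y"
  shows "\<exists>n. reach f n c x"
proof (cases "x \<in> c")
  case True
  then show ?thesis
    by (intro exI[of _ 0]) simp
next
  case False
  then obtain n where "reach f n (ladder f (least_above c x)) x"
    using ex_reach_ladder least_above_greater[OF assms] by blast
  then show ?thesis
    by (intro exI[of _ "Suc n"]) simp
qed

text \<open>A walk consults its starting set only through the least point at or above
  \<open>x\<close>, and that point survives the cut at \<delta>.\<close>

lemma reach_cong:
  assumes "y \<in> c" "x \<le> y" "y < \<delta>" "c' = c \<inter> {..<\<delta>}"
  shows "reach f n c x \<longleftrightarrow> reach f n c' x"
proof -
  have y: "y \<in> c'"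
    using assms by blast
  have "least_above c x = least_above c' x"
  proof (rule order_antisym)
    show "least_above c x \<le> least_above c' x"
      using least_above[OF y assms(2)] assms(4) by (intro least_above(3)) auto
    have "least_above c x < \<delta>"
      using least_above(3)[OF assms(1,2)] assms(3) by simp
    then show "least_above c' x \<le> least_above c x"
      using least_above(1,2)[OF assms(1,2)] assms(4) by (intro least_above(3)) auto
  qed
  moreover have "x \<in> c \<longleftrightarrow> x \<in> c'"
    using assms by auto
  ultimately show ?thesis
    by (cases n) auto
qed

text \<open>
  Here the cofinality of \<open>x\<close> matters: every stage of the walk to \<open>x\<close> is bounded below \<open>x\<close>, so a
  point slightly below \<open>x\<close> is walked to through \<open>x\<close> and needs a further step.
\<close>

lemma reach_isolated:
  assumes "reach f n c x" "\<And>m. m < n \<Longrightarrow> \<not> reach f m c x"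
    and "y \<in> c" "x \<le> y" "\<And>y. y \<in> c \<Longrightarrow> |c \<inter> {..<y}| <o |{..<l}|"
    and "cof_ge |{..<l}| {..<x}"
    and f: "\<And>\<alpha>. \<alpha> \<le> y \<Longrightarrow> inj_on (f \<alpha>) {..<\<alpha>} \<and> f \<alpha> ` {..<\<alpha>} \<subseteq> {..<l}"
    and l: "\<And>i. i < l \<Longrightarrow> |{..<i}| <o |{..<l}|"
  shows "\<exists>b<x. \<forall>z. b < z \<and> z < x \<longrightarrow> \<not> reach f n c z"
  using assms(1-5) f
proof (induction n arbitrary: c y)
  case (0 c y)
  then have "|c \<inter> {..<x}| <o |{..<l}|"
    by simp
  then have "\<exists>b\<in>{..<x}. \<forall>z\<in>c \<inter> {..<x}. z < b"
    by (intro cof_geD[OF assms(6)]) auto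
  then show ?case
    by (metis IntI lessThan_iff order.asym reach.simps(1))
next
  case (Suc n c y)
  define w where "w = least_above c x"
  have "x \<notin> c"
    using Suc.prems(2)[of 0] by simp
  then have w: "w \<in> c" "x < w" "w \<le> y"
    unfolding w_def using least_above[OF Suc.prems(3,4)] least_above_greater[OF Suc.prems(3,4)] by auto
  have "|c \<inter> {..<x}| \<le>o |c \<inter> {..<w}|"
    using w by (intro card_of_mono1) auto
  then have "|c \<inter> {..<x}| <o |{..<l}|"
    using Suc.prems(5)[OF w(1)] ordLeq_ordLess_trans by blast
  then have "\<exists>b\<in>{..<x}. \<forall>z\<in>c \<inter> {..<x}. z < b"
    by (intro cof_geD[OF assms(6)]) auto
  then obtain b1 where b1: "b1 < x" "\<And>z. z \<in> c \<Longrightarrow> z < x \<Longrightarrow> z < b1"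
    by auto
  have r: "reach f n (ladder f w) x"
    using Suc.prems(1) \<open>x \<notin> c\<close> by (simp add: w_def)
  have nr: "\<not> reach f m (ladder f w) x" if "m < n" for m
    using Suc.prems(2)[of "Suc m"] that by (simp add: w_def)
  obtain v where v: "v \<in> ladder f w" "x \<le> v"
    using ladder_above[OF w(2)] by blast
  have "v < w"
    using v(1) ladder_subset by blast
  have fw: "inj_on (f w) {..<w}" "f w ` {..<w} \<subseteq> {..<l}"
    using Suc.prems(6)[of w] w(3) by (auto simp: le_less)
  have small: "|ladder f w \<inter> {..<u}| <o |{..<l}|" if "u \<in> ladder f w" for u
  proof -
    have "f w u < l"
      using that fw(2) ladder_subset by blast
    from card_initial_of_incr[OF incr_on_ladder[of f, OF fw(1)] that] l[OF this]
    show ?thesis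
      by (rule ordLeq_ordLess_trans)
  qed
  have "\<exists>b<x. \<forall>z. b < z \<and> z < x \<longrightarrow> \<not> reach f n (ladder f w) z"
  proof (rule Suc.IH[OF r nr v small])
    fix \<alpha> assume "\<alpha> \<le> v"
    then have "\<alpha> \<le> y"
      using \<open>v < w\<close> w(3) by simp
    then show "inj_on (f \<alpha>) {..<\<alpha>} \<and> f \<alpha> ` {..<\<alpha>} \<subseteq> {..<l}"
      by (rule Suc.prems(6))
  qed
  then obtain b2 where b2: "b2 < x" "\<And>z. b2 < z \<Longrightarrow> z < x \<Longrightarrow> \<not> reach f n (ladder f w) z"
    by blast
  have "\<not> reach f (Suc n) c z" if "max b1 b2 < z" "z < x" for z
  proof -
    have "z \<notin> c"
      using b1(2)[of z] that by auto
    \<comment> \<open>Beyond \<open>b1\<close> no point of \<open>c\<close> lies between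
      \<open>z\<close> and \<open>x\<close>, so the walks to both begin with
      \<open>w\<close>.\<close>
    moreover have "least_above c z = w"
      unfolding w_def
    proof (rule least_above_cong[OF Suc.prems(3,4)])
      show "z \<le> x"
        using that by simp
      fix u assume "u \<in> c" "z \<le> u"
      then show "x \<le> u"
        using b1(2)[of u] that by (metis le_less_trans less_asym max_less_iff_conj not_le)
    qed
    ultimately show ?thesis
      using b2(2) that by simp
  qed
  then show ?case
    using b1(1) b2(1) by (intro exI[of _ "max b1 b2"]) auto
qed

text \<open>
  A point of \<open>c\<close> is coded with the top digit \<open>s (s (q x))\<close>, the points which are walked to through
  it get the smaller digit \<open>s (q x)\<close>. A point of \<open>c\<close> may still share its top digit with the points walked
  to through its successor in \<open>c\<close>; then the next digit decides, which is zero for the former only.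
\<close>

primrec code :: "('a \<Rightarrow> 'a) \<Rightarrow> 'a \<Rightarrow> ('a \<Rightarrow> 'a \<Rightarrow> 'a) \<Rightarrow> nat \<Rightarrow> 'a set \<Rightarrow> ('a \<Rightarrow> 'a) \<Rightarrow> 'a \<Rightarrow> nat \<Rightarrow> 'a" where
  "code s z f 0 c q x = (\<lambda>m. if m = 0 then s (s (q x)) else z)"
| "code s z f (Suc n) c q x = (if x \<in> c then (\<lambda>m. if m = Suc n then s (s (q x)) else z)
     else (code s z f n (ladder f (least_above c x)) (f (least_above c x)) x)
            (Suc n := s (q (least_above c x))))"

lemma code_above: "m > n \<Longrightarrow> code s z f n c q x m = z"
  by (induction n arbitrary: c q) auto

text \<open>The bound by \<open>l\<close> makes the digits admissible for the power
  \<lambda>^\<omega>; the nonzero digit in place \<open>n\<close> breaks the ties in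
  \<open>code_less\<close>.\<close>

lemma code_range:
  assumes "reach f n c x" "u \<in> c" "x \<le> u" "q ` c \<subseteq> {..<l}"
    and f: "\<And>\<alpha>. \<alpha> \<le> u \<Longrightarrow> f \<alpha> ` {..<\<alpha>} \<subseteq> {..<l}"
    and s: "\<And>i. i < l \<Longrightarrow> i < s i \<and> s i < l"
    and z: "\<And>i. z \<le> i" "z < l"
  shows "code s z f n c q x m < l \<and> z < code s z f n c q x n"
  using assms(1-4) f
proof (induction n arbitrary: c q u)
  case (0 c q u)
  then have "q x < l"
    by auto
  then have "s (s (q x)) < l" "q x < s (s (q x))"
    using s by (blast, meson less_trans s)
  then show ?case
    using z le_less_trans[OF z(1)] by auto
next
  case (Suc n c q u)
  define w where "w = least_above c x"
  have w: "w \<in> c" "x \<le> w" "w \<le> u"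
    unfolding w_def using least_above[OF Suc.prems(2,3)] by auto
  then have "q w < l"
    using Suc.prems(4) by auto
  then have q: "s (s (q w)) < l" "q w < s (s (q w))" "s (q w) < l" "q w < s (q w)"
    using s by (blast, meson less_trans s, blast, blast)
  show ?case
  proof (cases "x \<in> c")
    case True
    then have "w = x"
      using least_above_eq w_def by simp
    then show ?thesis
      using True q z le_less_trans[OF z(1)] by auto
  next
    case False
    then have "x < w"
      using w by (metis le_less)
    then obtain v where v: "v \<in> ladder f w" "x \<le> v"
      using ladder_above by blast
    have "v < w"
      using v(1) ladder_subset by blast
    have "code s z f n (ladder f w) (f w) x m < l \<and> z < code s z f n (ladder f w) (f w) x n"
    proof (rule Suc.IH[OF _ v])
      show "reach f n (ladder f w) x"
        using Suc.prems(1) False by (simp add: w_def)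
      show "f w ` ladder f w \<subseteq> {..<l}"
        using Suc.prems(5)[OF w(3)] ladder_subset by blast
      fix \<alpha> assume "\<alpha> \<le> v"
      then have "\<alpha> \<le> u"
        using \<open>v < w\<close> w(3) by simp
      then show "f \<alpha> ` {..<\<alpha>} \<subseteq> {..<l}"
        by (rule Suc.prems(5))
    qed
    then show ?thesis
      using False q le_less_trans[OF z(1)] unfolding w_def by auto
  qed
qed

lemma code_less:
  assumes "reach f n c x" "reach f n c y" "x < y"
    and "u \<in> c" "y \<le> u"
    and "incr_on c q" "q ` c \<subseteq> {..<l}"
    and f: "\<And>\<alpha>. \<alpha> \<le> u \<Longrightarrow> inj_on (f \<alpha>) {..<\<alpha>} \<and> f \<alpha> ` {..<\<alpha>} \<subseteq> {..<l}"
    and s: "\<And>i. i < l \<Longrightarrow> i < s i \<and> s i < l" "\<And>i j. i < j \<Longrightarrow> j < l \<Longrightarrow> s i \<le> j"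
    and z: "\<And>i. z \<le> i" "z < l"
  shows "\<exists>m. code s z f n c q x m < code s z f n c q y m \<and>
    (\<forall>k>m. code s z f n c q x k = code s z f n c q y k)"
  using assms(1-7) f
proof (induction n arbitrary: c q u)
  case (0 c q u)
  then have q: "q x < q y" "q x < l" "q y < l"
    unfolding incr_on_def by auto
  then have "s (q x) \<le> q y"
    using s(2) by blast
  also have "q y < s (q y)"
    using s(1) q by blast
  finally have "s (s (q x)) \<le> s (q y)"
    using s q by blast
  also have "s (q y) < s (s (q y))"
    using s(1) q by blast
  finally show ?case
    by (intro exI[of _ 0]) auto
next
  case (Suc n c q u)
  define v where "v = least_above c x"
  define w where "w = least_above c y"
  have "x \<le> u"
    using Suc.prems(3,5) by simp
  then have v: "v \<in> c" "x \<le> v" "v \<le> u"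
    unfolding v_def using least_above[OF Suc.prems(4)] by auto
  have w: "w \<in> c" "y \<le> w" "w \<le> u"
    unfolding w_def using least_above[OF Suc.prems(4,5)] by auto
  have "v \<le> w"
    unfolding v_def using Suc.prems(3) w by (intro least_above(3)) auto
  have ql: "q v < l" "q w < l"
    using Suc.prems(7) v(1) w(1) by auto
  let ?X = "code s z f (Suc n) c q x" and ?Y = "code s z f (Suc n) c q y"
  \<comment> \<open>The first stops \<open>v\<close> and \<open>w\<close> of the two walks decide
    the top digits. If they agree and \<open>y\<close> is not yet reached, the comparison passes to
    the ladder of \<open>w\<close>.\<close>
  show ?case
  proof (cases "v = w")
    case True
    have "x \<notin> c"
      using True w(2) Suc.prems(3) least_above_eq[of x c] unfolding v_def by auto
    show ?thesis
    proof (cases "y \<in> c")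
      case yc: True
      then have "y = w"
        using least_above_eq w_def by simp
      have "s (q w) < s (s (q w))"
        using s(1) ql by blast
      then show ?thesis
        using \<open>x \<notin> c\<close> yc \<open>v = w\<close> \<open>y = w\<close> 
        by (intro exI[of _ "Suc n"]) (simp add: code_above flip: v_def)
    next
      case False
      then have "y < w"
        using w(2) w_def least_above_greater[OF Suc.prems(4,5)] by blast
      then obtain u' where u': "u' \<in> ladder f w" "y \<le> u'"
        using ladder_above by blast
      have "u' < w"
        using u'(1) ladder_subset by blast
      have fw: "inj_on (f w) {..<w}" "f w ` {..<w} \<subseteq> {..<l}"
        using Suc.prems(8)[OF w(3)] by auto
      have "\<exists>m. code s z f n (ladder f w) (f w) x m < code s z f n (ladder f w) (f w) y m \<and>
        (\<forall>k>m. code s z f n (ladder f w) (f w) x k = code s z f n (ladder f w) (f w) y k)"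
      proof (rule Suc.IH[OF _ _ Suc.prems(3) u' incr_on_ladder[of f, OF fw(1)]])
        show "reach f n (ladder f w) x" "reach f n (ladder f w) y"
          using Suc.prems(1,2) False \<open>x \<notin> c\<close> True by (auto simp: w_def v_def)
        show "f w ` ladder f w \<subseteq> {..<l}"
          using fw(2) ladder_subset by blast
        fix \<alpha> assume "\<alpha> \<le> u'"
        then have "\<alpha> \<le> u"
          using \<open>u' < w\<close> w(3) by simp
        then show "inj_on (f \<alpha>) {..<\<alpha>} \<and> f \<alpha> ` {..<\<alpha>} \<subseteq> {..<l}"
          by (rule Suc.prems(8))
      qed
      then obtain m where m: "code s z f n (ladder f w) (f w) x m < code s z f n (ladder f w) (f w) y m"
        "\<And>k. k > m \<Longrightarrow> code s z f n (ladder f w) (f w) x k = code s z f n (ladder f w) (f w) y k"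
        by blast
      have "m \<le> n"
        using m(1) by (rule_tac ccontr) (simp add: code_above)
      then show ?thesis
        using m \<open>x \<notin> c\<close> False \<open>v = w\<close>
        by (intro exI[of _ m]) (auto simp flip: v_def w_def)
    qed
  next
    case False
    then have "v < w"
      using \<open>v \<le> w\<close> by simp
    then have "q v < q w"
      using Suc.prems(6) v(1) w(1) unfolding incr_on_def by blast
    then have a: "s (q v) \<le> q w" "q w < s (q w)" "s (q w) < s (s (q w))" "q v < s (q v)"
      using s ql by blast+
    then have b: "s (s (q v)) \<le> s (q w)"
      using s ql by (meson le_less_trans)
    have X: "?X (Suc n) = (if x \<in> c then s (s (q v)) else s (q v))"
      using least_above_eq[of x c] by (auto simp: v_def)
    have Y: "?Y (Suc n) = (if y \<in> c then s (s (q w)) else s (q w))"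
      using least_above_eq[of y c] by (auto simp: w_def)
    show ?thesis
    proof (cases "?X (Suc n) < ?Y (Suc n)")
      case True
      then show ?thesis
        using code_above[of "Suc n"] by (intro exI[of _ "Suc n"]) (simp del: code.simps)
    next
      case nless: False
      \<comment> \<open>The only possible tie: \<open>x\<close> is in \<open>c\<close>,
        \<open>y\<close> is not, and \<open>q w\<close> is the successor of \<open>q v\<close>. Then
        place \<open>n\<close> holds zero for \<open>x\<close> and a larger digit for
        \<open>y\<close>.\<close>
      have xc: "x \<in> c" and yc: "y \<notin> c"
        using nless a b unfolding X Y by (auto split: if_splits dest: le_less_trans)
      have eq: "?X (Suc n) = ?Y (Suc n)"
        using nless b xc yc unfolding X Y by auto
      have "y < w"
        using w(2) w_def least_above_greater[OF Suc.prems(4,5) yc] by blast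
      then obtain u' where u': "u' \<in> ladder f w" "y \<le> u'"
        using ladder_above by blast
      have "u' < w"
        using u'(1) ladder_subset by blast
      have "z < code s z f n (ladder f w) (f w) y n"
      proof (rule conjunct2[OF code_range[OF _ u' _ _ s(1) z]])
        show "reach f n (ladder f w) y"
          using Suc.prems(2) yc by (simp add: w_def)
        show "f w ` ladder f w \<subseteq> {..<l}"
          using Suc.prems(8)[OF w(3)] ladder_subset by blast
        fix \<alpha> assume "\<alpha> \<le> u'"
        then have "\<alpha> \<le> u"
          using \<open>u' < w\<close> w(3) by simp
        then show "f \<alpha> ` {..<\<alpha>} \<subseteq> {..<l}"
          using Suc.prems(8) by blast
      qed
      then have "?X n < ?Y n"
        using xc yc by (simp add: w_def)
      moreover have "?X k = ?Y k" if "k > n" for k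
        using eq code_above[of "Suc n" k s z f c q] that
        by (cases "k = Suc n") (simp_all del: code.simps)
      ultimately show ?thesis
        by blast
    qed
  qed
qed

end

subsection \<open>Coherent approximations\<close>

context wellorder
begin

definition approx :: "('a \<Rightarrow> 'a \<Rightarrow> 'a) \<Rightarrow> 'a \<Rightarrow> 'a \<Rightarrow> 'a set" where
  "approx f i \<delta> = {\<beta>. \<beta> < \<delta> \<and> f \<delta> \<beta> < i}"

text \<open>Agreement is demanded only at points of uncountable cofinality, because an index is
  closed off in \<omega> steps.\<close>

definition coherent :: "('a \<Rightarrow> 'a \<Rightarrow> 'a) \<Rightarrow> 'a \<Rightarrow> 'a \<Rightarrow> bool" where
  "coherent f i \<delta> \<longleftrightarrow> cofin {..<\<delta>} (approx f i \<delta>) \<and>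
     (\<forall>\<gamma><\<delta>. cof_gt natLeq {..<\<gamma>} \<and> cofin {..<\<gamma>} (approx f i \<delta> \<inter> {..<\<gamma>}) \<longrightarrow>
        approx f i \<gamma> = approx f i \<delta> \<inter> {..<\<gamma>})"

lemma approx_subset: "approx f i \<delta> \<subseteq> {..<\<delta>}"
  by (auto simp: approx_def)

lemma approx_mono: "i \<le> j \<Longrightarrow> approx f i \<delta> \<subseteq> approx f j \<delta>"
  by (auto simp: approx_def)

lemma card_approx:
  assumes "inj_on (f \<delta>) {..<\<delta>}" "i < l" "\<And>i. i < l \<Longrightarrow> |{..<i}| <o |{..<l}|"
  shows "|approx f i \<delta>| <o |{..<l}|"
proof -
  have "|approx f i \<delta>| \<le>o |{..<i}|"
    by (rule card_of_ordLeqI[of "f \<delta>"]) (use assms(1) in \<open>auto simp: approx_def inj_on_def\<close>)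
  then show ?thesis
    using assms(2,3) ordLeq_ordLess_trans by blast
qed

definition eventually_below :: "'a \<Rightarrow> ('a \<Rightarrow> bool) \<Rightarrow> bool" where
  "eventually_below l P \<longleftrightarrow> (\<exists>b<l. \<forall>j. b \<le> j \<and> j < l \<longrightarrow> P j)"

lemma eventually_below_conj: "eventually_below l P \<Longrightarrow> eventually_below l Q \<Longrightarrow> eventually_below l (\<lambda>j. P j \<and> Q j)"
  unfolding eventually_below_def
proof (elim exE conjE)
  fix b c assume "b < l" "c < l" "\<forall>j. b \<le> j \<and> j < l \<longrightarrow> P j" "\<forall>j. c \<le> j \<and> j < l \<longrightarrow> Q j"
  then show "\<exists>b<l. \<forall>j. b \<le> j \<and> j < l \<longrightarrow> P j \<and> Q j"
    by (intro exI[of _ "max b c"]) auto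
qed

text \<open>Fewer than \<open>l\<close> many thresholds have a common bound below the regular
  \<open>l\<close>.\<close>

lemma eventually_below_ball:
  assumes "cof_ge |{..<l}| {..<l}" "|X| <o |{..<l}|" "\<And>x. x \<in> X \<Longrightarrow> eventually_below l (P x)"
  shows "eventually_below l (\<lambda>j. \<forall>x\<in>X. P x j)"
proof -
  obtain b where b: "\<And>x. x \<in> X \<Longrightarrow> b x < l" "\<And>x j. x \<in> X \<Longrightarrow> b x \<le> j \<Longrightarrow> j < l \<Longrightarrow> P x j"
    using assms(3) unfolding eventually_below_def by metis
  have "b ` X \<subseteq> {..<l}" "|b ` X| <o |{..<l}|"
    using b(1) assms(2) card_of_image ordLeq_ordLess_trans by blast+
  from cof_geD[OF assms(1) this] obtain c where "c < l" "\<And>x. x \<in> X \<Longrightarrow> b x < c"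
    by auto
  then show ?thesis
    unfolding eventually_below_def using b(2) by (meson less_imp_le order_trans)
qed

lemma eventually_below_less: "cof_gt natLeq {..<l} \<Longrightarrow> v < l \<Longrightarrow> eventually_below l (\<lambda>j. v < j)"
  unfolding eventually_below_def using cof_gt_lessThan_gt[of l v] less_le_trans by blast

text \<open>The index \<open>i\<close> is the supremum of \<omega> stages. Each stage closes off the
  previous one against \<open>f \<delta>\<close> and against \<open>f y\<close> for the fewer than
  \<open>l\<close> many points \<open>y\<close> captured so far; regularity of \<open>l\<close>
  keeps every stage below \<open>l\<close>.\<close>

lemma ex_coherent:
  assumes f: "\<And>\<alpha>. \<alpha> \<le> \<delta> \<Longrightarrow> inj_on (f \<alpha>) {..<\<alpha>} \<and> f \<alpha> ` {..<\<alpha>} \<subseteq> {..<l}"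
    and l: "\<And>i. i < l \<Longrightarrow> |{..<i}| <o |{..<l}|" "cof_ge |{..<l}| {..<l}" "natLeq <o |{..<l}|"
    and Z: "cofin {..<\<delta>} Z" "|Z| <o |{..<l}|"
  shows "\<exists>i<l. coherent f i \<delta>"
proof -
  have cl: "cof_gt natLeq {..<l}"
    using l(2,3) by (rule cof_ge_imp_gt)
  \<comment> \<open>The least strict upper bound of the points captured below \<open>y\<close>;
    through it the limit points of a stage enter the next stage.\<close>
  define lub where "lub i y = (LEAST s. approx f i \<delta> \<inter> {..<y} \<subseteq> {..<s})" for i y
  have lub_le: "lub i y \<le> y" for i y
    unfolding lub_def by (rule Least_le) blast
  \<comment> \<open>The first two clauses compare the enumerations of \<open>y\<close> and of
    \<delta> in both directions; the third captures the limit \<open>lub i y\<close>.\<close>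
  define Q where "Q i y j \<longleftrightarrow> (\<forall>\<gamma>\<in>approx f i y. f \<delta> \<gamma> < j) \<and>
    (\<forall>\<gamma>\<in>approx f i \<delta>. \<gamma> < y \<longrightarrow> f y \<gamma> < j) \<and> f \<delta> (lub i y) < j" for i y j
  have f_less: "f \<alpha> \<gamma> < l" if "\<gamma> < \<alpha>" "\<alpha> \<le> \<delta>" for \<alpha> \<gamma>
    using f[OF that(2)] that(1) by blast
  have small: "|approx f i \<alpha>| <o |{..<l}|" if "i < l" "\<alpha> \<le> \<delta>" for i \<alpha>
    using f[OF that(2)] that(1) l(1) by (blast intro: card_approx)
  have step: "\<exists>j<l. i < j \<and> (\<forall>y\<in>approx f i \<delta>. Q i y j)" if i: "i < l" for i
  proof -
    have "eventually_below l (\<lambda>j. \<forall>y\<in>approx f i \<delta>. Q i y j)"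
    proof (rule eventually_below_ball[OF l(2) small[OF i order_refl]])
      fix y assume "y \<in> approx f i \<delta>"
      then have y: "y < \<delta>"
        by (simp add: approx_def)
      have "eventually_below l (\<lambda>j. \<forall>\<gamma>\<in>approx f i y. f \<delta> \<gamma> < j)"
        by (intro eventually_below_ball l(2) small i eventually_below_less cl f_less) (use y in \<open>auto simp: approx_def\<close>)
      moreover have "eventually_below l (\<lambda>j. \<forall>\<gamma>\<in>approx f i \<delta>. \<gamma> < y \<longrightarrow> f y \<gamma> < j)"
      proof (rule eventually_below_ball[OF l(2) small[OF i order_refl]])
        fix \<gamma>
        show "eventually_below l (\<lambda>j. \<gamma> < y \<longrightarrow> f y \<gamma> < j)"
        proof (cases "\<gamma> < y")
          case True
          then show ?thesis
            using eventually_below_less[OF cl f_less[of \<gamma> y]] y by simp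
        next
          case False
          then show ?thesis
            using i by (auto simp: eventually_below_def)
        qed
      qed
      moreover have "eventually_below l (\<lambda>j. f \<delta> (lub i y) < j)"
        using lub_le[of i y] y by (intro eventually_below_less cl f_less) auto
      ultimately show "eventually_below l (Q i y)"
        unfolding Q_def by (intro eventually_below_conj)
    qed
    with eventually_below_less[OF cl i] have "eventually_below l (\<lambda>j. i < j \<and> (\<forall>y\<in>approx f i \<delta>. Q i y j))"
      by (rule eventually_below_conj)
    then show ?thesis
      unfolding eventually_below_def by blast
  qed
  have "\<exists>i0<l. Z \<subseteq> approx f i0 \<delta>"
  proof -
    have Zs: "Z \<subseteq> {..<\<delta>}"
      using Z(1) by (simp add: cofin_def)
    then have "f \<delta> ` Z \<subseteq> {..<l}"
      using f_less by auto
    moreover have "|f \<delta> ` Z| <o |{..<l}|"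
      using card_of_image Z(2) by (rule ordLeq_ordLess_trans)
    ultimately have "\<exists>b\<in>{..<l}. \<forall>x\<in>f \<delta> ` Z. x < b"
      by (rule cof_geD[OF l(2)])
    then show ?thesis
      using Zs by (auto simp: approx_def)
  qed
  then obtain i0 where i0: "i0 < l" "Z \<subseteq> approx f i0 \<delta>"
    by blast
  have "\<exists>s. \<forall>n. (s n < l \<and> i0 \<le> s n) \<and> (s n < s (Suc n) \<and> (\<forall>y\<in>approx f (s n) \<delta>. Q (s n) y (s (Suc n))))"
  proof (rule dependent_nat_choice)
    show "\<exists>x. x < l \<and> i0 \<le> x"
      using i0(1) by blast
    fix x assume x: "x < l \<and> i0 \<le> x"
    then obtain j where "j < l" "x < j" "\<forall>y\<in>approx f x \<delta>. Q x y j"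
      using step by blast
    then show "\<exists>y. (y < l \<and> i0 \<le> y) \<and> x < y \<and> (\<forall>w\<in>approx f x \<delta>. Q x w y)"
      using x by (intro exI[of _ j]) auto
  qed
  then obtain s where s: "\<And>n. s n < l \<and> i0 \<le> s n"
    "\<And>n. s n < s (Suc n) \<and> (\<forall>y\<in>approx f (s n) \<delta>. Q (s n) y (s (Suc n)))"
    by blast
  have s_mono: "s m \<le> s n" if "m \<le> n" for m n
    using that
  proof (induction rule: dec_induct)
    case (step n)
    then show ?case
      using s(2)[of n] by (meson less_imp_le order_trans)
  qed simp
  have "range s \<subseteq> {..<l}"
    using s(1) by auto
  from cof_gt_lub[OF cl down_closed_lessThan this]
  obtain i where i: "i < l" "\<And>n. s n < i" "\<And>x. x < i \<Longrightarrow> \<exists>n. x \<le> s n"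
    by auto
  have ex_stage: "\<exists>k\<ge>n. x < s k" if "x < i" for x n
  proof -
    obtain m where "x \<le> s m"
      using i(3)[OF \<open>x < i\<close>] by blast
    also have "s m \<le> s (max m n)"
      by (rule s_mono) simp
    also have "\<dots> < s (Suc (max m n))"
      using s(2) by blast
    finally show ?thesis
      by (intro exI[of _ "Suc (max m n)"]) auto
  qed
  \<comment> \<open>So every stage is cofinal in \<delta> and has a point at or above any given
    \<gamma>.\<close>
  have Zn: "Z \<subseteq> approx f (s n) \<delta>" for n
    using i0(2) approx_mono[of i0 "s n"] s(1) by blast
  have "coherent f i \<delta>"
    unfolding coherent_def
  proof (intro conjI allI impI)
    have "Z \<subseteq> approx f i \<delta>"
      using Zn[of 0] approx_mono[of "s 0" i] i(2)[of 0] by (meson less_imp_le subset_trans)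
    then show "cofin {..<\<delta>} (approx f i \<delta>)"
      using Z(1) approx_subset unfolding cofin_def by blast
    fix \<gamma> assume \<gamma>: "\<gamma> < \<delta>" and "cof_gt natLeq {..<\<gamma>} \<and> cofin {..<\<gamma>} (approx f i \<delta> \<inter> {..<\<gamma>})"
    then have c\<gamma>: "cof_gt natLeq {..<\<gamma>}" and lim: "cofin {..<\<gamma>} (approx f i \<delta> \<inter> {..<\<gamma>})"
      by auto
    \<comment> \<open>If every stage were bounded below \<gamma>, so would be their union, because
      \<gamma> has uncountable cofinality. Hence a single stage accumulates at \<gamma>.\<close>
    have "\<exists>n. cofin {..<\<gamma>} (approx f (s n) \<delta> \<inter> {..<\<gamma>})"
    proof (rule ccontr)
      assume "\<not> ?thesis"
      then have "\<forall>n. \<exists>b<\<gamma>. \<forall>z\<in>approx f (s n) \<delta>. z < \<gamma> \<longrightarrow> z < b"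
        unfolding cofin_def by (metis IntI inf_le2 lessThan_iff not_le)
      then obtain b where b: "\<And>n. b n < \<gamma>" "\<And>n z. z \<in> approx f (s n) \<delta> \<Longrightarrow> z < \<gamma> \<Longrightarrow> z < b n"
        by metis
      have "range b \<subseteq> {..<\<gamma>}"
        using b(1) by auto
      from cof_gt_seq_bound[OF c\<gamma> this] obtain c where c: "c < \<gamma>" "\<And>n. b n < c"
        by auto
      obtain z where z: "z \<in> approx f i \<delta>" "z < \<gamma>" "c \<le> z"
        using lim c(1) unfolding cofin_def by blast
      then obtain n where "f \<delta> z < s n"
        using ex_stage[of "f \<delta> z" 0] by (auto simp: approx_def)
      then have "z < b n"
        using b(2) z by (auto simp: approx_def)
      then show False
        using c(2)[of n] z(3) by simp
    qed
    then obtain n where n: "cofin {..<\<gamma>} (approx f (s n) \<delta> \<inter> {..<\<gamma>})"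
      by blast
    obtain z where z: "z \<in> approx f (s n) \<delta>" "\<gamma> \<le> z"
      using Z(1) Zn[of n] \<gamma> unfolding cofin_def by blast
    \<comment> \<open>Stage \<open>s n\<close> has no point at or above \<gamma> and below
      \<open>y\<close>, so the limit taken below \<open>y\<close> is \<gamma> itself, and the next
      stage captures it.\<close>
    define y where "y = least_above (approx f (s n) \<delta>) \<gamma>"
    have y: "y \<in> approx f (s n) \<delta>" "\<gamma> \<le> y"
      and ly: "\<And>w. w \<in> approx f (s n) \<delta> \<Longrightarrow> \<gamma> \<le> w \<Longrightarrow> y \<le> w"
      unfolding y_def using least_above[OF z] least_above(3) by blast+
    have "approx f (s n) \<delta> \<inter> {..<y} = approx f (s n) \<delta> \<inter> {..<\<gamma>}"
      using y(2) ly by (auto simp: not_le[symmetric])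
    moreover have "(LEAST u. approx f (s n) \<delta> \<inter> {..<\<gamma>} \<subseteq> {..<u}) = \<gamma>"
    proof (rule Least_equality)
      fix u assume u: "approx f (s n) \<delta> \<inter> {..<\<gamma>} \<subseteq> {..<u}"
      show "\<gamma> \<le> u"
      proof (rule ccontr)
        assume "\<not> \<gamma> \<le> u"
        then obtain w where "w \<in> approx f (s n) \<delta> \<inter> {..<\<gamma>}" "u \<le> w"
          using n unfolding cofin_def by (meson lessThan_iff not_le)
        then show False
          using u by (auto simp: not_le[symmetric])
      qed
    qed blast
    ultimately have "lub (s n) y = \<gamma>"
      by (simp add: lub_def)
    then have "f \<delta> \<gamma> < s (Suc n)"
      using s(2)[of n] y(1) unfolding Q_def by auto
    then have \<gamma>_in: "\<gamma> \<in> approx f (s k) \<delta>" if "k \<ge> Suc n" for k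
      using s_mono[OF that] \<gamma> by (auto simp: approx_def)
    have Qk: "Q (s k) \<gamma> (s (Suc k))" if "k \<ge> Suc n" for k
      using s(2)[of k] \<gamma>_in[OF that] by blast
    show "approx f i \<gamma> = approx f i \<delta> \<inter> {..<\<gamma>}"
    proof (intro subset_antisym subsetI)
      fix \<beta> assume \<beta>: "\<beta> \<in> approx f i \<gamma>"
      then obtain k where k: "k \<ge> Suc n" "f \<gamma> \<beta> < s k"
        using ex_stage[of "f \<gamma> \<beta>" "Suc n"] by (auto simp: approx_def)
      then have "f \<delta> \<beta> < s (Suc k)"
        using Qk[OF k(1)] \<beta> unfolding Q_def by (auto simp: approx_def)
      then show "\<beta> \<in> approx f i \<delta> \<inter> {..<\<gamma>}"
        using i(2)[of "Suc k"] \<beta> \<gamma> by (auto simp: approx_def)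
    next
      fix \<beta> assume \<beta>: "\<beta> \<in> approx f i \<delta> \<inter> {..<\<gamma>}"
      then obtain k where k: "k \<ge> Suc n" "f \<delta> \<beta> < s k"
        using ex_stage[of "f \<delta> \<beta>" "Suc n"] by (auto simp: approx_def)
      then have "f \<gamma> \<beta> < s (Suc k)"
        using Qk[OF k(1)] \<beta> unfolding Q_def by (auto simp: approx_def)
      then show "\<beta> \<in> approx f i \<gamma>"
        using i(2)[of "Suc k"] \<beta> by (auto simp: approx_def)
    qed
  qed
  then show ?thesis
    using i(1) by blast
qed

section \<open>Guessing a set by walks from coherent approximations\<close>

definition lim_pt :: "'a set \<Rightarrow> 'a \<Rightarrow> bool" where
  "lim_pt D x \<longleftrightarrow> (\<forall>y<x. \<exists>z\<in>D. y < z \<and> z < x)"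

lemma coherent_approx:
  assumes "coherent f i d" "\<gamma> < d" "cof_gt natLeq {..<\<gamma>}" "cofin {..<\<gamma>} (approx f i d \<inter> {..<\<gamma>})"
  shows "approx f i \<gamma> = approx f i d \<inter> {..<\<gamma>}"
  using assms unfolding coherent_def by blast

text \<open>
  The number of steps needed to reach a point of \<open>A\<close> is the same from \<open>d\<close> and from any \<open>\<delta> < d\<close> at
  which the approximation of \<open>d\<close> accumulates, and a single number \<open>n\<close> serves unboundedly many
  points of \<open>A\<close> below \<open>d\<close>; so it suffices that \<open>h\<close> takes each value stationarily often below \<open>d\<close>.
\<close>

lemma guess_at:
  assumes f: "\<And>\<alpha>. \<alpha> \<le> d \<Longrightarrow> inj_on (f \<alpha>) {..<\<alpha>} \<and> f \<alpha> ` {..<\<alpha>} \<subseteq> {..<l}"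
    and l: "\<And>i. i < l \<Longrightarrow> |{..<i}| <o |{..<l}|" "i < l"
    and T: "\<And>n. stat {..<d} (T n)"
    and T': "\<And>n \<delta>. \<delta> \<in> T n \<Longrightarrow> cof_gt natLeq {..<\<delta>} \<and> cofin {..<\<delta>} (approx f i d \<inter> {..<\<delta>})"
    and d: "coherent f i d" "cof_gt natLeq {..<d}" "mono_map {..<d} G"
    and A: "closed_under (next_in A) d" "\<And>x. x < d \<Longrightarrow> \<exists>y\<in>A. x < y"
      "\<And>\<beta>. \<beta> \<in> A \<Longrightarrow> cof_ge |{..<l}| {..<\<beta>}"
  shows "\<exists>n. \<exists>\<delta>\<in>T n. closed_under G \<delta> \<and> (\<forall>y<\<delta>. \<exists>x\<in>A. y < x \<and> x < \<delta> \<and>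
    reach f n (approx f i \<delta>) x \<and> \<not> lim_pt {x. x < \<delta> \<and> reach f n (approx f i \<delta>) x} x)"
proof -
  define c where "c = approx f i d"
  have cc: "cofin {..<d} c"
    using d(1) by (simp add: coherent_def c_def)
  have nomax: "\<forall>x\<in>{..<d}. \<exists>y\<in>{..<d}. x < y"
    using cof_gt_lessThan_gt[OF d(2)] by auto
  define B where "B n = {x \<in> A. x < d \<and> reach f n c x \<and> (\<forall>m<n. \<not> reach f m c x)}" for n
  \<comment> \<open>Otherwise some \<open>e < d\<close> bounds all the \<open>B n\<close>, by
    uncountable cofinality; but the next point of \<open>A\<close> after \<open>e\<close> is still
    below \<open>d\<close> and belongs to one of them.\<close>
  have "\<exists>n. cofin {..<d} (B n)"
  proof (rule ccontr)
    assume "\<not> ?thesis"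
    have "\<forall>n. \<exists>b<d. \<forall>x\<in>B n. x < b"
    proof (intro allI)
      fix n
      have "B n \<subseteq> {..<d}"
        by (auto simp: B_def)
      then show "\<exists>b<d. \<forall>x\<in>B n. x < b"
        using \<open>\<not> (\<exists>n. cofin {..<d} (B n))\<close> unfolding cofin_def by (metis lessThan_iff not_le)
    qed
    then obtain b where b: "\<And>n. b n < d" "\<And>n x. x \<in> B n \<Longrightarrow> x < b n"
      by metis
    have "range b \<subseteq> {..<d}"
      using b(1) by auto
    from cof_gt_seq_bound[OF d(2) this] obtain e where e: "e < d" "\<And>n. b n < e"
      by auto
    define x where "x = next_in A e"
    have x: "x \<in> A" "e < x"
      unfolding x_def using A(2)[OF e(1)] next_in by blast+
    have "x < d"
      using A(1) e(1) unfolding x_def closed_under_def by blast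
    then obtain y where "y \<in> c" "x \<le> y"
      using cc unfolding cofin_def by blast
    then have ex: "\<exists>n. reach f n c x"
      by (rule ex_reach)
    have "x \<in> B (LEAST n. reach f n c x)"
      unfolding B_def using x(1) \<open>x < d\<close> Orderings.LeastI_ex[OF ex] Orderings.not_less_Least by blast
    then have "x < e"
      using b(2) e(2) by (meson less_trans)
    then show False
      using x(2) by simp
  qed
  then obtain n where n: "cofin {..<d} (B n)"
    by blast
  \<comment> \<open>Being closed under \<open>next_in (B n)\<close>, the \<delta> to be chosen is a
    limit of \<open>B n\<close>.\<close>
  from stat_closed_under[OF stat_closed_under[OF T[of n] d(3)] mono_map_next_in[OF n nomax]]
  have "stat {..<d} {\<beta> \<in> {\<beta> \<in> T n. closed_under G \<beta>}. closed_under (next_in (B n)) \<beta>}" .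
  moreover obtain e where "e < d"
    using cof_gt_lessThan_nonempty[OF d(2)] by blast
  then have "mono_map {..<d} (\<lambda>_. e)"
    by (intro mono_map_const) simp
  ultimately obtain \<delta> where \<delta>: "\<delta> \<in> T n" "closed_under G \<delta>" "closed_under (next_in (B n)) \<delta>"
    unfolding stat_def by blast
  have "\<delta> < d"
    using \<delta>(1) T[of n] unfolding stat_def by blast
  have lim: "cofin {..<\<delta>} (c \<inter> {..<\<delta>})"
    using T'[OF \<delta>(1)] by (simp add: c_def)
  have c': "approx f i \<delta> = c \<inter> {..<\<delta>}"
    unfolding c_def using coherent_approx[OF d(1) \<open>\<delta> < d\<close>] T'[OF \<delta>(1)] by blast
  have "\<exists>x\<in>A. y < x \<and> x < \<delta> \<and> reach f n (approx f i \<delta>) x \<and>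
      \<not> lim_pt {x. x < \<delta> \<and> reach f n (approx f i \<delta>) x} x" if y: "y < \<delta>" for y
  proof -
    define x where "x = next_in (B n) y"
    have x: "x \<in> B n" "y < x"
      unfolding x_def using cofin_next_in[OF n _ nomax] y \<open>\<delta> < d\<close> by auto
    have "x < \<delta>"
      using \<delta>(3) y unfolding x_def closed_under_def by blast
    then obtain w where w: "w \<in> c" "x \<le> w" "w < \<delta>"
      using lim unfolding cofin_def by blast
    \<comment> \<open>The approximation at \<delta> is the cut of \<open>c\<close> and still has the
      point \<open>w\<close> at or above \<open>x\<close>, so walks from it and from
      \<open>c\<close> take the same number of steps.\<close>
    have r: "reach f m c x \<longleftrightarrow> reach f m (approx f i \<delta>) x" for m
      using w c' by (rule reach_cong)
    have fd: "inj_on (f \<alpha>) {..<\<alpha>} \<and> f \<alpha> ` {..<\<alpha>} \<subseteq> {..<l}" if "\<alpha> \<le> \<delta>" for \<alpha>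
      using f[of \<alpha>] that \<open>\<delta> < d\<close> by simp
    have small: "|approx f i \<delta> \<inter> {..<u}| <o |{..<l}|" for u
    proof -
      have "|approx f i \<delta> \<inter> {..<u}| \<le>o |approx f i \<delta>|"
        by (rule card_of_mono1) blast
      also have "|approx f i \<delta>| <o |{..<l}|"
        using fd[of \<delta>] l by (intro card_approx) auto
      finally show ?thesis .
    qed
    have "\<exists>b<x. \<forall>z. b < z \<and> z < x \<longrightarrow> \<not> reach f n (approx f i \<delta>) z"
    proof (rule reach_isolated[OF _ _ _ w(2) small _ _ l(1)])
      show "reach f n (approx f i \<delta>) x"
        using x(1) r by (simp add: B_def)
      show "\<not> reach f m (approx f i \<delta>) x" if "m < n" for m
        using x(1) r that by (simp add: B_def)
      show "w \<in> approx f i \<delta>"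
        using w c' by simp
      show "cof_ge |{..<l}| {..<x}"
        using A(3) x(1) by (simp add: B_def)
      show "inj_on (f \<alpha>) {..<\<alpha>} \<and> f \<alpha> ` {..<\<alpha>} \<subseteq> {..<l}" if "\<alpha> \<le> w" for \<alpha>
        using fd[of \<alpha>] that w(3) by simp
    qed
    then have "\<not> lim_pt {x. x < \<delta> \<and> reach f n (approx f i \<delta>) x} x"
      unfolding lim_pt_def by blast
    then show ?thesis
      using x \<open>x < \<delta>\<close> r by (auto simp: B_def)
  qed
  then show ?thesis
    using \<delta>(1,2) by blast
qed

text \<open>A monotone map on \<open>F\<close> restricts to some \<open>d\<close> in
  \<open>S1\<close> that is closed under it and under the passage to the next point of
  \<open>A\<close>; below this \<open>d\<close> the guess comes from
  \<open>guess_at\<close>.\<close>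

lemma stat_guess:
  assumes F: "down_closed F" "cof_gt natLeq F" "cofin F A"
    and f: "\<And>\<alpha>. \<alpha> \<in> F \<Longrightarrow> inj_on (f \<alpha>) {..<\<alpha>} \<and> f \<alpha> ` {..<\<alpha>} \<subseteq> {..<l}"
    and l: "\<And>i. i < l \<Longrightarrow> |{..<i}| <o |{..<l}|" "i < l"
    and S: "S \<subseteq> F" "\<And>\<delta>. \<delta> \<in> S \<Longrightarrow> cof_gt natLeq {..<\<delta>}"
    and S1: "stat F S1" "\<And>d. d \<in> S1 \<Longrightarrow> coherent f i d \<and> cof_gt natLeq {..<d}"
      "\<And>d n. d \<in> S1 \<Longrightarrow>
        stat {..<d} {\<delta> \<in> S. \<delta> < d \<and> cofin {..<\<delta>} (approx f i d \<inter> {..<\<delta>}) \<and> h \<delta> = n}"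
    and A: "\<And>\<beta>. \<beta> \<in> A \<Longrightarrow> cof_ge |{..<l}| {..<\<beta>}"
  shows "stat F {\<delta> \<in> S. cofin {..<\<delta>} (approx f i \<delta>) \<and>
    (\<forall>y<\<delta>. \<exists>x\<in>A. y < x \<and> x < \<delta> \<and> reach f (h \<delta>) (approx f i \<delta>) x \<and>
      \<not> lim_pt {x. x < \<delta> \<and> reach f (h \<delta>) (approx f i \<delta>) x} x)}" (is "stat F ?S'")
  unfolding stat_def
proof (intro conjI allI impI)
  show "?S' \<subseteq> F"
    using S(1) by blast
  fix G assume G: "mono_map F G"
  have nomax: "\<forall>x\<in>F. \<exists>y\<in>F. x < y"
    using cof_gt_ex_greater[OF F(2) natLeq_Card_order] by (simp add: Field_natLeq)
  have "stat F {d \<in> S1. closed_under (next_in A) d}"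
    by (rule stat_closed_under[OF S1(1) mono_map_next_in[OF F(3) nomax]])
  then obtain d where d: "d \<in> S1" "closed_under (next_in A) d" "closed_under G d"
    using G unfolding stat_def by blast
  have dF: "d \<in> F"
    using d(1) S1(1) unfolding stat_def by blast
  have below: "x \<in> F" if "x \<le> d" for x
    using F(1) dF that unfolding down_closed_def by (metis le_less)
  have "mono_map {..<d} G"
    using d(3) G below unfolding mono_map_def closed_under_def by auto
  moreover have "\<exists>y\<in>A. x < y" if "x < d" for x
    using cofin_next_in(1,2)[OF F(3) below nomax] that by (metis less_imp_le)
  ultimately have "\<exists>n. \<exists>\<delta>\<in>{\<delta> \<in> S. \<delta> < d \<and> cofin {..<\<delta>} (approx f i d \<inter> {..<\<delta>}) \<and> h \<delta> = n}.
    closed_under G \<delta> \<and> (\<forall>y<\<delta>. \<exists>x\<in>A. y < x \<and> x < \<delta> \<and>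
      reach f n (approx f i \<delta>) x \<and> \<not> lim_pt {x. x < \<delta> \<and> reach f n (approx f i \<delta>) x} x)"
    using S1(2)[OF d(1)] S(2) by (intro guess_at[OF f[OF below] l S1(3)[OF d(1)] _ _ _ _ d(2) _ A]) auto
  then obtain n \<delta> where \<delta>: "\<delta> \<in> S" "\<delta> < d" "cofin {..<\<delta>} (approx f i d \<inter> {..<\<delta>})" "h \<delta> = n"
    "closed_under G \<delta>" "\<forall>y<\<delta>. \<exists>x\<in>A. y < x \<and> x < \<delta> \<and>
      reach f n (approx f i \<delta>) x \<and> \<not> lim_pt {x. x < \<delta> \<and> reach f n (approx f i \<delta>) x} x"
    by blast
  moreover have "cofin {..<\<delta>} (approx f i \<delta>)"
    using coherent_approx[of f i d \<delta>] S1(2)[OF d(1)] S(2)[OF \<delta>(1)] \<delta>(2,3) by simp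
  ultimately show "\<exists>\<delta>\<in>?S'. closed_under G \<delta>"
    by blast
qed

end

subsection \<open>Splitting stationary sets\<close>

lemma uncountable_reals: "\<not> countable (UNIV :: (nat \<Rightarrow> bool) set)"
proof
  assume "countable (UNIV :: (nat \<Rightarrow> bool) set)"
  then obtain e :: "nat \<Rightarrow> nat \<Rightarrow> bool" where "range e = UNIV"
    by (metis UNIV_not_empty range_from_nat_into)
  then obtain n where "e n = (\<lambda>k. \<not> e k k)"
    by (metis UNIV_I imageE)
  then show False
    by (metis (full_types))
qed

lemma card_seq_reals: "|UNIV :: (nat \<Rightarrow> nat \<Rightarrow> bool) set| \<le>o |UNIV :: (nat \<Rightarrow> bool) set|"
proof (rule card_of_ordLeqI[of "\<lambda>\<sigma> k. case_prod \<sigma> (prod_decode k)"])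
  show "inj (\<lambda>(\<sigma> :: nat \<Rightarrow> nat \<Rightarrow> bool) k. case_prod \<sigma> (prod_decode k))"
  proof (rule injI, intro ext)
    fix \<sigma> \<tau> :: "nat \<Rightarrow> nat \<Rightarrow> bool" and m n
    assume "(\<lambda>k. case_prod \<sigma> (prod_decode k)) = (\<lambda>k. case_prod \<tau> (prod_decode k))"
    then have "case_prod \<sigma> (prod_decode (prod_encode (m, n))) = case_prod \<tau> (prod_decode (prod_encode (m, n)))"
      by metis
    then show "\<sigma> m n = \<tau> m n"
      by simp
  qed
qed simp

text \<open>
  An uncountable set all of whose proper initial segments are countable has size \<open>\<aleph>\<^sub>1\<close>, hence embeds
  into the reals.
\<close>

lemma initial_countable_inj:
  assumes r: "Well_order r" "B \<subseteq> Field r" and B: "\<And>x. x \<in> Field r \<Longrightarrow> countable (B \<inter> underS r x)"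
  shows "\<exists>\<iota> :: 'x \<Rightarrow> nat \<Rightarrow> bool. inj_on \<iota> B"
proof -
  have wo: "well_order_on B (Restr r B)"
    by (rule well_order_on_Restr[OF r])
  then have WO: "Well_order (Restr r B)" and F: "Field (Restr r B) = B"
    using r by (simp_all add: Well_order_Restr Refl_Field_Restr2 order_on_defs)
  have "|B| \<le>o |UNIV :: (nat \<Rightarrow> bool) set|"
  proof (rule ccontr)
    assume "\<not> ?thesis"
    then have "|UNIV :: (nat \<Rightarrow> bool) set| <o |B|"
      using not_ordLeq_iff_ordLess[OF card_of_Well_order card_of_Well_order] by blast
    also have "|B| \<le>o Restr r B"
      by (rule card_of_least[OF wo])
    finally obtain a where a: "a \<in> B"
      "|UNIV :: (nat \<Rightarrow> bool) set| =o Restr (Restr r B) (underS (Restr r B) a)"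
      using ordLess_iff_ordIso_Restr[OF WO card_of_Well_order] F by blast
    have "|UNIV :: (nat \<Rightarrow> bool) set| =o |Field (Restr (Restr r B) (underS (Restr r B) a))|"
      using card_of_cong[OF a(2)] by (simp add: Field_card_of)
    moreover have "Field (Restr (Restr r B) (underS (Restr r B) a)) \<subseteq> B \<inter> underS r a"
      by (auto simp: Field_def underS_def)
    then have "countable (Field (Restr (Restr r B) (underS (Restr r B) a)))"
      using B a(1) r(2) countable_subset by blast
    ultimately show False
      by (metis countable_card_le_natLeq ordIso_ordLeq_trans uncountable_reals)
  qed
  then show ?thesis
    by (metis card_of_ordLeq)
qed

text \<open>Induction on the cardinality of \<open>X\<close>, well-ordered in its cardinal type. If
  \<open>B\<close> is already uncountable inside a proper initial segment, the family of that
  segment handles it; one extra map handles all remaining \<open>B\<close> at once.\<close>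

lemma ex_real_maps:
  fixes X :: "'x set" and L :: "'l rel"
  assumes L: "Cinfinite L"
  shows "|X| \<le>o L \<Longrightarrow> \<exists>\<G> :: ('x \<Rightarrow> nat \<Rightarrow> bool) set. |\<G>| \<le>o L \<and>
    (\<forall>B\<subseteq>X. \<not> countable B \<longrightarrow> (\<exists>g\<in>\<G>. infinite (g ` B)))"
proof (induction "|X|" arbitrary: X rule: wf_induct_rule[OF wf_ordLess])
  case (1 X)
  define r where "r = |X|"
  have r: "Well_order r" "Field r = X" "Card_order r"
    unfolding r_def by (rule card_of_Well_order, rule Field_card_of, rule card_of_Card_order)
  have "\<exists>\<G> :: ('x \<Rightarrow> nat \<Rightarrow> bool) set. |\<G>| \<le>o L \<and>
    (\<forall>B\<subseteq>underS r x. \<not> countable B \<longrightarrow> (\<exists>g\<in>\<G>. infinite (g ` B)))" if "x \<in> X" for x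
  proof (rule 1(1))
    show "( |underS r x|, |X| ) \<in> ordLess"
      using card_of_underS[OF r(3)] that r(2) by (simp add: r_def)
    then show "|underS r x| \<le>o L"
      using 1(2) by (meson ordLess_imp_ordLeq ordLeq_transitive)
  qed
  then obtain \<G> :: "'x \<Rightarrow> ('x \<Rightarrow> nat \<Rightarrow> bool) set" where \<G>: "\<And>x. x \<in> X \<Longrightarrow> |\<G> x| \<le>o L"
    "\<And>x B. x \<in> X \<Longrightarrow> B \<subseteq> underS r x \<Longrightarrow> \<not> countable B \<Longrightarrow> \<exists>g\<in>\<G> x. infinite (g ` B)"
    by metis
  have fin: "\<not> finite (Field L)" and cL: "Card_order L"
    using L by (auto simp: cinfinite_def)
  let ?thin = "\<lambda>B. B \<subseteq> X \<and> \<not> countable B \<and> (\<forall>x\<in>X. countable (B \<inter> underS r x))"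
  have U: "|\<Union>x\<in>X. \<G> x| \<le>o L"
    using \<G>(1) by (intro card_of_UNION_ordLeq_infinite_Field[OF fin cL 1(2)]) blast
  have not_thin: "\<exists>g\<in>\<Union>x\<in>X. \<G> x. infinite (g ` B)" if B: "B \<subseteq> X" "\<not> countable B" "\<not> ?thin B" for B
  proof -
    obtain x where x: "x \<in> X" "\<not> countable (B \<inter> underS r x)"
      using B by blast
    then obtain g where "g \<in> \<G> x" "infinite (g ` (B \<inter> underS r x))"
      using \<G>(2)[of x "B \<inter> underS r x"] by blast
    then show ?thesis
      using x(1) infinite_super[of "g ` (B \<inter> underS r x)" "g ` B"] by blast
  qed
  show ?case
  proof (cases "\<exists>B0. ?thin B0")
    case False
    show ?thesis
    proof (intro exI[of _ "\<Union>x\<in>X. \<G> x"] conjI U allI impI)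
      fix B assume B: "B \<subseteq> X" "\<not> countable B"
      have "\<not> ?thin B"
        using False by (rule contrapos_nn) (rule exI)
      with B show "\<exists>g\<in>\<Union>x\<in>X. \<G> x. infinite (g ` B)"
        by (rule not_thin)
    qed
  next
    case True
    then obtain B0 where "?thin B0" ..
    then have B0: "B0 \<subseteq> X" "\<not> countable B0" "\<And>x. x \<in> X \<Longrightarrow> countable (B0 \<inter> underS r x)"
      by auto
    obtain \<iota> :: "'x \<Rightarrow> nat \<Rightarrow> bool" where \<iota>: "inj_on \<iota> B0"
      using initial_countable_inj[of r B0] r B0 by auto
    \<comment> \<open>An uncountable set all of whose initial segments are countable is
      unbounded.\<close>
    have "\<exists>b\<in>B0. (x, b) \<in> r" if "x \<in> X" for x
    proof (rule ccontr)
      assume no: "\<not> ?thesis"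
      have "B0 \<subseteq> underS r x"
      proof
        fix b assume b: "b \<in> B0"
        have tot: "total_on X r" "refl_on X r"
          using r(1,2) by (auto simp: order_on_defs)
        have "(x, b) \<notin> r"
          using no b by simp
        moreover from this have "b \<noteq> x"
          using refl_onD[OF tot(2) that] by auto
        moreover have "b \<in> X"
          using b B0(1) ..
        ultimately have "(b, x) \<in> r" "b \<noteq> x"
          using tot(1) that unfolding total_on_def by (metis, metis)
        then show "b \<in> underS r x"
          by (simp add: underS_def)
      qed
      then show False
        using B0(2,3) that by (metis inf.absorb1)
    qed
    then obtain m where m: "\<And>x. x \<in> X \<Longrightarrow> m x \<in> B0 \<and> (x, m x) \<in> r"
      by metis
    \<comment> \<open>Each \<open>x\<close> is labelled by the real attached to a point of
      \<open>B0\<close> at or above it. A fibre of \<open>g0\<close> in a thin set lies at or below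
      one such point, hence is countable.\<close>
    define g0 where "g0 = \<iota> \<circ> m"
    have inf_g0: "infinite (g0 ` B)" if B: "?thin B" for B
    proof
      assume "finite (g0 ` B)"
      have "countable {x \<in> B. g0 x = v}" for v
      proof (cases "\<exists>y\<in>B. g0 y = v")
        case True
        then obtain y where y: "y \<in> B" "g0 y = v"
          by blast
        then have my: "m y \<in> X"
          using m B B0(1) by blast
        have "m x = m y" if "x \<in> B" "g0 x = v" for x
          using \<iota> m that y B unfolding g0_def by (metis comp_apply inj_onD subsetD)
        then have "{x \<in> B. g0 x = v} \<subseteq> insert (m y) (B \<inter> underS r (m y))"
          using m B by (fastforce simp: underS_def)
        then show ?thesis
          using B my by (meson countable_insert countable_subset)
      next
        case False
        then have "{x \<in> B. g0 x = v} = {}"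
          by blast
        then show ?thesis
          by (simp only: countable_empty)
      qed
      then have "countable (\<Union>v\<in>g0 ` B. {x \<in> B. g0 x = v})"
        using countable_finite[OF \<open>finite (g0 ` B)\<close>] by (intro countable_UN)
      moreover have "B = (\<Union>v\<in>g0 ` B. {x \<in> B. g0 x = v})"
        by blast
      ultimately show False
        using B by simp
    qed
    have card_insert: "|insert g0 (\<Union>x\<in>X. \<G> x)| \<le>o L"
    proof -
      have "|{g0}| \<le>o L"
        using fin cL by (intro Card_order_singl_ordLeq) auto
      from card_of_Un_ordLeq_infinite_Field[OF fin this U cL] show ?thesis
        by simp
    qed
    show ?thesis
    proof (intro exI[of _ "insert g0 (\<Union>x\<in>X. \<G> x)"] conjI card_insert allI impI)
      fix B assume B: "B \<subseteq> X" "\<not> countable B"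
      show "\<exists>g\<in>insert g0 (\<Union>x\<in>X. \<G> x). infinite (g ` B)"
      proof (cases "?thin B")
        case True
        then show ?thesis
          using inf_g0 by blast
      next
        case False
        from not_thin[OF B this] show ?thesis
          by blast
      qed
    qed
  qed
qed

text \<open>An infinite image contains an injective sequence of reals; reading off the index in that
  sequence gives a map onto the natural numbers, and there are only continuum many
  sequences.\<close>

lemma ex_surjective_maps:
  fixes X :: "'x set" and L :: "'l rel"
  assumes L: "Cinfinite L" "|X| \<le>o L" "|UNIV :: (nat \<Rightarrow> bool) set| \<le>o L"
  shows "\<exists>\<S> :: ('x \<Rightarrow> nat) set. |\<S>| \<le>o L \<and>
    (\<forall>B\<subseteq>X. \<not> countable B \<longrightarrow> (\<exists>s\<in>\<S>. s ` B = UNIV))"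
proof -
  obtain \<G> :: "('x \<Rightarrow> nat \<Rightarrow> bool) set" where \<G>: "|\<G>| \<le>o L"
    "\<And>B. B \<subseteq> X \<Longrightarrow> \<not> countable B \<Longrightarrow> \<exists>g\<in>\<G>. infinite (g ` B)"
    using ex_real_maps[OF L(1,2)] by blast
  define s where "s = (\<lambda>(g :: 'x \<Rightarrow> nat \<Rightarrow> bool, \<sigma> :: nat \<Rightarrow> nat \<Rightarrow> bool) x. LEAST n. \<sigma> n = g x)"
  have "|UNIV :: (nat \<Rightarrow> nat \<Rightarrow> bool) set| \<le>o L"
    using card_seq_reals L(3) ordLeq_transitive by blast
  then have "|\<G> \<times> (UNIV :: (nat \<Rightarrow> nat \<Rightarrow> bool) set)| \<le>o L"
    using L(1) \<G>(1) by (intro card_of_Times_ordLeq_infinite_Field) (auto simp: cinfinite_def)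
  then have "|s ` (\<G> \<times> UNIV)| \<le>o L"
    using card_of_image ordLeq_transitive by blast
  moreover have "\<exists>t\<in>s ` (\<G> \<times> UNIV). t ` B = UNIV" if B: "B \<subseteq> X" "\<not> countable B" for B
  proof -
    obtain g where g: "g \<in> \<G>" "infinite (g ` B)"
      using \<G>(2)[OF B] by blast
    then obtain \<sigma> :: "nat \<Rightarrow> nat \<Rightarrow> bool" where \<sigma>: "inj \<sigma>" "range \<sigma> \<subseteq> g ` B"
      using infinite_countable_subset by blast
    have "n \<in> s (g, \<sigma>) ` B" for n
    proof -
      obtain x where x: "x \<in> B" "g x = \<sigma> n"
        using \<sigma>(2) by (metis imageE rangeI subsetD)
      have "(LEAST k. \<sigma> k = \<sigma> n) = n"
        by (rule Least_equality) (simp_all add: inj_eq[OF \<sigma>(1)])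
      then have "s (g, \<sigma>) x = n"
        by (simp add: s_def x(2))
      then show ?thesis
        using x(1) by blast
    qed
    then have "s (g, \<sigma>) ` B = UNIV"
      by blast
    then show ?thesis
      using g(1) by blast
  qed
  ultimately show ?thesis
    by (intro exI[of _ "s ` (\<G> \<times> UNIV)"]) blast
qed

section \<open>Ulam matrices and colourings of positions\<close>

context wellorder
begin

text \<open>
  Ulam's argument: the indices \<open>oi z < p\<close> of a position \<open>p\<close> are enumerated injectively by \<open>K\<close>. For
  every \<open>z \<in> Z\<close> one value \<open>\<xi>\<close> is taken stationarily often, and one \<open>\<xi>\<close> serves uncountably many \<open>z\<close>.
\<close>

lemma ulam:
  assumes K: "Cinfinite K" "cof_gt K {..<d}" "\<not> |Z| \<le>o K"
    and T: "\<And>z. z \<in> Z \<Longrightarrow> stat {..<d} {\<delta> \<in> T. oi z < pos \<delta>}"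
    and g: "\<And>\<delta> z. \<delta> \<in> T \<Longrightarrow> z \<in> Z \<Longrightarrow> oi z < pos \<delta> \<Longrightarrow> g (pos \<delta>) z \<in> Field K"
  shows "\<exists>\<xi>\<in>Field K. \<exists>B\<subseteq>Z. \<not> countable B \<and>
    (\<forall>z\<in>B. stat {..<d} {\<delta> \<in> T. oi z < pos \<delta> \<and> g (pos \<delta>) z = \<xi>})"
proof -
  have fin: "\<not> finite (Field K)" and cK: "Card_order K"
    using K(1) by (auto simp: cinfinite_def)
  have FK: "|Field K| \<le>o K"
    using card_of_Field_ordIso[OF cK] ordIso_iff_ordLeq by blast
  have "\<exists>\<xi>\<in>Field K. stat {..<d} {\<delta> \<in> T. oi z < pos \<delta> \<and> g (pos \<delta>) z = \<xi>}" if z: "z \<in> Z" for z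
  proof (rule stat_UN[OF _ cof_gt_mono[OF K(2) FK] down_closed_lessThan])
    have "{\<delta> \<in> T. oi z < pos \<delta>} = (\<Union>\<xi>\<in>Field K. {\<delta> \<in> T. oi z < pos \<delta> \<and> g (pos \<delta>) z = \<xi>})"
      using g[OF _ z] by blast
    then show "stat {..<d} (\<Union>\<xi>\<in>Field K. {\<delta> \<in> T. oi z < pos \<delta> \<and> g (pos \<delta>) z = \<xi>})"
      using T[OF z] by simp
  qed
  then have "\<forall>z\<in>Z. \<exists>\<xi>. \<xi> \<in> Field K \<and> stat {..<d} {\<delta> \<in> T. oi z < pos \<delta> \<and> g (pos \<delta>) z = \<xi>}"
    by blast
  from bchoice[OF this] obtain \<xi> where \<xi>: "\<And>z. z \<in> Z \<Longrightarrow> \<xi> z \<in> Field K"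
    "\<And>z. z \<in> Z \<Longrightarrow> stat {..<d} {\<delta> \<in> T. oi z < pos \<delta> \<and> g (pos \<delta>) z = \<xi> z}"
    by auto
  \<comment> \<open>Otherwise \<open>Z\<close> would be a union of at most \<open>K\<close> many
    countable sets.\<close>
  have "\<exists>x\<in>Field K. \<not> countable {z \<in> Z. \<xi> z = x}"
  proof (rule ccontr)
    assume "\<not> ?thesis"
    then have "\<forall>x\<in>Field K. |{z \<in> Z. \<xi> z = x}| \<le>o natLeq"
      by (simp add: countable_card_le_natLeq)
    moreover have "natLeq \<le>o K"
      using K(1) by (simp add: natLeq_ordLeq_cinfinite)
    ultimately have "\<forall>x\<in>Field K. |{z \<in> Z. \<xi> z = x}| \<le>o K"
      using ordLeq_transitive by blast
    then have "|\<Union>x\<in>Field K. {z \<in> Z. \<xi> z = x}| \<le>o K"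
      by (rule card_of_UNION_ordLeq_infinite_Field[OF fin cK FK])
    moreover have "(\<Union>x\<in>Field K. {z \<in> Z. \<xi> z = x}) = Z"
      using \<xi>(1) by blast
    ultimately show False
      using K(3) by simp
  qed
  then obtain x where x: "x \<in> Field K" "\<not> countable {z \<in> Z. \<xi> z = x}"
    by blast
  then show ?thesis
    using \<xi>(2) by (intro bexI[OF _ x(1)] exI[of _ "{z \<in> Z. \<xi> z = x}"]) auto
qed

text \<open>If \<open>g p\<close> is injective on the indices \<open>z\<close> with
  \<open>oi z < p\<close>, then \<xi> picks at most one of them, which \<open>s\<close> turns into a
  number. The value depends on the position alone, so one colouring can be used below different
  \<open>d\<close>.\<close>

definition colour :: "('a \<Rightarrow> 'a) \<Rightarrow> ('a \<Rightarrow> 'a \<Rightarrow> 'k) \<Rightarrow> 'a set \<Rightarrow> 'k \<times> ('a \<Rightarrow> nat) \<Rightarrow> 'a \<Rightarrow> nat" where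
  "colour oi g Z = (\<lambda>(\<xi>, s) p. s (THE z. z \<in> Z \<and> oi z < p \<and> g p z = \<xi>))"

lemma colour_eq:
  assumes "inj_on (g p) {z \<in> Z. oi z < p}" "z \<in> Z" "oi z < p" "g p z = \<xi>"
  shows "colour oi g Z (\<xi>, s) p = s z"
proof -
  have "(THE z. z \<in> Z \<and> oi z < p \<and> g p z = \<xi>) = z"
    using assms by (intro the_equality) (auto simp: inj_on_def)
  then show ?thesis
    by (simp add: colour_def)
qed

text \<open>The class of colour \<open>n\<close> contains the stationary set attached to any
  \<open>z\<close> in \<open>B\<close> with \<open>s z = n\<close>.\<close>

lemma ulam_colour:
  assumes B: "B \<subseteq> Z" "\<And>z. z \<in> B \<Longrightarrow> stat {..<d} {\<delta> \<in> T. oi z < pos \<delta> \<and> g (pos \<delta>) z = \<xi>}"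
    and g: "\<And>\<delta>. \<delta> \<in> T \<Longrightarrow> inj_on (g (pos \<delta>)) {z \<in> Z. oi z < pos \<delta>}" and s: "s ` B = UNIV" and "T \<subseteq> {..<d}"
  shows "stat {..<d} {\<delta> \<in> T. colour oi g Z (\<xi>, s) (pos \<delta>) = n}"
proof -
  obtain z where z: "z \<in> B" "s z = n"
    using s by (metis UNIV_I imageE)
  show ?thesis
  proof (rule stat_mono[OF B(2)[OF z(1)]])
    show "{\<delta> \<in> T. oi z < pos \<delta> \<and> g (pos \<delta>) z = \<xi>} \<subseteq> {\<delta> \<in> T. colour oi g Z (\<xi>, s) (pos \<delta>) = n}"
    proof clarify
      fix \<delta> assume \<delta>: "\<delta> \<in> T" "oi z < pos \<delta>" "\<xi> = g (pos \<delta>) z"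
      show "colour oi g Z (g (pos \<delta>) z, s) (pos \<delta>) = n"
        using colour_eq[where g = g and p = "pos \<delta>", OF g[OF \<delta>(1)] _ \<delta>(2) refl] z B(1) by auto
    qed
  qed (use assms in blast)
qed

section \<open>Transport between approximations of the same order type\<close>

lemma ot_image:
  assumes "incr_on X \<phi>" "X \<subseteq> {..<\<gamma>}" "\<phi> ` X \<subseteq> {..<\<delta>}"
  shows "ot (\<phi> ` X) = ot X"
proof (rule order_antisym)
  have inj: "inj_on \<phi> X"
    by (rule incr_on_inj[OF assms(1)])
  obtain g where g: "incr_on X g" "g ` X \<subseteq> {..<ot X}"
    using ot_ex[OF assms(2)] by blast
  show "ot (\<phi> ` X) \<le> ot X"
  proof (rule ot_le)
    show "incr_on (\<phi> ` X) (g \<circ> inv_into X \<phi>)"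
      using g(1) unfolding incr_on_def by (auto simp: inj inv_into_f_f incr_on_less_iff[OF assms(1)])
    show "(g \<circ> inv_into X \<phi>) ` \<phi> ` X \<subseteq> {..<ot X}"
      using g(2) by (auto simp: inj inv_into_f_f)
  qed
  obtain k where k: "incr_on (\<phi> ` X) k" "k ` \<phi> ` X \<subseteq> {..<ot (\<phi> ` X)}"
    using ot_ex[OF assms(3)] by blast
  show "ot X \<le> ot (\<phi> ` X)"
  proof (rule ot_le)
    show "incr_on X (k \<circ> \<phi>)"
      using k(1) assms(1) unfolding incr_on_def by auto
    show "(k \<circ> \<phi>) ` X \<subseteq> {..<ot (\<phi> ` X)}"
      using k(2) by auto
  qed
qed

text \<open>Both sets collapse onto the same initial segment; one collapse is composed with the
  inverse of the other.\<close>

lemma ex_order_iso: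
  assumes "X \<subseteq> {..<\<gamma>}" "Y \<subseteq> {..<\<delta>}" "ot X = ot Y"
  shows "\<exists>\<phi>. incr_on X \<phi> \<and> bij_betw \<phi> X Y"
proof -
  define o1 where "o1 x = ot (X \<inter> {..<x})" for x
  define o2 where "o2 y = ot (Y \<inter> {..<y})" for y
  have b: "bij_betw o1 X {..<ot X}" "bij_betw o2 Y {..<ot X}"
    unfolding o1_def o2_def using bij_betw_ot[OF assms(1)] bij_betw_ot[OF assms(2)] assms(3) by auto
  have i: "incr_on X o1" "incr_on Y o2"
    unfolding o1_def o2_def using incr_on_ot assms by auto
  have bij: "bij_betw (inv_into Y o2 \<circ> o1) X Y"
    using b(1) bij_betw_inv_into[OF b(2)] by (rule bij_betw_trans)
  moreover have "incr_on X (inv_into Y o2 \<circ> o1)"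
    unfolding incr_on_def
  proof (intro ballI impI)
    fix x y assume xy: "x \<in> X" "y \<in> X" "x < y"
    have "o2 ((inv_into Y o2 \<circ> o1) w) = o1 w" if "w \<in> X" for w
      using b that by (metis bij_betw_apply bij_betw_inv_into_right comp_apply)
    then have "o2 ((inv_into Y o2 \<circ> o1) x) < o2 ((inv_into Y o2 \<circ> o1) y)"
      using i(1) xy by (simp add: incr_on_def)
    moreover have "(inv_into Y o2 \<circ> o1) x \<in> Y" "(inv_into Y o2 \<circ> o1) y \<in> Y"
      using bij xy by (auto dest: bij_betw_apply)
    ultimately show "(inv_into Y o2 \<circ> o1) x < (inv_into Y o2 \<circ> o1) y"
      using incr_on_less_iff[OF i(2)] by blast
  qed
  ultimately show ?thesis
    by blast
qed

lemma least_above_mono: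
  assumes "x \<le> y" "z \<in> c" "y \<le> z"
  shows "least_above c x \<le> least_above c y"
  using least_above[OF assms(2,3)] assms(1) by (intro least_above(3)) auto

definition lim_points :: "'a set \<Rightarrow> 'a set \<Rightarrow> 'a \<Rightarrow> 'a set" where
  "lim_points S c d = {\<delta> \<in> S. \<delta> < d \<and> cofin {..<\<delta>} (c \<inter> {..<\<delta>})}"

text \<open>An isomorphism \<phi> of the two approximations carries limits of one to limits of the
  other. At limits in \<open>S\<close>, coherence makes the approximation equal to the corresponding
  cut, so positions are preserved too.\<close>

lemma stat_transport:
  assumes co: "coherent f i d0" "coherent f i d1" and ot: "ot (approx f i d0) = ot (approx f i d1)"
    and cof: "cof_gt natLeq {..<d0}" "cof_gt natLeq {..<d1}"
    and S: "\<And>\<delta>. \<delta> \<in> S \<Longrightarrow> cof_gt natLeq {..<\<delta>}"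
    and S_iso: "\<And>\<delta> X \<epsilon> \<phi>. \<delta> \<in> S \<Longrightarrow> \<delta> < d0 \<Longrightarrow> \<epsilon> < d1 \<Longrightarrow> cofin {..<\<delta>} X \<Longrightarrow> incr_on X \<phi> \<Longrightarrow>
      cofin {..<\<epsilon>} (\<phi> ` X) \<Longrightarrow> \<epsilon> \<in> S"
    and st: "stat {..<d0} {\<delta> \<in> lim_points S (approx f i d0) d0. P (ot (approx f i \<delta>))}"
  shows "stat {..<d1} {\<delta> \<in> lim_points S (approx f i d1) d1. P (ot (approx f i \<delta>))}"
  unfolding stat_def
proof (intro conjI allI impI)
  let ?a = "approx f i d0" and ?b = "approx f i d1"
  show "{\<delta> \<in> lim_points S ?b d1. P (ot (approx f i \<delta>))} \<subseteq> {..<d1}"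
    by (auto simp: lim_points_def)
  fix G assume G: "mono_map {..<d1} G"
  have ca: "cofin {..<d0} ?a" and cb: "cofin {..<d1} ?b"
    using co by (auto simp: coherent_def)
  obtain \<phi> where \<phi>: "incr_on ?a \<phi>" "bij_betw \<phi> ?a ?b"
    using ex_order_iso[OF approx_subset approx_subset ot] by blast
  define \<psi> where "\<psi> = inv_into ?a \<phi>"
  have \<psi>: "\<psi> y \<in> ?a \<and> \<phi> (\<psi> y) = y" if "y \<in> ?b" for y
    unfolding \<psi>_def
    using bij_betw_apply[OF bij_betw_inv_into[OF \<phi>(2)] that] bij_betw_inv_into_right[OF \<phi>(2) that] by simp
  have \<phi>b: "\<phi> x \<in> ?b" if "x \<in> ?a" for x
    using \<phi>(2) that by (rule bij_betw_apply)
  have iff: "\<phi> x \<le> \<phi> y \<longleftrightarrow> x \<le> y" if "x \<in> ?a" "y \<in> ?a" for x y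
    using incr_on_less_iff[OF \<phi>(1) that(2,1)] by (meson not_le)
  have nomax: "\<forall>x\<in>{..<d1}. \<exists>y\<in>{..<d1}. x < y"
    using cof_gt_lessThan_gt[OF cof(2)] by auto
  define up where "up u = \<phi> (least_above ?a u)" for u
  have la: "least_above ?a u \<in> ?a" "u \<le> least_above ?a u" if "u < d0" for u
    using ca that least_above(1,2) unfolding cofin_def by blast+
  have up: "up u \<in> ?b" "up u < d1" if "u < d0" for u
    unfolding up_def using \<phi>b[OF la(1)[OF that]] approx_subset by auto
  have Gup: "G (up u) < d1" if "u < d0" for u
    using G up(2)[OF that] unfolding mono_map_def by auto
  \<comment> \<open>\<open>G\<close> is pulled back from \<open>d1\<close> to \<open>d0\<close>:
    round up to the approximation, cross over, apply \<open>G\<close>, go to the next point of the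
    other approximation, and return.\<close>
  define H where "H u = \<psi> (next_in ?b (G (up u)))" for u
  have nb: "next_in ?b v \<in> ?b" "v < next_in ?b v" if "v < d1" for v
    using cofin_next_in[OF cb _ nomax] that by auto
  have \<phi>H: "\<phi> (H u) = next_in ?b (G (up u))" "H u \<in> ?a" if "u < d0" for u
    using \<psi> nb(1)[OF Gup[OF that]] by (auto simp: H_def)
  have "mono_map {..<d0} H"
    unfolding mono_map_def
  proof (intro conjI ballI impI)
    show "H ` {..<d0} \<subseteq> {..<d0}"
      using \<phi>H(2) approx_subset by blast
    fix u v assume uv: "u \<in> {..<d0}" "v \<in> {..<d0}" "u \<le> v"
    then obtain w where "w \<in> ?a" "v \<le> w"
      using ca unfolding cofin_def by blast
    then have "least_above ?a u \<le> least_above ?a v"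
      using uv(3) by (intro least_above_mono)
    then have "up u \<le> up v"
      unfolding up_def using iff la(1) uv by simp
    then have "G (up u) \<le> G (up v)"
      using G up(2) uv unfolding mono_map_def by auto
    then have "next_in ?b (G (up u)) \<le> next_in ?b (G (up v))"
      using nb[OF Gup] uv by (intro next_in(3)) (auto intro: le_less_trans)
    then show "H u \<le> H v"
      using \<phi>H uv iff by (metis lessThan_iff)
  qed
  then obtain \<delta> where \<delta>: "\<delta> \<in> S" "\<delta> < d0" "cofin {..<\<delta>} (?a \<inter> {..<\<delta>})"
      "P (ot (approx f i \<delta>))" "closed_under H \<delta>"
    using st unfolding stat_def lim_points_def by blast
  define X where "X = ?a \<inter> {..<\<delta>}"
  have XS: "X \<subseteq> ?a" "X \<subseteq> {..<\<delta>}"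
    by (auto simp: X_def)
  obtain w where w: "w \<in> ?a" "\<delta> \<le> w"
    using ca \<delta>(2) unfolding cofin_def by blast
  \<comment> \<open>The point corresponding to \<delta>: the least strict upper bound of the
    transported cut. The value \<open>\<phi> w\<close> shows that it exists and lies below
    \<open>d1\<close>.\<close>
  define \<epsilon> where "\<epsilon> = (LEAST s. \<phi> ` X \<subseteq> {..<s})"
  have wX: "\<phi> ` X \<subseteq> {..<\<phi> w}"
  proof clarify
    fix x assume "x \<in> X"
    then have "x \<in> ?a" "x < w"
      using w(2) by (auto simp: X_def)
    then show "\<phi> x < \<phi> w"
      using \<phi>(1) w(1) by (simp add: incr_on_def)
  qed
  then have \<epsilon>X: "\<phi> ` X \<subseteq> {..<\<epsilon>}"
    unfolding \<epsilon>_def by (rule LeastI)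
  have \<epsilon>_le: "\<epsilon> \<le> s" if "\<phi> ` X \<subseteq> {..<s}" for s
    unfolding \<epsilon>_def using that by (rule Least_le)
  have "\<epsilon> < d1"
  proof -
    have "\<phi> w < d1"
      using \<phi>b[OF w(1)] approx_subset by blast
    with \<epsilon>_le[OF wX] show ?thesis
      by (rule le_less_trans)
  qed
  have ex_X: "\<exists>x\<in>X. u \<le> \<phi> x" if "u < \<epsilon>" for u
    using \<epsilon>_le[of u] that by (meson image_subsetI lessThan_iff not_le)
  have cX: "cofin {..<\<epsilon>} (\<phi> ` X)"
    unfolding cofin_def using \<epsilon>X ex_X by auto
  have X_eq: "\<phi> ` X = ?b \<inter> {..<\<epsilon>}"
  proof (intro subset_antisym subsetI)
    fix y assume y: "y \<in> ?b \<inter> {..<\<epsilon>}"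
    then obtain x where x: "x \<in> X" "y \<le> \<phi> x"
      using ex_X by auto
    then have "\<psi> y \<le> x"
      using y \<psi> iff XS(1) by (metis IntD1 subsetD)
    then have "\<psi> y \<in> X"
      using x(1) y \<psi> unfolding X_def by auto
    then show "y \<in> \<phi> ` X"
      using y \<psi> by (metis IntD1 imageI)
  qed (use \<epsilon>X \<phi>b XS(1) in blast)
  have "incr_on X \<phi>"
    using \<phi>(1) XS(1) by (rule incr_on_subset)
  then have "\<epsilon> \<in> S"
    using S_iso[OF \<delta>(1,2) \<open>\<epsilon> < d1\<close> _ _ cX] \<delta>(3) by (simp add: X_def)
  have "approx f i \<epsilon> = \<phi> ` X"
    using coherent_approx[OF co(2) \<open>\<epsilon> < d1\<close> S[OF \<open>\<epsilon> \<in> S\<close>]] cX X_eq by simp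
  also have "ot (\<phi> ` X) = ot X"
    using \<open>incr_on X \<phi>\<close> XS(2) \<epsilon>X by (rule ot_image)
  also have "X = approx f i \<delta>"
    using coherent_approx[OF co(1) \<delta>(2) S[OF \<delta>(1)] \<delta>(3)] by (simp add: X_def)
  finally have "P (ot (approx f i \<epsilon>))"
    using \<delta>(4) by simp
  \<comment> \<open>For \<open>x\<close> in \<open>X\<close> the point \<open>H x\<close> is again
    in \<open>X\<close>, and its image exceeds \<open>G (\<phi> x)\<close>.\<close>
  moreover have "closed_under G \<epsilon>"
    unfolding closed_under_def
  proof (intro allI impI)
    fix u assume "u < \<epsilon>"
    then obtain x where x: "x \<in> X" "u \<le> \<phi> x"
      using ex_X by blast
    then have "x < \<delta>" "x < d0" "x \<in> ?a"
      using \<delta>(2) by (auto simp: X_def)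
    then have "up x = \<phi> x"
      by (simp add: up_def least_above_eq)
    have "H x \<in> X"
      using \<delta>(5) \<open>x < \<delta>\<close> \<phi>H(2)[OF \<open>x < d0\<close>] unfolding closed_under_def X_def by blast
    then have "\<phi> (H x) < \<epsilon>"
      using \<epsilon>X by blast
    moreover have "G (\<phi> x) < \<phi> (H x)"
      using nb(2)[OF Gup[OF \<open>x < d0\<close>]] \<phi>H(1)[OF \<open>x < d0\<close>] \<open>up x = \<phi> x\<close> by simp
    moreover have "G u \<le> G (\<phi> x)"
      using G x(2) up(2)[OF \<open>x < d0\<close>] \<open>up x = \<phi> x\<close> unfolding mono_map_def by auto
    ultimately show "G u < \<epsilon>"
      by simp
  qed
  ultimately show "\<exists>\<delta>\<in>{\<delta> \<in> lim_points S ?b d1. P (ot (approx f i \<delta>))}. closed_under G \<delta>"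
    using \<open>\<epsilon> \<in> S\<close> \<open>\<epsilon> < d1\<close> cX X_eq by (auto simp: lim_points_def)
qed


section \<open>Positions in an approximation and index sets for the matrix\<close>

lemma ot_cofin_initial_less:
  assumes "cofin {..<d} c" "z < d"
  shows "ot (c \<inter> {..<z}) < ot c"
proof -
  obtain x where x: "x \<in> c" "z \<le> x"
    using assms unfolding cofin_def by blast
  have c: "c \<subseteq> {..<d}"
    using assms(1) by (simp add: cofin_def)
  have "ot (c \<inter> {..<z}) \<le> ot (c \<inter> {..<x})"
    using x(2) by (intro ot_mono[of _ _ x]) auto
  also have "\<dots> < ot c"
    by (rule ot_initial_less[OF c x(1)])
  finally show ?thesis .
qed

lemma position:
  assumes "coherent f i d" "\<delta> \<in> lim_points S (approx f i d) d" "cof_gt natLeq {..<\<delta>}"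
  shows "approx f i \<delta> = approx f i d \<inter> {..<\<delta>}" "ot (approx f i \<delta>) < ot (approx f i d)"
proof -
  show eq: "approx f i \<delta> = approx f i d \<inter> {..<\<delta>}"
    using assms coherent_approx unfolding lim_points_def by blast
  show "ot (approx f i \<delta>) < ot (approx f i d)"
    unfolding eq using assms by (intro ot_cofin_initial_less) (auto simp: coherent_def lim_points_def)
qed

text \<open>Almost every element of \<open>S\<close> below \<open>d\<close> is a limit of the
  approximation and lies above the point of position \<open>p\<close>; its own position is then the
  type of a longer cut.\<close>

lemma stat_position_greater:
  assumes d: "coherent f i d" "cof_gt natLeq {..<d}" "stat {..<d} (S \<inter> {..<d})"
    and S: "\<And>\<delta>. \<delta> \<in> S \<Longrightarrow> cof_gt natLeq {..<\<delta>}"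
    and p: "p < ot (approx f i d)"
  shows "stat {..<d} {\<delta> \<in> lim_points S (approx f i d) d. p < ot (approx f i \<delta>)}"
proof -
  let ?c = "approx f i d"
  have nomax: "\<forall>x\<in>{..<d}. \<exists>y\<in>{..<d}. x < y"
    using cof_gt_lessThan_gt[OF d(2)] by auto
  have c: "cofin {..<d} ?c"
    using d(1) by (simp add: coherent_def)
  obtain x where x: "x \<in> ?c" "ot (?c \<inter> {..<x}) = p"
    using ot_surj[OF approx_subset p] by blast
  then have "x \<in> {..<d}"
    using approx_subset by blast
  \<comment> \<open>As elements of \<open>S\<close> are not least, being closed under the constant
    map \<open>x\<close> means lying above \<open>x\<close>.\<close>
  have "stat {..<d} {\<beta> \<in> {\<beta> \<in> S \<inter> {..<d}. closed_under (\<lambda>_. x) \<beta>}. closed_under (next_in ?c) \<beta>}"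
    by (intro stat_closed_under d(3) mono_map_const \<open>x \<in> {..<d}\<close> mono_map_next_in[OF c nomax])
  then show ?thesis
  proof (rule stat_mono)
    show "{\<delta> \<in> lim_points S ?c d. p < ot (approx f i \<delta>)} \<subseteq> {..<d}"
      by (auto simp: lim_points_def)
    show "{\<beta> \<in> {\<beta> \<in> S \<inter> {..<d}. closed_under (\<lambda>_. x) \<beta>}. closed_under (next_in ?c) \<beta>}
      \<subseteq> {\<delta> \<in> lim_points S ?c d. p < ot (approx f i \<delta>)}"
    proof clarify
      fix \<delta> assume \<delta>: "\<delta> \<in> S" "\<delta> < d" "closed_under (\<lambda>_. x) \<delta>" "closed_under (next_in ?c) \<delta>"
      have "x < \<delta>"
        using \<delta>(3) cof_gt_lessThan_nonempty[OF S[OF \<delta>(1)]] by (auto simp: closed_under_def)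
      have "\<exists>z\<in>?c \<inter> {..<\<delta>}. y \<le> z" if "y < \<delta>" for y
      proof (rule bexI)
        have y: "y \<in> {..<d}"
          using that \<delta>(2) by simp
        show "y \<le> next_in ?c y"
          using cofin_next_in(2)[OF c y nomax] by (rule less_imp_le)
        show "next_in ?c y \<in> ?c \<inter> {..<\<delta>}"
          using cofin_next_in(1)[OF c y nomax] \<delta>(4) that by (simp add: closed_under_def)
      qed
      then have lim: "\<delta> \<in> lim_points S ?c d"
        using \<delta>(1,2) by (auto simp: lim_points_def cofin_def)
      moreover have "p < ot (approx f i \<delta>)"
      proof -
        have "?c \<inter> {..<\<delta>} \<inter> {..<x} = ?c \<inter> {..<x}"
          using \<open>x < \<delta>\<close> by auto
        then show ?thesis
          using ot_initial_less[of "?c \<inter> {..<\<delta>}" \<delta> x] x \<open>x < \<delta>\<close> position(1)[OF d(1) lim S[OF \<delta>(1)]]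
          by simp
      qed
      ultimately show "\<delta> \<in> lim_points S ?c d \<and> p < ot (approx f i \<delta>)"
        by simp
    qed
  qed
qed

text \<open>Left-to-right maxima along an injection into \<open>k\<close> thin a cofinal set until
  its initial segments inject into proper initial segments of \<open>k\<close>. It stays cofinal, so
  the cofinality of \<open>d\<close> forces more than \<open>K\<close> elements.\<close>

lemma ex_index_set:
  assumes d: "cof_gt K {..<d}" "cofin {..<d} Z0" "|Z0| \<le>o |{..<k}|"
    and k: "\<And>x. x < k \<Longrightarrow> |{..<x}| \<le>o K"
  shows "\<exists>Z. cofin {..<d} Z \<and> (\<forall>x<d. |Z \<inter> {..<x}| \<le>o K) \<and> \<not> |Z| \<le>o K"
proof -
  obtain \<zeta> where \<zeta>: "inj_on \<zeta> Z0" "\<zeta> ` Z0 \<subseteq> {..<k}"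
    using d(3) unfolding card_of_ordLeq[symmetric] by blast
  define Z where "Z = lr_max Z0 \<zeta>"
  have inc: "incr_on Z \<zeta>" and cZ: "cofin Z0 Z"
    unfolding Z_def using \<zeta>(1) by (auto intro: incr_on_lr_max cofin_lr_max)
  have Z: "cofin {..<d} Z"
    using d(2) cZ by (rule cofin_trans)
  moreover have "|Z \<inter> {..<x}| \<le>o K" if x: "x < d" for x
  proof -
    obtain z where z: "z \<in> Z" "x \<le> z"
      using Z x unfolding cofin_def by blast
    have "|Z \<inter> {..<x}| \<le>o |Z \<inter> {..<z}|"
      using z(2) by (intro card_of_mono1) auto
    also have "|Z \<inter> {..<z}| \<le>o |{..<\<zeta> z}|"
      by (rule card_initial_of_incr[OF inc z(1)])
    also have "|{..<\<zeta> z}| \<le>o K"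
      using cZ z(1) \<zeta>(2) unfolding cofin_def by (intro k) blast
    finally show ?thesis .
  qed
  moreover have "\<not> |Z| \<le>o K"
  proof
    assume "|Z| \<le>o K"
    then obtain b where "b < d" "\<And>z. z \<in> Z \<Longrightarrow> z < b"
      using cof_gtD[OF d(1), of Z] Z unfolding cofin_def by auto
    then show False
      using Z unfolding cofin_def by (meson lessThan_iff not_le)
  qed
  ultimately show ?thesis
    by blast
qed

text \<open>These are the enumerations of the Ulam matrix: the indices of position below
  \<open>p\<close> lie before the point of \<open>c\<close> at position \<open>p\<close>, so there
  are at most \<open>K\<close> of them.\<close>

lemma ex_index_maps:
  assumes d: "cofin {..<d} c" "Card_order K"
    and Z: "Z \<subseteq> {..<d}" "\<And>x. x < d \<Longrightarrow> |Z \<inter> {..<x}| \<le>o K"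
  shows "\<exists>g. \<forall>p. p < ot c \<longrightarrow> inj_on (g p) {z \<in> Z. ot (c \<inter> {..<z}) < p} \<and>
    g p ` {z \<in> Z. ot (c \<inter> {..<z}) < p} \<subseteq> Field K"
proof -
  have c: "c \<subseteq> {..<d}"
    using d(1) by (simp add: cofin_def)
  have "\<exists>g. inj_on g {z \<in> Z. ot (c \<inter> {..<z}) < p} \<and>
      g ` {z \<in> Z. ot (c \<inter> {..<z}) < p} \<subseteq> Field K" if p: "p < ot c" for p
  proof -
    obtain x where x: "x \<in> c" "ot (c \<inter> {..<x}) = p"
      using ot_surj[OF c p] by blast
    have "{z \<in> Z. ot (c \<inter> {..<z}) < p} \<subseteq> Z \<inter> {..<x}"
    proof clarify
      fix z assume z: "z \<in> Z" "ot (c \<inter> {..<z}) < p"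
      show "z < x"
      proof (rule ccontr)
        assume "\<not> z < x"
        then have "ot (c \<inter> {..<x}) \<le> ot (c \<inter> {..<z})"
          by (intro ot_mono[of _ _ z]) auto
        then show False
          using x(2) z(2) by simp
      qed
    qed
    then have "|{z \<in> Z. ot (c \<inter> {..<z}) < p}| \<le>o |Z \<inter> {..<x}|"
      by (rule card_of_mono1)
    also have "|Z \<inter> {..<x}| \<le>o K"
      using x(1) c by (intro Z(2)) blast
    also have "K =o |Field K|"
      using card_of_Field_ordIso[OF d(2)] by (rule ordIso_symmetric)
    finally show ?thesis
      by (simp only: card_of_ordLeq)
  qed
  then have "\<forall>p. \<exists>g. p < ot c \<longrightarrow> inj_on g {z \<in> Z. ot (c \<inter> {..<z}) < p} \<and>
      g ` {z \<in> Z. ot (c \<inter> {..<z}) < p} \<subseteq> Field K"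
    by blast
  then show ?thesis
    by (rule choice)
qed

text \<open>Stationarily many \<open>d\<close> share the index \<open>i\<close> and the order type
  \<rho> of their approximation. One of them, \<open>d0\<close>, supplies an index set and an Ulam
  matrix on the positions below \<rho>, which serves all of them. It remains to find one pair
  (\<xi>, s) that is right for stationarily many \<open>d\<close>.\<close>

lemma ex_colouring:
  fixes K :: "'k rel"
  assumes F: "down_closed F" "cof_gt |{..<l}| F"
    and f: "\<And>\<alpha>. \<alpha> \<in> F \<Longrightarrow> inj_on (f \<alpha>) {..<\<alpha>} \<and> f \<alpha> ` {..<\<alpha>} \<subseteq> {..<l}"
    and l: "\<And>i. i < l \<Longrightarrow> |{..<i}| <o |{..<l}|" "cof_ge |{..<l}| {..<l}" "natLeq <o |{..<l}|" "K \<le>o |{..<l}|"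
    and k: "k < l" "\<And>x. x < k \<Longrightarrow> |{..<x}| \<le>o K" and K: "Cinfinite K"
    and S: "\<And>\<delta>. \<delta> \<in> S \<Longrightarrow> cof_gt natLeq {..<\<delta>}"
    and S1: "stat F S1" "\<And>d. d \<in> S1 \<Longrightarrow> cof_gt K {..<d} \<and> stat {..<d} (S \<inter> {..<d}) \<and>
      (\<exists>Z. cofin {..<d} Z \<and> |Z| \<le>o |{..<k}| )"
    and split: "|UNIV :: (nat \<Rightarrow> bool) set| \<le>o |{..<l}| \<or>
      (\<forall>\<delta> X \<epsilon> \<phi>. \<delta> \<in> S \<longrightarrow> \<delta> \<in> F \<longrightarrow> \<epsilon> \<in> F \<longrightarrow> cofin {..<\<delta>} X \<longrightarrow> incr_on X \<phi> \<longrightarrow> cofin {..<\<epsilon>} (\<phi> ` X) \<longrightarrow> \<epsilon> \<in> S)"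
  shows "\<exists>i<l. \<exists>S2 h. stat F S2 \<and> (\<forall>d\<in>S2. coherent f i d \<and> cof_gt natLeq {..<d} \<and>
    (\<forall>n::nat. stat {..<d} {\<delta> \<in> lim_points S (approx f i d) d. h \<delta> = n}))"
proof -
  have below: "\<alpha> \<in> F" if "\<alpha> \<le> d" "d \<in> F" for \<alpha> d
    using that F(1) unfolding down_closed_def by (metis le_less)
  have S1F: "S1 \<subseteq> F"
    using S1(1) by (simp add: stat_def)
  have natK: "natLeq \<le>o K"
    using K by (simp add: natLeq_ordLeq_cinfinite)
  have nat_l: "natLeq \<le>o |{..<l}|"
    using l(3) by (rule ordLess_imp_ordLeq)
  then have inf_l: "infinite {..<l}"
    using infinite_iff_natLeq_ordLeq[of "{..<l}"] by blast
  then have L: "Cinfinite |{..<l}|"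
    using card_of_Card_order[of "{..<l}"] by (simp add: cinfinite_def Field_card_of)
  have Sc: "cof_gt natLeq {..<d}" if "d \<in> S1" for d
    using S1(2)[OF that] natK cof_gt_mono by blast
  define S1' where "S1' = (\<lambda>(i, \<rho>). {d \<in> S1. coherent f i d \<and> ot (approx f i d) = \<rho>})"
  have "\<exists>i<l. coherent f i d \<and> ot (approx f i d) < l" if d: "d \<in> S1" for d
  proof -
    obtain Z where Z: "cofin {..<d} Z" "|Z| \<le>o |{..<k}|"
      using S1(2)[OF d] by blast
    have dF: "d \<in> F"
      using S1F d by blast
    from Z(2) l(1)[OF k(1)] have Zl: "|Z| <o |{..<l}|"
      by (rule ordLeq_ordLess_trans)
    have fd: "inj_on (f \<alpha>) {..<\<alpha>} \<and> f \<alpha> ` {..<\<alpha>} \<subseteq> {..<l}" if "\<alpha> \<le> d" for \<alpha>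
      using f[OF below[OF that dF]] .
    obtain i where i: "i < l" "coherent f i d"
      using ex_coherent[OF fd l(1-3) Z(1) Zl] by blast
    have "ot (approx f i d) < l"
      using f[OF dF] i(1) l(1) by (intro ot_less_of_card[OF approx_subset] card_approx) auto
    then show ?thesis
      using i by blast
  qed
  then have "S1 \<subseteq> (\<Union>x\<in>{..<l} \<times> {..<l}. S1' x)"
    unfolding S1'_def by fast
  moreover have "(\<Union>x\<in>{..<l} \<times> {..<l}. S1' x) \<subseteq> F"
    unfolding S1'_def using S1F by auto
  ultimately have "stat F (\<Union>x\<in>{..<l} \<times> {..<l}. S1' x)"
    using S1(1) stat_mono by blast
  moreover have "|{..<l} \<times> {..<l}| \<le>o |{..<l}|"
    using inf_l card_of_refl card_of_Times_same_infinite ordIso_imp_ordLeq by blast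
  then have "cof_gt |{..<l} \<times> {..<l}| F"
    using F(2) cof_gt_mono by blast
  ultimately obtain i \<rho> where i: "i < l" and "stat F (S1' (i, \<rho>))"
    using stat_UN[OF _ _ F(1)] by fastforce
  define S2 where "S2 = S1' (i, \<rho>)"
  have S2: "stat F S2" "\<And>d. d \<in> S2 \<Longrightarrow> d \<in> S1 \<and> coherent f i d \<and> ot (approx f i d) = \<rho>"
    using \<open>stat F (S1' (i, \<rho>))\<close> unfolding S2_def S1'_def by auto
  have "mono_map F (\<lambda>x. x)"
    by (auto simp: mono_map_def)
  then obtain d0 where d0: "d0 \<in> S2"
    using S2(1) unfolding stat_def by blast
  then obtain Z0 where Z0: "cofin {..<d0} Z0" "|Z0| \<le>o |{..<k}|"
    using S1(2) S2(2) by blast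
  have d0': "cof_gt K {..<d0}" "cofin {..<d0} (approx f i d0)" "ot (approx f i d0) = \<rho>"
    using S1(2) S2(2)[OF d0] by (auto simp: coherent_def)
  obtain Z where Z: "cofin {..<d0} Z" "\<And>x. x < d0 \<Longrightarrow> |Z \<inter> {..<x}| \<le>o K" "\<not> |Z| \<le>o K"
    using ex_index_set[OF d0'(1) Z0 k(2)] by blast
  have Zd: "Z \<subseteq> {..<d0}"
    using Z(1) by (simp add: cofin_def)
  \<comment> \<open>An index enters only through its position in the approximation of
    \<open>d0\<close>, so it has a meaning for every \<open>d\<close> of the same type.\<close>
  define oi where "oi z = ot (approx f i d0 \<inter> {..<z})" for z
  have oi: "oi z < \<rho>" if "z \<in> Z" for z
    unfolding oi_def d0'(3)[symmetric] using that Zd by (intro ot_cofin_initial_less[OF d0'(2)]) blast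
  have "\<exists>g. \<forall>p < \<rho>. inj_on (g p) {z \<in> Z. oi z < p} \<and> g p ` {z \<in> Z. oi z < p} \<subseteq> Field K"
    unfolding oi_def d0'(3)[symmetric] using K by (intro ex_index_maps[OF d0'(2) _ Zd Z(2)]) auto
  then obtain g where g: "\<And>p. p < \<rho> \<Longrightarrow> inj_on (g p) {z \<in> Z. oi z < p}"
      "\<And>p. p < \<rho> \<Longrightarrow> g p ` {z \<in> Z. oi z < p} \<subseteq> Field K"
    by blast
  define pos where "pos \<delta> = ot (approx f i \<delta>)" for \<delta>
  define T where "T d = lim_points S (approx f i d) d" for d
  have T_sub: "T d \<subseteq> {..<d}" for d
    by (auto simp: T_def lim_points_def)
  have pos: "pos \<delta> < \<rho>" if "d \<in> S2" "\<delta> \<in> T d" for d \<delta>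
    using position(2)[of f i d \<delta> S] S2(2)[OF that(1)] that(2) S unfolding pos_def T_def
    by (auto simp: lim_points_def)
  have ul: "\<exists>\<xi>\<in>Field K. \<exists>B\<subseteq>Z. \<not> countable B \<and>
    (\<forall>z\<in>B. stat {..<d} {\<delta> \<in> T d. oi z < pos \<delta> \<and> g (pos \<delta>) z = \<xi>})" if d: "d \<in> S2" for d
  proof (rule ulam[OF K _ Z(3)])
    show "cof_gt K {..<d}"
      using S1(2) S2(2)[OF d] by blast
    show "stat {..<d} {\<delta> \<in> T d. oi z < pos \<delta>}" if "z \<in> Z" for z
      unfolding T_def pos_def using S2(2)[OF d] S1(2) Sc S oi[OF that]
      by (intro stat_position_greater) auto
    show "g (pos \<delta>) z \<in> Field K" if "\<delta> \<in> T d" "z \<in> Z" "oi z < pos \<delta>" for \<delta> z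
      using g(2)[OF pos[OF d that(1)]] that by blast
  qed
  have "\<forall>d\<in>S2. \<exists>x. fst x \<in> Field K \<and> snd x \<subseteq> Z \<and> \<not> countable (snd x) \<and>
    (\<forall>z\<in>snd x. stat {..<d} {\<delta> \<in> T d. oi z < pos \<delta> \<and> g (pos \<delta>) z = fst x})"
  proof
    fix d assume "d \<in> S2"
    from ul[OF this] obtain \<xi> B where "\<xi> \<in> Field K" "B \<subseteq> Z" "\<not> countable B"
      "\<forall>z\<in>B. stat {..<d} {\<delta> \<in> T d. oi z < pos \<delta> \<and> g (pos \<delta>) z = \<xi>}"
      by blast
    then show "\<exists>x. fst x \<in> Field K \<and> snd x \<subseteq> Z \<and> \<not> countable (snd x) \<and>
        (\<forall>z\<in>snd x. stat {..<d} {\<delta> \<in> T d. oi z < pos \<delta> \<and> g (pos \<delta>) z = fst x})"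
      by (intro exI[of _ "(\<xi>, B)"]) simp
  qed
  from bchoice[OF this] obtain u where u: "\<forall>d\<in>S2. fst (u d) \<in> Field K \<and> snd (u d) \<subseteq> Z \<and> \<not> countable (snd (u d)) \<and>
    (\<forall>z\<in>snd (u d). stat {..<d} {\<delta> \<in> T d. oi z < pos \<delta> \<and> g (pos \<delta>) z = fst (u d)})" ..
  define \<xi> B where "\<xi> d = fst (u d)" and "B d = snd (u d)" for d
  have \<xi>: "\<xi> d \<in> Field K" if "d \<in> S2" for d
    using u that by (simp add: \<xi>_def)
  have B: "B d \<subseteq> Z" "\<not> countable (B d)"
      "\<And>z. z \<in> B d \<Longrightarrow> stat {..<d} {\<delta> \<in> T d. oi z < pos \<delta> \<and> g (pos \<delta>) z = \<xi> d}" if "d \<in> S2" for d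
    using u that by (simp_all add: \<xi>_def B_def)
  have col: "stat {..<d} {\<delta> \<in> T d. colour oi g Z (\<xi> d, s) (pos \<delta>) = n}" if "d \<in> S2" "s ` B d = UNIV" for d s n
    using g(1)[OF pos[OF that(1)]] by (intro ulam_colour[OF B(1)[OF that(1)] B(3)[OF that(1)] _ that(2) T_sub])
  define good where "good = (\<lambda>x. {d \<in> S2. \<forall>n. stat {..<d} {\<delta> \<in> T d. colour oi g Z x (pos \<delta>) = n}})"
  have "\<exists>x. stat F (good x)"
    using split
  proof
    assume R: "|UNIV :: (nat \<Rightarrow> bool) set| \<le>o |{..<l}|"
    have d0F: "d0 \<in> F"
      using d0 S2(1) by (auto simp: stat_def)
    have "|Z| \<le>o |{..<l}|"
      using f[OF d0F] Zd by (intro card_of_ordLeqI[of "f d0"]) (auto intro: inj_on_subset)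
    from ex_surjective_maps[OF L this R]
    obtain \<S> :: "('a \<Rightarrow> nat) set" where \<S>: "|\<S>| \<le>o |{..<l}|"
      "\<And>B. B \<subseteq> Z \<Longrightarrow> \<not> countable B \<Longrightarrow> \<exists>s\<in>\<S>. s ` B = UNIV"
      by blast
    \<comment> \<open>There are at most \<open>l\<close> many candidates (\<xi>, s), fewer than the
      cofinality of \<open>F\<close>, so one of them is good stationarily often.\<close>
    have "S2 \<subseteq> (\<Union>x\<in>Field K \<times> \<S>. good x)"
    proof
      fix d assume d: "d \<in> S2"
      obtain s where s: "s \<in> \<S>" "s ` B d = UNIV"
        using \<S>(2)[OF B(1)[OF d] B(2)[OF d]] by blast
      then have "d \<in> good (\<xi> d, s)"
        using col[OF d s(2)] d by (simp add: good_def)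
      then show "d \<in> (\<Union>x\<in>Field K \<times> \<S>. good x)"
        using \<xi>[OF d] s(1) by blast
    qed
    moreover have "(\<Union>x\<in>Field K \<times> \<S>. good x) \<subseteq> F"
      using S2(1) by (auto simp: good_def stat_def)
    ultimately have "stat F (\<Union>x\<in>Field K \<times> \<S>. good x)"
      using S2(1) stat_mono by blast
    moreover have "|Field K| \<le>o |{..<l}|"
      using K l(4) card_of_Field_ordIso ordIso_ordLeq_trans by blast
    then have "|Field K \<times> \<S>| \<le>o |{..<l}|"
      using \<S>(1) inf_l by (intro card_of_Times_ordLeq_infinite_Field) (auto simp: Field_card_of card_of_card_order_on)
    then have "cof_gt |Field K \<times> \<S>| F"
      using F(2) cof_gt_mono by blast
    ultimately show ?thesis
      using stat_UN[OF _ _ F(1)] by blast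
  next
    assume iso: "\<forall>\<delta> X \<epsilon> \<phi>. \<delta> \<in> S \<longrightarrow> \<delta> \<in> F \<longrightarrow> \<epsilon> \<in> F \<longrightarrow> cofin {..<\<delta>} X \<longrightarrow> incr_on X \<phi> \<longrightarrow>
      cofin {..<\<epsilon>} (\<phi> ` X) \<longrightarrow> \<epsilon> \<in> S"
    \<comment> \<open>Here a single \<open>s\<close> is enough, the inverse of a sequence in
      \<open>B d0\<close>; the colouring it yields below \<open>d0\<close> is transported to every
      other \<open>d\<close>.\<close>
    have "infinite (B d0)"
      using B(2)[OF d0] countable_finite by blast
    then obtain \<sigma> :: "nat \<Rightarrow> 'a" where \<sigma>: "inj \<sigma>" "range \<sigma> \<subseteq> B d0"
      using infinite_countable_subset by blast
    have "n \<in> inv \<sigma> ` B d0" for n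
      using \<sigma> by (intro image_eqI[of _ _ "\<sigma> n"]) auto
    then have "inv \<sigma> ` B d0 = UNIV"
      by blast
    then have st: "stat {..<d0} {\<delta> \<in> T d0. colour oi g Z (\<xi> d0, inv \<sigma>) (pos \<delta>) = n}" for n
      by (rule col[OF d0])
    have "d \<in> good (\<xi> d0, inv \<sigma>)" if d: "d \<in> S2" for d
    proof -
      have dF: "d \<in> F" "d0 \<in> F"
        using d d0 S2(1) by (auto simp: stat_def)
      have "stat {..<d} {\<delta> \<in> T d. colour oi g Z (\<xi> d0, inv \<sigma>) (pos \<delta>) = n}" for n
        unfolding T_def pos_def
      proof (rule stat_transport[where P = "\<lambda>p. colour oi g Z (\<xi> d0, inv \<sigma>) p = n"])
        show "coherent f i d0" "coherent f i d" "ot (approx f i d0) = ot (approx f i d)"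
          using S2(2) d d0 by auto
        show "cof_gt natLeq {..<d0}" "cof_gt natLeq {..<d}"
          using Sc S2(2) d d0 by auto
        show "stat {..<d0} {\<delta> \<in> lim_points S (approx f i d0) d0.
            colour oi g Z (\<xi> d0, inv \<sigma>) (ot (approx f i \<delta>)) = n}"
          using st[of n] by (simp add: T_def pos_def)
        show "cof_gt natLeq {..<\<delta>}" if "\<delta> \<in> S" for \<delta>
          by (rule S[OF that])
        show "\<epsilon> \<in> S" if "\<delta> \<in> S" "\<delta> < d0" "\<epsilon> < d" "cofin {..<\<delta>} X" "incr_on X \<phi>" "cofin {..<\<epsilon>} (\<phi> ` X)"
          for \<delta> X \<epsilon> \<phi>
          using iso that below[OF less_imp_le dF(1)] below[OF less_imp_le dF(2)] by blast
      qed
      then show ?thesis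
        using d by (simp add: good_def)
    qed
    then have "good (\<xi> d0, inv \<sigma>) = S2"
      by (auto simp: good_def)
    then show ?thesis
      using S2(1) by (intro exI[of _ "(\<xi> d0, inv \<sigma>)"]) simp
  qed
  then obtain x where x: "stat F (good x)"
    by blast
  have "coherent f i d \<and> cof_gt natLeq {..<d} \<and>
      (\<forall>n. stat {..<d} {\<delta> \<in> lim_points S (approx f i d) d. colour oi g Z x (pos \<delta>) = n})" if "d \<in> good x" for d
    using that S2(2)[of d] Sc[of d] by (simp add: good_def T_def)
  then show ?thesis
    using i x by (intro exI[of _ i] conjI exI[of _ "good x"] exI[of _ "\<lambda>\<delta>. colour oi g Z x (pos \<delta>)"]) auto
qed

end

subsection \<open>Ordinal products and powers\<close>

text \<open>The comparison asks for an embedding as an initial segment, but an increasing map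
  suffices: if \<open>s\<close> were isomorphic to the proper segment of \<open>r\<close> below
  \<open>a\<close>, then \<open>e \<circ> h\<close> would be an increasing map of \<open>r\<close>
  into itself that moves \<open>a\<close> down.\<close>

lemma ordLeq_of_strict_mono:
  assumes r: "Well_order r" and s: "Well_order s"
    and h: "\<And>a. a \<in> Field r \<Longrightarrow> h a \<in> Field s" "\<And>a b. (a, b) \<in> r \<Longrightarrow> a \<noteq> b \<Longrightarrow> (h a, h b) \<in> s - Id"
  shows "r \<le>o s"
proof (rule ccontr)
  assume "\<not> r \<le>o s"
  then have "s <o r"
    using r s by (simp add: not_ordLeq_iff_ordLess)
  then obtain a where a: "a \<in> Field r" "s =o Restr r (underS r a)"
    using ordLess_iff_ordIso_Restr[OF r s] by blast
  then obtain e where e: "iso s (Restr r (underS r a)) e"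
    unfolding ordIso_def by blast
  have compat: "(e x, e y) \<in> r - Id" if "(x, y) \<in> s - Id" for x y
  proof -
    have "compat s (Restr r (underS r a)) e"
      using e s embed_compat unfolding iso_def by blast
    then have "(e x, e y) \<in> Restr r (underS r a)"
      using that unfolding compat_def by blast
    moreover have "inj_on e (Field s)"
      using e unfolding iso_def bij_betw_def by blast
    then have "e x \<noteq> e y"
      using that by (auto simp: inj_on_def Field_def)
    ultimately show ?thesis
      by blast
  qed
  have into: "e x \<in> underS r a" if "x \<in> Field s" for x
  proof -
    have "e x \<in> Field (Restr r (underS r a))"
      using e that unfolding iso_def bij_betw_def by blast
    then show ?thesis
      by (auto simp: Field_def)
  qed
  have wf: "wf (r - Id)"
    using r by (simp add: order_on_defs)
  have "x \<in> Field r \<Longrightarrow> (e (h x), x) \<notin> r - Id" for x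
  proof (induction x rule: wf_induct_rule[OF wf])
    case (1 x)
    show "(e (h x), x) \<notin> r - Id"
    proof
      assume *: "(e (h x), x) \<in> r - Id"
      then have "e (h x) \<in> Field r"
        by (auto simp: Field_def)
      moreover have "(e (h (e (h x))), e (h x)) \<in> r - Id"
        using * h(2) by (intro compat) auto
      ultimately show False
        using "1.IH"[OF *] by blast
    qed
  qed
  moreover have "(e (h a), a) \<in> r - Id"
    using into[OF h(1)[OF a(1)]] by (auto simp: underS_def)
  ultimately show False
    using a(1) by blast
qed

lemma Well_order_ord_prod:
  assumes r: "Well_order r" and s: "Well_order s"
  shows "Well_order (ord_prod r s)" "Field (ord_prod r s) = Field r \<times> Field s"
proof -
  have ro: "refl_on (Field r) r" "trans r" "antisym r" "total_on (Field r) r" "wf (r - Id)"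
    and so: "refl_on (Field s) s" "trans s" "antisym s" "total_on (Field s) s" "wf (s - Id)"
    using r s by (auto simp: order_on_defs)
  have refl: "refl_on (Field r \<times> Field s) (ord_prod r s)"
    using ro(1) unfolding ord_prod_def refl_on_def by auto
  show F: "Field (ord_prod r s) = Field r \<times> Field s"
  proof
    show "Field (ord_prod r s) \<subseteq> Field r \<times> Field s"
    proof
      fix p assume "p \<in> Field (ord_prod r s)"
      then obtain q where "(p, q) \<in> ord_prod r s \<or> (q, p) \<in> ord_prod r s"
        unfolding Field_def by blast
      then show "p \<in> Field r \<times> Field s"
        by (auto simp: ord_prod_def)
    qed
    show "Field r \<times> Field s \<subseteq> Field (ord_prod r s)"
      using refl unfolding refl_on_def Field_def[of "ord_prod r s"] by blast
  qed
  moreover have "trans (ord_prod r s)"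
    unfolding trans_def ord_prod_def using ro(2) so(2,3)
    by (auto dest: transD antisymD)
  moreover have "antisym (ord_prod r s)"
    unfolding antisym_def ord_prod_def using ro(3) so(2,3) by (auto dest: antisymD)
  moreover have "total_on (Field r \<times> Field s) (ord_prod r s)"
    unfolding total_on_def ord_prod_def using ro(1,4) so(4) by (auto simp: total_on_def refl_on_def)
  moreover have "wf (ord_prod r s - Id)"
  proof (rule wf_subset)
    \<comment> \<open>The second coordinate dominates, hence the swap.\<close>
    show "wf (inv_image ((s - Id) <*lex*> (r - Id)) (\<lambda>(x, y). (y, x)))"
      by (intro wf_inv_image wf_lex_prod ro(5) so(5))
    show "ord_prod r s - Id \<subseteq> inv_image ((s - Id) <*lex*> (r - Id)) (\<lambda>(x, y). (y, x))"
      by (auto simp: ord_prod_def)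
  qed
  moreover have "ord_prod r s \<subseteq> (Field r \<times> Field s) \<times> (Field r \<times> Field s)"
    by (auto simp: ord_prod_def)
  ultimately show "Well_order (ord_prod r s)"
    using refl unfolding order_on_defs by simp
qed

lemma ord_pow_natLeq:
  "(f, g) \<in> ord_pow r natLeq \<longleftrightarrow> f \<in> finsupp_funs r natLeq \<and> g \<in> finsupp_funs r natLeq \<and>
    (f = g \<or> (\<exists>m. (f m, g m) \<in> r - Id \<and> (\<forall>x>m. f x = g x)))"
proof -
  have "(m, x) \<in> natLeq - Id \<longleftrightarrow> m < x" for m x
    by (auto simp: natLeq_def)
  then show ?thesis
    unfolding ord_pow_def Field_natLeq by auto
qed

lemma finsupp_funs_natLeq:
  "f \<in> finsupp_funs r natLeq \<longleftrightarrow> range f \<subseteq> Field r \<and> finite {x. f x \<noteq> wo_rel.minim r (Field r)}"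
  by (auto simp: finsupp_funs_def Func_def Field_natLeq)

text \<open>
  Well-foundedness: listing the values from the largest argument in the support downwards turns
  the order into the length-lexicographic one.
\<close>

lemma Well_order_ord_pow:
  fixes r :: "'x rel"
  assumes r: "Well_order r"
  shows "Well_order (ord_pow r natLeq)" "Field (ord_pow r natLeq) = finsupp_funs r natLeq"
proof -
  define z where "z = wo_rel.minim r (Field r)"
  let ?P = "finsupp_funs r natLeq"
  have P: "f \<in> ?P \<longleftrightarrow> range f \<subseteq> Field r \<and> finite {x. f x \<noteq> z}" for f
    unfolding finsupp_funs_natLeq z_def ..
  have ro: "refl_on (Field r) r" "trans r" "antisym r" "total_on (Field r) r" "wf (r - Id)"
    using r by (auto simp: order_on_defs)
  have zmin: "(v, z) \<notin> r - Id" for v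
  proof
    assume *: "(v, z) \<in> r - Id"
    then have "v \<in> Field r"
      by (auto simp: Field_def)
    then have "(z, v) \<in> r"
      unfolding z_def using wo_rel.minim_least[of r "Field r" v] r by (simp add: wo_rel_def)
    then show False
      using * ro(3) by (auto dest: antisymD)
  qed
  define lt where "lt f g \<longleftrightarrow> (\<exists>m. (f m, g m) \<in> r - Id \<and> (\<forall>x>m. f x = g x))" for f g :: "nat \<Rightarrow> 'x"
  have pow: "(f, g) \<in> ord_pow r natLeq \<longleftrightarrow> f \<in> ?P \<and> g \<in> ?P \<and> (f = g \<or> lt f g)" for f g
    unfolding ord_pow_natLeq lt_def ..
  show F: "Field (ord_pow r natLeq) = ?P"
    by (auto simp: Field_def pow)
  have tr: "(x, w) \<in> r - Id" if "(x, y) \<in> r - Id" "(y, w) \<in> r - Id" for x y w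
    using that ro(2,3) by (auto dest: transD antisymD)
  have lt_trans: "lt f h" if fg: "lt f g" and gh: "lt g h" for f g h
  proof -
    obtain m where m: "(f m, g m) \<in> r - Id" "\<And>x. x > m \<Longrightarrow> f x = g x"
      using fg unfolding lt_def by blast
    obtain n where n: "(g n, h n) \<in> r - Id" "\<And>x. x > n \<Longrightarrow> g x = h x"
      using gh unfolding lt_def by blast
    have "(f (max m n), h (max m n)) \<in> r - Id"
    proof (cases m n rule: linorder_cases)
      case less
      then show ?thesis
        using m(2)[OF less] n(1) by (simp add: max_def)
    next
      case equal
      then show ?thesis
        using m(1) n(1) tr by (metis max.idem)
    next
      case greater
      then show ?thesis
        using n(2)[OF greater] m(1) by (simp add: max_def)
    qed
    then show ?thesis
      unfolding lt_def using m(2) n(2) by (intro exI[of _ "max m n"]) auto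
  qed
  have irrefl: "\<not> lt f f" for f
    by (auto simp: lt_def)
  have lt_I: "lt f g" if "(f m, g m) \<in> r - Id" "\<forall>x>m. f x = g x" for f g m
    unfolding lt_def by (rule exI[of _ m]) (use that in simp)
  have total: "lt f g \<or> lt g f" if fg: "f \<in> ?P" "g \<in> ?P" "f \<noteq> g" for f g
  proof -
    define D where "D = {x. f x \<noteq> g x}"
    have "D \<subseteq> {x. f x \<noteq> z} \<union> {x. g x \<noteq> z}"
      by (auto simp: D_def)
    then have "finite D"
      using fg(1,2) P finite_subset by blast
    moreover have "D \<noteq> {}"
      using fg(3) by (auto simp: D_def)
    ultimately have D: "Max D \<in> D" "\<And>x. x > Max D \<Longrightarrow> x \<notin> D"
      by (auto dest: Max_ge)
    have "f (Max D) \<noteq> g (Max D)" "f (Max D) \<in> Field r" "g (Max D) \<in> Field r"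
      using D(1) fg(1,2) P unfolding D_def by auto
    with ro(4) have "(f (Max D), g (Max D)) \<in> r - Id \<or> (g (Max D), f (Max D)) \<in> r - Id"
      unfolding total_on_def by simp
    moreover have eq: "f x = g x" if "x > Max D" for x
      using D(2)[OF that] by (simp only: D_def mem_Collect_eq not_not)
    ultimately show ?thesis
      using lt_I[of f "Max D" g] lt_I[of g "Max D" f] by auto
  qed
  have "refl_on ?P (ord_pow r natLeq)"
    by (auto simp: refl_on_def pow)
  moreover have "trans (ord_pow r natLeq)"
    unfolding trans_def pow using lt_trans by blast
  moreover have "antisym (ord_pow r natLeq)"
    unfolding antisym_def pow using lt_trans irrefl by blast
  moreover have "total_on ?P (ord_pow r natLeq)"
    unfolding total_on_def pow using total by blast
  moreover have "wf (ord_pow r natLeq - Id)"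
  proof (rule wf_subset)
    \<comment> \<open>One more than the largest argument in the support, or 0 for the zero
      function.\<close>
    define N where "N f = (LEAST n. \<forall>x\<ge>n. f x = z)" for f :: "nat \<Rightarrow> 'x"
    define L where "L f = map f (rev [0..<N f])" for f :: "nat \<Rightarrow> 'x"
    show "wf (inv_image (lenlex (r - Id)) L)"
      by (intro wf_inv_image wf_lenlex ro(5))
    show "ord_pow r natLeq - Id \<subseteq> inv_image (lenlex (r - Id)) L"
    proof (rule subrelI)
      fix f g assume "(f, g) \<in> ord_pow r natLeq - Id"
      then have fg: "(f, g) \<in> ord_pow r natLeq" "f \<noteq> g"
        by auto
      then have "lt f g"
        by (simp add: pow)
      then obtain m where m: "(f m, g m) \<in> r - Id" "\<And>x. x > m \<Longrightarrow> f x = g x"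
        unfolding lt_def by blast
      have N: "\<forall>x\<ge>N k. k x = z" if "k \<in> ?P" for k
      proof -
        have "finite {x. k x \<noteq> z}"
          using that P by blast
        then obtain b where "\<forall>x\<in>{x. k x \<noteq> z}. x < b"
          using finite_nat_set_iff_bounded by blast
        then have "\<forall>x\<ge>b. k x = z"
          by (auto simp: not_less[symmetric])
        then show ?thesis
          unfolding N_def by (rule LeastI)
      qed
      \<comment> \<open>Since \<open>g m\<close> is not zero and the functions agree beyond
        \<open>m\<close>, the list of \<open>g\<close> is at least as long; for equal lengths the
        lists first differ at \<open>m\<close>.\<close>
      have "g m \<noteq> z"
        using m(1) zmin by metis
      then have "m < N g"
        using N[of g] fg(1) by (meson not_le pow)
      then have "\<forall>x\<ge>N g. f x = z"
        using N[of g] fg(1) m(2) by (simp add: pow)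
      then have le: "N f \<le> N g"
        unfolding N_def[of f] by (rule Least_le)
      show "(f, g) \<in> inv_image (lenlex (r - Id)) L"
      proof (cases "N f < N g")
        case True
        then show ?thesis
          by (simp add: L_def lenlex_def)
      next
        case False
        then have eq: "N f = N g"
          using le by simp
        have split: "[0..<N g] = [0..<m] @ m # [Suc m..<N g]"
          using \<open>m < N g\<close> upt_add_eq_append[of 0 m "N g - m"] by (simp add: upt_conv_Cons)
        have "map f (rev [Suc m..<N g]) = map g (rev [Suc m..<N g])"
          using m(2) by simp
        then have "L f = map g (rev [Suc m..<N g]) @ f m # map f (rev [0..<m])"
          unfolding L_def eq split by simp
        moreover have "L g = map g (rev [Suc m..<N g]) @ g m # map g (rev [0..<m])"
          unfolding L_def split by simp
        ultimately have "(L f, L g) \<in> lex (r - Id)"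
          unfolding lex_conv using m(1) by fastforce
        then show ?thesis
          by (simp add: L_def eq lenlex_def)
      qed
    qed
  qed
  ultimately show "Well_order (ord_pow r natLeq)"
    unfolding F order_on_defs by (auto simp: pow)
qed

subsection \<open>Clubs\<close>

context wellorder
begin

definition order_rel :: "'a set \<Rightarrow> 'a rel" where
  "order_rel D = {(x, y). x \<in> D \<and> y \<in> D \<and> x \<le> y}"

text \<open>The least element is vacuously a limit point; requiring some \<open>y < x\<close>
  excludes it, in accordance with \<open>closed_in\<close>, which asks for earlier points.\<close>

definition clos :: "'a \<Rightarrow> 'a set \<Rightarrow> 'a set" where
  "clos \<delta> D = {x. x < \<delta> \<and> (x \<in> D \<or> (\<exists>y. y < x) \<and> lim_pt D x)}"

lemma Field_order_rel [simp]: "Field (order_rel D) = D"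
  by (auto simp: Field_def order_rel_def)

lemma Well_order_order_rel: "Well_order (order_rel D)"
proof -
  have "wf {(x, y). x < y}"
  proof (rule wfUNIVI)
    fix P x assume *: "\<forall>x. (\<forall>y. (y, x) \<in> {(x, y). x < y} \<longrightarrow> P y) \<longrightarrow> P x"
    show "P x"
      by (induction x rule: less_induct) (simp add: *)
  qed
  then have "wf (order_rel D - Id)"
    by (rule wf_subset) (auto simp: order_rel_def)
  then show ?thesis
    unfolding order_on_defs Field_order_rel
    by (auto simp: order_rel_def refl_on_def total_on_def intro!: transI antisymI)
qed

lemma wo_rel_order_rel: "wo_rel (order_rel D)"
  by (simp only: wo_rel_def Well_order_order_rel)

lemma underS_order_rel: "down_closed D \<Longrightarrow> \<delta> \<in> D \<Longrightarrow> underS (order_rel D) \<delta> = {..<\<delta>}"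
  by (auto simp: underS_def order_rel_def down_closed_def less_le)

lemma Restr_order_rel: "E \<subseteq> D \<Longrightarrow> Restr (order_rel D) E = order_rel E"
  by (auto simp: order_rel_def)

lemma lessThan_subset: "down_closed D \<Longrightarrow> \<delta> \<in> D \<Longrightarrow> {..<\<delta>} \<subseteq> D"
  by (auto simp: down_closed_def)

lemma below_order_rel: "down_closed D \<Longrightarrow> \<delta> \<in> D \<Longrightarrow> below (order_rel D) \<delta> = order_rel {..<\<delta>}"
  by (simp add: below_def underS_order_rel Restr_order_rel lessThan_subset)

lemma unbounded_in_order_rel: "unbounded_in (order_rel D) X \<longleftrightarrow> cofin D X"
proof -
  have "(\<forall>x\<in>D. \<exists>y\<in>X. (x, y) \<in> order_rel D) \<longleftrightarrow> (\<forall>x\<in>D. \<exists>y\<in>X. x \<le> y)" if "X \<subseteq> D"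
    using that unfolding order_rel_def by blast
  then show ?thesis
    unfolding unbounded_in_def cofin_def Field_order_rel by blast
qed

text \<open>As \<open>X\<close> lies strictly below \<beta>, leastness of the bound means that no
  \<open>y < \<beta>\<close> bounds \<open>X\<close>. For empty \<open>X\<close> both sides say that
  \<beta> is the least element.\<close>

lemma eq_supr_iff:
  assumes "down_closed D" "\<beta> \<in> D" "X \<subseteq> {..<\<beta>}"
  shows "\<beta> = wo_rel.supr (order_rel D) X \<longleftrightarrow> (\<forall>y<\<beta>. \<exists>x\<in>X. y < x)"
proof -
  let ?A = "Above (order_rel D) X"
  have A: "b \<in> ?A \<longleftrightarrow> b \<in> D \<and> (\<forall>x\<in>X. x \<le> b)" for b
    using assms unfolding Above_def Field_order_rel
    by (auto simp: order_rel_def down_closed_def)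
  have AF: "?A \<subseteq> Field (order_rel D)"
    by (auto simp: A)
  have \<beta>A: "\<beta> \<in> ?A"
    using assms by (auto simp: A less_imp_le)
  have supr: "wo_rel.supr (order_rel D) X = wo_rel.minim (order_rel D) ?A"
    by (simp add: wo_rel.supr_def[OF wo_rel_order_rel])
  show ?thesis
  proof
    assume eq: "\<beta> = wo_rel.supr (order_rel D) X"
    show "\<forall>y<\<beta>. \<exists>x\<in>X. y < x"
    proof (intro allI impI, rule ccontr)
      fix y assume "y < \<beta>" "\<not> (\<exists>x\<in>X. y < x)"
      then have "y \<in> ?A"
        using assms(1,2) by (auto simp: A down_closed_def not_less)
      then have "(\<beta>, y) \<in> order_rel D"
        unfolding eq supr by (rule wo_rel.minim_least[OF wo_rel_order_rel AF])
      then have "\<beta> \<le> y"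
        by (simp add: order_rel_def)
      then show False
        using \<open>y < \<beta>\<close> by (meson not_le)
    qed
  next
    assume lub: "\<forall>y<\<beta>. \<exists>x\<in>X. y < x"
    show "\<beta> = wo_rel.supr (order_rel D) X"
      unfolding supr
    proof (rule wo_rel.equals_minim[OF wo_rel_order_rel AF \<beta>A])
      fix b assume "b \<in> ?A"
      then have b: "b \<in> D" "\<forall>x\<in>X. x \<le> b"
        by (simp_all add: A)
      have "\<beta> \<le> b"
      proof (rule ccontr)
        assume "\<not> \<beta> \<le> b"
        then show False
          using lub b(2) by (meson not_le)
      qed
      then show "(\<beta>, b) \<in> order_rel D"
        using b(1) assms(2) by (simp add: order_rel_def)
    qed
  qed
qed

lemma closed_in_iff:
  assumes "down_closed D"
  shows "closed_in (order_rel D) C \<longleftrightarrow> (\<forall>\<beta>\<in>D. (\<exists>y. y < \<beta>) \<and> (\<forall>y<\<beta>. \<exists>x\<in>C. y < x \<and> x < \<beta>) \<longrightarrow> \<beta> \<in> C)"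
proof -
  have eq: "(C \<inter> underS (order_rel D) \<beta> \<noteq> {} \<and> \<beta> = wo_rel.supr (order_rel D) (C \<inter> underS (order_rel D) \<beta>)) \<longleftrightarrow>
    (\<exists>y. y < \<beta>) \<and> (\<forall>y<\<beta>. \<exists>x\<in>C. y < x \<and> x < \<beta>)" if "\<beta> \<in> D" for \<beta>
  proof -
    have "C \<inter> {..<\<beta>} \<subseteq> {..<\<beta>}"
      by blast
    from eq_supr_iff[OF assms that this] show ?thesis
      unfolding underS_order_rel[OF assms that] by auto
  qed
  then show ?thesis
    unfolding closed_in_def Field_order_rel by (intro ball_cong refl) (simp only: eq)
qed

lemma club_clos:
  assumes "cofin {..<\<delta>} D"
  shows "club_in (order_rel {..<\<delta>}) (clos \<delta> D)"
  unfolding club_in_def unbounded_in_order_rel closed_in_iff[OF down_closed_lessThan]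
proof (intro conjI ballI impI)
  show "cofin {..<\<delta>} (clos \<delta> D)"
    using assms unfolding cofin_def clos_def by blast
  fix \<beta> assume "\<beta> \<in> {..<\<delta>}" and \<beta>: "(\<exists>y. y < \<beta>) \<and> (\<forall>y<\<beta>. \<exists>x\<in>clos \<delta> D. y < x \<and> x < \<beta>)"
  have "\<exists>z\<in>D. y < z \<and> z < \<beta>" if y: "y < \<beta>" for y
  proof -
    obtain x where x: "x \<in> clos \<delta> D" "y < x" "x < \<beta>"
      using \<beta> y by blast
    show ?thesis
    proof (cases "x \<in> D")
      case False
      then obtain z where "z \<in> D" "y < z" "z < x"
        using x unfolding clos_def lim_pt_def by blast
      then show ?thesis
        using x(3) by (meson less_trans)
    qed (use x in blast)
  qed
  then show "\<beta> \<in> clos \<delta> D"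
    using \<beta> \<open>\<beta> \<in> {..<\<delta>}\<close> by (simp add: clos_def lim_pt_def)
qed

text \<open>Taking the closure adds no limits: below any point of the closure that is not in
  \<open>D\<close> there are points of \<open>D\<close> arbitrarily close to it. So isolated points
  found by walks remain isolated in the club.\<close>

lemma nacc_clos:
  assumes "down_closed F" "\<delta> \<in> F" "x < \<delta>" "x \<in> D" "\<not> lim_pt D x"
  shows "x \<in> nacc_points (order_rel F) (clos \<delta> D)"
proof -
  have "x \<in> F"
    using assms(1-3) by (auto simp: down_closed_def)
  have "\<not> (\<forall>y<x. \<exists>z\<in>clos \<delta> D \<inter> {..<x}. y < z)"
  proof
    assume *: "\<forall>y<x. \<exists>z\<in>clos \<delta> D \<inter> {..<x}. y < z"
    have "\<exists>z\<in>D. y < z \<and> z < x" if y: "y < x" for y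
    proof -
      obtain w where w: "w \<in> clos \<delta> D" "w < x" "y < w"
        using * y by blast
      show ?thesis
      proof (cases "w \<in> D")
        case False
        then obtain z where "z \<in> D" "y < z" "z < w"
          using w unfolding clos_def lim_pt_def by blast
        then show ?thesis
          using w(2) by (meson less_trans)
      qed (use w in blast)
    qed
    then show False
      using assms(5) by (simp add: lim_pt_def)
  qed
  then have "x \<noteq> wo_rel.supr (order_rel F) (clos \<delta> D \<inter> {..<x})"
    using eq_supr_iff[OF assms(1) \<open>x \<in> F\<close>, of "clos \<delta> D \<inter> {..<x}"] by blast
  then show ?thesis
    using assms(3,4) underS_order_rel[OF assms(1) \<open>x \<in> F\<close>]
    by (simp add: nacc_points_def acc_points_def clos_def)
qed

text \<open>Closing off does not increase the order type: a limit of \<open>D\<close> goes to the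
  first point of \<open>D\<close> at or above it, any other point to the next point of
  \<open>D\<close>, and this shift makes room for the limits.\<close>

lemma incr_on_clos:
  assumes "cofin {..<\<delta>} D" "cof_gt natLeq {..<\<delta>}"
  shows "\<exists>\<sigma>. incr_on (clos \<delta> D) \<sigma> \<and> \<sigma> ` clos \<delta> D \<subseteq> D"
proof -
  have nomax: "\<forall>x\<in>{..<\<delta>}. \<exists>y\<in>{..<\<delta>}. x < y"
    using cof_gt_lessThan_gt[OF assms(2)] by auto
  define \<sigma> where "\<sigma> p = (if lim_pt D p then least_above D p else next_in D p)" for p
  have \<sigma>: "\<sigma> p \<in> D" "p \<le> \<sigma> p" "\<not> lim_pt D p \<Longrightarrow> p < \<sigma> p" "\<And>z. z \<in> D \<Longrightarrow> p < z \<Longrightarrow> \<sigma> p \<le> z" if p: "p < \<delta>" for p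
  proof -
    obtain y where "y \<in> D" "p \<le> y"
      using assms(1) p unfolding cofin_def by blast
    moreover have "next_in D p \<in> D" "p < next_in D p"
      using cofin_next_in[OF assms(1) _ nomax] p by auto
    ultimately show "\<sigma> p \<in> D" "p \<le> \<sigma> p" "\<not> lim_pt D p \<Longrightarrow> p < \<sigma> p"
      using least_above by (auto simp: \<sigma>_def less_imp_le)
    show "\<sigma> p \<le> z" if "z \<in> D" "p < z" for z
      using least_above(3)[of z D p] next_in(3)[of z D p] that by (simp add: \<sigma>_def less_imp_le)
  qed
  have "\<sigma> p < \<sigma> q" if pq: "p \<in> clos \<delta> D" "q \<in> clos \<delta> D" "p < q" for p q
  proof -
    have \<delta>: "p < \<delta>" "q < \<delta>"
      using pq by (auto simp: clos_def)
    show ?thesis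
    proof (cases "lim_pt D q")
      case True
      then obtain z where z: "z \<in> D" "p < z" "z < q"
        using pq(3) unfolding lim_pt_def by blast
      have "\<sigma> p \<le> z"
        using \<sigma>(4)[OF \<delta>(1) z(1,2)] .
      also have "z < q"
        by (rule z(3))
      also have "q \<le> \<sigma> q"
        by (rule \<sigma>(2)[OF \<delta>(2)])
      finally show ?thesis .
    next
      case False
      then have "q \<in> D"
        using pq(2) by (simp add: clos_def)
      from \<sigma>(4)[OF \<delta>(1) this pq(3)] \<sigma>(3)[OF \<delta>(2) False] show ?thesis
        by (rule le_less_trans)
    qed
  qed
  then have "incr_on (clos \<delta> D) \<sigma>"
    by (simp add: incr_on_def)
  moreover have "\<sigma> ` clos \<delta> D \<subseteq> D"
    using \<sigma>(1) by (auto simp: clos_def)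
  ultimately show ?thesis
    by blast
qed

section \<open>Comparison of \<open>stat\<close> with stationarity\<close>

lemma stat_of_stationary:
  assumes D: "down_closed D" "cof_gt natLeq D" and T: "stationary_in (order_rel D) T"
  shows "stat D T"
  unfolding stat_def
proof (intro conjI allI impI)
  show "T \<subseteq> D"
    using T by (simp add: stationary_in_def)
  fix G assume G: "mono_map D G"
  have nomax: "\<exists>y\<in>D. x < y" if "x \<in> D" for x
    using cof_gt_ex_greater[OF D(2) natLeq_Card_order] that by (simp add: Field_natLeq)
  have "club_in (order_rel D) {\<beta> \<in> D. closed_under G \<beta>}"
    unfolding club_in_def unbounded_in_order_rel closed_in_iff[OF D(1)] cofin_def
  proof (intro conjI ballI impI)
    fix x assume x: "x \<in> D"
    \<comment> \<open>For unboundedness \<open>G\<close> is iterated \<omega> times above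
      \<open>x\<close>; the supremum is closed under \<open>G\<close> by monotonicity.\<close>
    have "\<exists>s. \<forall>n. (s n \<in> D \<and> x \<le> s n) \<and> (s n < s (Suc n) \<and> G (s n) < s (Suc n))"
    proof (rule dependent_nat_choice)
      show "\<exists>y. y \<in> D \<and> x \<le> y"
        using x by blast
      fix y assume y: "y \<in> D \<and> x \<le> y"
      then have "max y (G y) \<in> D"
        using G by (auto simp: max_def mono_map_def)
      then obtain z where "z \<in> D" "max y (G y) < z"
        using nomax by blast
      then show "\<exists>z. (z \<in> D \<and> x \<le> z) \<and> y < z \<and> G y < z"
        using y by (intro exI[of _ z]) auto
    qed
    then obtain s where s: "\<And>n. s n \<in> D" "\<And>n. x \<le> s n" "\<And>n. G (s n) < s (Suc n)"
      by blast
    have "range s \<subseteq> D"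
      using s(1) by blast
    from cof_gt_lub[OF D(2,1) this] obtain b where b: "b \<in> D" "\<And>n. s n < b" "\<And>y. y < b \<Longrightarrow> \<exists>n. y \<le> s n"
      by blast
    have "closed_under G b"
      unfolding closed_under_def
    proof (intro allI impI)
      fix y assume y: "y < b"
      then obtain n where n: "y \<le> s n"
        using b(3) by blast
      have "y \<in> D"
        using y b(1) D(1) by (auto simp: down_closed_def)
      then have "G y \<le> G (s n)"
        using G s(1) n by (simp add: mono_map_def)
      also have "\<dots> < s (Suc n)"
        by (rule s(3))
      also have "\<dots> < b"
        by (rule b(2))
      finally show "G y < b" .
    qed
    then show "\<exists>y\<in>{\<beta> \<in> D. closed_under G \<beta>}. x \<le> y"
      using b(1) b(2)[of 0] s(2)[of 0] by (intro bexI[of _ b]) auto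
  next
    fix \<beta> assume "\<beta> \<in> D" and *: "(\<exists>y. y < \<beta>) \<and> (\<forall>y<\<beta>. \<exists>x\<in>{\<beta> \<in> D. closed_under G \<beta>}. y < x \<and> x < \<beta>)"
    have "G y < \<beta>" if y: "y < \<beta>" for y
    proof -
      obtain x where "closed_under G x" "y < x" "x < \<beta>"
        using * y by blast
      then show ?thesis
        unfolding closed_under_def by (meson less_trans)
    qed
    then show "\<beta> \<in> {\<beta> \<in> D. closed_under G \<beta>}"
      using \<open>\<beta> \<in> D\<close> by (simp add: closed_under_def)
  qed blast
  then show "\<exists>\<beta>\<in>T. closed_under G \<beta>"
    using T unfolding stationary_in_def by blast
qed

text \<open>The least element is vacuously closed under every map but need not belong to a club,
  hence the second condition on \<open>T\<close>. Any other point closed under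
  \<open>next_in C\<close> is a limit of \<open>C\<close>.\<close>

lemma stationary_of_stat:
  assumes D: "down_closed D" "cof_gt natLeq D" and T: "stat D T" "\<And>\<beta>. \<beta> \<in> T \<Longrightarrow> \<exists>y. y < \<beta>"
  shows "stationary_in (order_rel D) T"
  unfolding stationary_in_def Field_order_rel
proof (intro conjI allI impI)
  show "T \<subseteq> D"
    using T(1) by (simp add: stat_def)
  fix C assume C: "club_in (order_rel D) C"
  then have cof: "cofin D C"
    and cl: "\<And>\<beta>. \<beta> \<in> D \<Longrightarrow> \<exists>y. y < \<beta> \<Longrightarrow> \<forall>y<\<beta>. \<exists>x\<in>C. y < x \<and> x < \<beta> \<Longrightarrow> \<beta> \<in> C"
    unfolding club_in_def unbounded_in_order_rel closed_in_iff[OF D(1)] by blast+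
  have nomax: "\<forall>x\<in>D. \<exists>y\<in>D. x < y"
    using cof_gt_ex_greater[OF D(2) natLeq_Card_order] by (simp add: Field_natLeq)
  obtain \<beta> where \<beta>: "\<beta> \<in> T" "closed_under (next_in C) \<beta>"
    using T(1) mono_map_next_in[OF cof nomax] unfolding stat_def by blast
  have "\<beta> \<in> D"
    using \<beta>(1) \<open>T \<subseteq> D\<close> by blast
  have "\<exists>x\<in>C. y < x \<and> x < \<beta>" if y: "y < \<beta>" for y
  proof -
    have "y \<in> D"
      using y \<open>\<beta> \<in> D\<close> D(1) by (auto simp: down_closed_def)
    then show ?thesis
      using cofin_next_in(1,2)[OF cof _ nomax] \<beta>(2) y unfolding closed_under_def by blast
  qed
  then have "\<beta> \<in> C"
    using cl \<open>\<beta> \<in> D\<close> T(2)[OF \<beta>(1)] by blast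
  then show "T \<inter> C \<noteq> {}"
    using \<beta>(1) by blast
qed

section \<open>Cofinality and its invariance\<close>

lemma cf_order_rel:
  "\<exists>A. cofin D A \<and> cf (order_rel D) = |A|" "cofin D B \<Longrightarrow> cf (order_rel D) \<le>o |B|"
proof -
  have "Refl (order_rel D)"
    unfolding Field_order_rel by (simp add: refl_on_def order_rel_def)
  from cf_spec[OF this] show "\<exists>A. cofin D A \<and> cf (order_rel D) = |A|" "cofin D B \<Longrightarrow> cf (order_rel D) \<le>o |B|"
    unfolding unbounded_in_order_rel by blast+
qed

lemma cof_ge_of_cf:
  assumes "cf (order_rel D) =o K"
  shows "cof_ge K D" "\<exists>Z. cofin D Z \<and> |Z| =o K"
proof -
  show "\<exists>Z. cofin D Z \<and> |Z| =o K"
    using cf_order_rel(1)[of D] assms by auto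
  show "cof_ge K D"
    unfolding cof_ge_def
  proof (intro allI impI, rule ccontr)
    fix X assume X: "X \<subseteq> D" "|X| <o K" and no: "\<not> (\<exists>b\<in>D. \<forall>x\<in>X. x < b)"
    then have "cofin D X"
      unfolding cofin_def by (auto simp: not_less)
    then have "K \<le>o |X|"
      using cf_order_rel(2) assms ordIso_symmetric ordIso_ordLeq_trans by blast
    then show False
      using X(2) not_ordLess_ordLeq by blast
  qed
qed

text \<open>A cofinal subset of \<open>D\<close> is rounded up into \<open>X\<close> and carried
  over by \<phi>.\<close>

lemma cf_order_rel_mono:
  assumes "cofin D X" "incr_on X \<phi>" "cofin D' (\<phi> ` X)"
  shows "cf (order_rel D') \<le>o cf (order_rel D)"
proof -
  obtain A where A: "cofin D A" "cf (order_rel D) = |A|"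
    using cf_order_rel(1) by blast
  let ?A' = "(\<lambda>a. \<phi> (least_above X a)) ` A"
  have la: "least_above X a \<in> X" "a \<le> least_above X a" if a: "a \<in> A" for a
  proof -
    obtain y where "y \<in> X" "a \<le> y"
      using a A(1) assms(1) unfolding cofin_def by blast
    then show "least_above X a \<in> X" "a \<le> least_above X a"
      by (rule least_above)+
  qed
  have "cofin D' ?A'"
    unfolding cofin_def
  proof (intro conjI ballI)
    show "?A' \<subseteq> D'"
      using la(1) assms(3) unfolding cofin_def by blast
    fix e assume "e \<in> D'"
    then obtain x where x: "x \<in> X" "e \<le> \<phi> x"
      using assms(3) unfolding cofin_def by blast
    then obtain a where a: "a \<in> A" "x \<le> a"
      using A(1) assms(1) unfolding cofin_def by blast
    then have "\<phi> x \<le> \<phi> (least_above X a)"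
      using la[OF a(1)] x(1) by (intro incr_on_le[OF assms(2)]) auto
    then show "\<exists>y\<in>?A'. e \<le> y"
      using x(2) a(1) by (intro bexI[of _ "\<phi> (least_above X a)"]) auto
  qed
  from cf_order_rel(2)[OF this] card_of_image[of _ A] show ?thesis
    unfolding A(2) by (rule ordLeq_transitive)
qed

lemma cf_order_rel_iso:
  assumes "cofin D X" "incr_on X \<phi>" "cofin D' (\<phi> ` X)"
  shows "cf (order_rel D') =o cf (order_rel D)"
proof -
  have inj: "inj_on \<phi> X"
    by (rule incr_on_inj[OF assms(2)])
  have "incr_on (\<phi> ` X) (inv_into X \<phi>)"
    unfolding incr_on_def using incr_on_less_iff[OF assms(2)] by (auto simp: inv_into_f_f[OF inj])
  moreover have "inv_into X \<phi> ` \<phi> ` X = X"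
    using inj by (simp add: image_comp inv_into_f_f)
  ultimately have "cf (order_rel D) \<le>o cf (order_rel D')"
    using cf_order_rel_mono[OF assms(3), of "inv_into X \<phi>" D] assms(1) by simp
  with cf_order_rel_mono[OF assms] show ?thesis
    by (simp add: ordIso_iff_ordLeq)
qed

end

subsection \<open>Regularity and order types of closures\<close>

text \<open>A \<open>cofinal\<close> set, defined by strict inequality, is in particular
  \<open>unbounded_in\<close>, so its size is at least \<open>cf r\<close>.\<close>

lemma regularCard_of_cf:
  assumes "Card_order r" "cf r =o r"
  shows "regularCard r"
  unfolding regularCard_def
proof (intro allI impI)
  fix K assume K: "K \<subseteq> Field r \<and> cofinal K r"
  have "Refl r"
    using assms(1) by (simp add: card_order_on_def order_on_defs)
  have "unbounded_in r K"
    using K unfolding unbounded_in_def cofinal_def by blast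
  then have "cf r \<le>o |K|"
    using cf_spec[OF \<open>Refl r\<close>] by blast
  then have "r \<le>o |K|"
    using assms(2) ordIso_symmetric ordIso_ordLeq_trans by blast
  moreover have "|K| \<le>o r"
    using K card_of_mono1 card_of_Field_ordIso[OF assms(1)] ordLeq_ordIso_trans by blast
  ultimately show "|K| =o r"
    by (simp add: ordIso_iff_ordLeq)
qed

section \<open>Cardinals as points of the well-order\<close>

context wellorder
begin

text \<open>Used to turn \<open>\<Lambda>\<close> and \<open>cardSuc \<theta>\<^sub>1\<close> into
  points \<open>l\<close> and \<open>k\<close>.\<close>

lemma ordLess_order_rel_segment:
  assumes "Well_order r" "down_closed D" "r <o order_rel D"
  shows "\<exists>l\<in>D. r =o order_rel {..<l}"
proof -
  obtain l where l: "l \<in> D" "r =o Restr (order_rel D) (underS (order_rel D) l)"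
    using assms(3) unfolding ordLess_iff_ordIso_Restr[OF Well_order_order_rel assms(1)] Field_order_rel
    by blast
  then show ?thesis
    using below_order_rel[OF assms(2) l(1)] unfolding below_def by auto
qed

lemma card_order_rel:
  assumes "Card_order r" "r =o order_rel D"
  shows "|D| =o r"
proof -
  have "|Field r| =o |D|"
    using card_of_cong[OF assms(2)] by simp
  then show ?thesis
    using card_of_Field_ordIso[OF assms(1)] ordIso_symmetric ordIso_transitive by blast
qed

lemma card_lessThan_less:
  assumes "Card_order r" "r =o order_rel D" "down_closed D" "x \<in> D"
  shows "|{..<x}| <o r"
proof -
  have "Card_order (order_rel D)"
    using assms(1,2) by (rule Card_order_ordIso2)
  then have "|underS (order_rel D) x| <o order_rel D"
    using assms(4) by (intro card_of_underS) simp_all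
  then show ?thesis
    using assms ordIso_symmetric ordLess_ordIso_trans by (simp add: underS_order_rel) blast
qed

text \<open>A set that is not \<open>cofinal\<close> has an upper bound \<open>a\<close>, possibly
  attained; an infinite cardinal is a limit, so there is a strict bound above
  \<open>a\<close>.\<close>

lemma cof_ge_of_regularCard:
  assumes "Cinfinite (order_rel D)" "regularCard (order_rel D)"
  shows "cof_ge (order_rel D) D"
  unfolding cof_ge_def
proof (intro allI impI)
  fix X assume X: "X \<subseteq> D" "|X| <o order_rel D"
  then have "\<not> cofinal X (order_rel D)"
    using assms(2) not_ordLess_ordIso unfolding regularCard_def Field_order_rel by blast
  then obtain a where a': "a \<in> D" "\<forall>b\<in>X. \<not> (a \<noteq> b \<and> (a, b) \<in> order_rel D)"
    unfolding cofinal_def Field_order_rel by blast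
  have a: "x \<le> a" if "x \<in> X" for x
    using a' that X(1) linear[of x a] unfolding order_rel_def by auto
  have "Card_order (order_rel D)" "infinite (Field (order_rel D))"
    using assms(1) by (auto simp: cinfinite_def)
  from infinite_Card_order_limit[OF this, of a] a'(1)
  obtain b where "b \<in> D" "a \<noteq> b" "(a, b) \<in> order_rel D"
    unfolding Field_order_rel by blast
  then have "b \<in> D" "a < b"
    by (simp_all add: order_rel_def less_le)
  then show "\<exists>b\<in>D. \<forall>x\<in>X. x < b"
    using a by (meson le_less_trans)
qed

text \<open>Moves digits below \<open>l\<close> into the field of \<open>r\<close>. Zero has to go
  to the default value of \<open>ord_pow\<close>, so that supports stay finite.\<close>

lemma ex_strict_embedding:
  assumes "Well_order r" "r =o order_rel {..<l}"
  shows "\<exists>\<psi>. (\<forall>i<l. \<psi> i \<in> Field r) \<and> (\<forall>i j. i < j \<and> j < l \<longrightarrow> (\<psi> i, \<psi> j) \<in> r - Id) \<and>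
    (\<forall>z. z < l \<and> (\<forall>x. z \<le> x) \<longrightarrow> \<psi> z = wo_rel.minim r (Field r))"
proof -
  have "order_rel {..<l} =o r"
    using assms(2) by (rule ordIso_symmetric)
  then obtain \<psi> where \<psi>: "iso (order_rel {..<l}) r \<psi>"
    unfolding ordIso_def by blast
  then have bij: "bij_betw \<psi> {..<l} (Field r)"
    by (simp add: iso_def)
  have "compat (order_rel {..<l}) r \<psi>"
    using \<psi> embed_compat Well_order_order_rel unfolding iso_def by blast
  then have le: "(\<psi> i, \<psi> j) \<in> r" if "i \<le> j" "j < l" for i j
    using that by (auto simp: compat_def order_rel_def)
  have inj: "\<psi> i \<noteq> \<psi> j" if "i < j" "j < l" for i j
    using bij that unfolding bij_betw_def inj_on_def by (metis lessThan_iff less_trans less_irrefl)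
  have fld: "\<psi> i \<in> Field r" if "i < l" for i
    using bij that by (auto dest: bij_betw_apply)
  have "\<psi> z = wo_rel.minim r (Field r)" if z: "z < l" "\<And>x. z \<le> x" for z
  proof (rule wo_rel.equals_minim)
    show "wo_rel r"
      using assms(1) by (simp add: wo_rel_def)
    fix b assume "b \<in> Field r"
    then obtain x where "x < l" "b = \<psi> x"
      using bij by (auto simp: bij_betw_def)
    then show "(\<psi> z, b) \<in> r"
      using le z(2) by blast
  qed (use fld z in auto)
  then show ?thesis
    using fld le inj by (intro exI[of _ \<psi>]) (auto simp: less_imp_le)
qed

text \<open>The closure maps increasingly into the set of reached points, and a reached point is
  coded by the \<open>n + 1\<close> digits of its walk, which form a finitely supported
  function.\<close>

lemma ordLeq_clos_reach:
  fixes r :: "'l rel" and t :: "'m rel"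
  assumes c: "cofin {..<\<delta>} c" "cof_gt natLeq {..<\<delta>}" "|c| <o |{..<l}|"
    and f: "\<And>\<alpha>. \<alpha> \<le> \<delta> \<Longrightarrow> inj_on (f \<alpha>) {..<\<alpha>} \<and> f \<alpha> ` {..<\<alpha>} \<subseteq> {..<l}"
    and r: "Well_order r" "r =o order_rel {..<l}" and l: "cof_gt natLeq {..<l}"
    and t: "Well_order t" "Field t \<noteq> {}"
  shows "order_rel (clos \<delta> {x. x < \<delta> \<and> reach f n c x}) \<le>o ord_prod (ord_pow r natLeq) t"
proof -
  define D where "D = {x. x < \<delta> \<and> reach f n c x}"
  have "c \<subseteq> D"
    unfolding D_def using c(1) by (cases n) (auto simp: cofin_def)
  moreover have "D \<subseteq> {..<\<delta>}"
    by (auto simp: D_def)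
  ultimately have "cofin {..<\<delta>} D"
    using c(1) unfolding cofin_def by blast
  from incr_on_clos[OF this c(2)] obtain \<sigma> where \<sigma>: "incr_on (clos \<delta> D) \<sigma>" "\<sigma> ` clos \<delta> D \<subseteq> D"
    by blast
  obtain \<psi> where \<psi>: "\<And>i. i < l \<Longrightarrow> \<psi> i \<in> Field r" "\<And>i j. i < j \<Longrightarrow> j < l \<Longrightarrow> (\<psi> i, \<psi> j) \<in> r - Id"
      "\<And>z. z < l \<Longrightarrow> (\<And>x. z \<le> x) \<Longrightarrow> \<psi> z = wo_rel.minim r (Field r)"
    using ex_strict_embedding[OF r] by blast
  define z where "z = (LEAST x. True)"
  have z: "z \<le> x" for x
    unfolding z_def by (rule Least_le) simp
  have zl: "z < l"
    using cof_gt_lessThan_nonempty[OF l] z le_less_trans by blast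
  define s where "s i = (LEAST j. i < j)" for i
  have s: "i < s i \<and> s i < l" if i: "i < l" for i
  proof -
    obtain j where j: "i < j" "j < l"
      using cof_gt_lessThan_gt[OF l i] by blast
    have "i < s i"
      unfolding s_def using j(1) by (rule LeastI)
    moreover have "s i \<le> j"
      unfolding s_def using j(1) by (rule Least_le)
    ultimately show ?thesis
      using j(2) by simp
  qed
  have s_le: "s i \<le> j" if "i < j" for i j
    unfolding s_def using that by (rule Least_le)
  \<comment> \<open>Points of \<open>c\<close> are labelled by their position, which is below
    \<open>l\<close> because \<open>c\<close> has fewer than \<open>l\<close> elements; in the
    ladder of \<alpha> the labels are the values of \<open>f \<alpha>\<close>.\<close>
  define q where "q x = ot (c \<inter> {..<x})" for x
  have cs: "c \<subseteq> {..<\<delta>}"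
    using c(1) by (simp add: cofin_def)
  have q: "incr_on c q"
    unfolding q_def by (rule incr_on_ot[OF cs])
  have ql: "q ` c \<subseteq> {..<l}"
    using ot_initial_less[OF cs] ot_less_of_card[OF cs c(3)] unfolding q_def by (auto intro: less_trans)
  have ex_u: "\<exists>u\<in>c. x \<le> u" if "x \<in> D" for x
    using c(1) that by (auto simp: cofin_def D_def)
  have fu: "inj_on (f \<alpha>) {..<\<alpha>} \<and> f \<alpha> ` {..<\<alpha>} \<subseteq> {..<l}" if "\<alpha> \<le> u" "u \<in> c" for \<alpha> u
    using that cs by (intro f) (auto dest: subsetD)
  define k where "k x = code s z f n c q x" for x
  have k_range: "k x m < l" if x: "x \<in> D" for x m
  proof -
    obtain u where u: "u \<in> c" "x \<le> u"
      using ex_u[OF x] by blast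
    have "reach f n c x"
      using x by (simp add: D_def)
    from code_range[OF this u ql _ s z zl] fu[OF _ u(1)] show ?thesis
      unfolding k_def by blast
  qed
  have k_less: "\<exists>m. k x m < k y m \<and> (\<forall>i>m. k x i = k y i)" if xy: "x \<in> D" "y \<in> D" "x < y" for x y
  proof -
    obtain u where u: "u \<in> c" "y \<le> u"
      using ex_u[OF xy(2)] by blast
    have "reach f n c x" "reach f n c y"
      using xy by (auto simp: D_def)
    from code_less[OF this xy(3) u q ql fu[OF _ u(1)] s s_le z zl] show ?thesis
      unfolding k_def by blast
  qed
  have k_fin: "\<psi> \<circ> k x \<in> finsupp_funs r natLeq" if "x \<in> D" for x
    unfolding finsupp_funs_natLeq
  proof (intro conjI)
    show "range (\<psi> \<circ> k x) \<subseteq> Field r"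
      using \<psi>(1) k_range[OF that] by auto
    have *: "(\<psi> \<circ> k x) m = wo_rel.minim r (Field r)" if "m > n" for m
      using code_above[OF that] \<psi>(3)[OF zl z] by (simp add: k_def)
    have "{m. (\<psi> \<circ> k x) m \<noteq> wo_rel.minim r (Field r)} \<subseteq> {m. m \<le> n}"
    proof (intro subsetI CollectI)
      fix m assume "m \<in> {m. (\<psi> \<circ> k x) m \<noteq> wo_rel.minim r (Field r)}"
      then have "\<not> n < m"
        using * by blast
      then show "m \<le> n"
        by simp
    qed
    then show "finite {m. (\<psi> \<circ> k x) m \<noteq> wo_rel.minim r (Field r)}"
      using finite_Collect_le_nat finite_subset by blast
  qed
  \<comment> \<open>One copy of the power is enough, so the second coordinate is constant.\<close>
  obtain b where b: "b \<in> Field t"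
    using t(2) by blast
  have "Well_order (ord_prod (ord_pow r natLeq) t)"
    by (intro Well_order_ord_prod Well_order_ord_pow r(1) t(1))
  moreover have "(\<psi> \<circ> k (\<sigma> x), b) \<in> Field (ord_prod (ord_pow r natLeq) t)" if "x \<in> clos \<delta> D" for x
    using k_fin \<sigma>(2) that b Well_order_ord_prod(2)[OF Well_order_ord_pow(1)[OF r(1)] t(1)]
      Well_order_ord_pow(2)[OF r(1)] by blast
  moreover have "((\<psi> \<circ> k (\<sigma> x), b), (\<psi> \<circ> k (\<sigma> y), b)) \<in> ord_prod (ord_pow r natLeq) t - Id"
    if xy: "(x, y) \<in> order_rel (clos \<delta> D)" "x \<noteq> y" for x y
  proof -
    have D: "\<sigma> x \<in> D" "\<sigma> y \<in> D" "\<sigma> x < \<sigma> y"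
      using xy \<sigma> by (auto simp: order_rel_def incr_on_def less_le)
    obtain m where m: "k (\<sigma> x) m < k (\<sigma> y) m" "\<And>i. i > m \<Longrightarrow> k (\<sigma> x) i = k (\<sigma> y) i"
      using k_less[OF D] by blast
    have lt: "((\<psi> \<circ> k (\<sigma> x)) m, (\<psi> \<circ> k (\<sigma> y)) m) \<in> r - Id"
      using \<psi>(2)[OF m(1) k_range[OF D(2)]] by simp
    have "(\<psi> \<circ> k (\<sigma> x), \<psi> \<circ> k (\<sigma> y)) \<in> ord_pow r natLeq"
      unfolding ord_pow_natLeq using k_fin D lt m(2) by (intro conjI disjI2 exI[of _ m]) auto
    moreover have "\<psi> \<circ> k (\<sigma> x) \<noteq> \<psi> \<circ> k (\<sigma> y)"
      using lt by (metis DiffE IdI)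
    ultimately show ?thesis
      using b k_fin D unfolding ord_prod_def Well_order_ord_pow(2)[OF r(1)] by simp
  qed
  ultimately show ?thesis
    unfolding D_def[symmetric]
    by (intro ordLeq_of_strict_mono[OF Well_order_order_rel, where h = "\<lambda>x. (\<psi> \<circ> k (\<sigma> x), b)"]) simp_all
qed

end

subsection \<open>Guessing clubs\<close>

lemma card_reals: "|UNIV :: (nat \<Rightarrow> bool) set| = ctwo ^c natLeq"
  by (auto simp: cexp_def ctwo_def Field_card_of Field_natLeq Func_def)

context wellorder
begin

text \<open>By coherence, at a limit point in \<open>S\<close> of the approximation of
  \<open>d\<close> the point's own approximation is cofinal.\<close>

lemma stat_lim_points:
  assumes F: "down_closed F"
    and S: "S \<subseteq> F" "\<And>\<delta>. \<delta> \<in> S \<Longrightarrow> cof_gt natLeq {..<\<delta>}"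
    and S2: "stat F S2" "\<And>d. d \<in> S2 \<Longrightarrow> coherent f i d \<and> stat {..<d} {\<delta> \<in> lim_points S (approx f i d) d. P \<delta>}"
  shows "stat F {\<delta> \<in> S. cofin {..<\<delta>} (approx f i \<delta>)}"
  unfolding stat_def
proof (intro conjI allI impI)
  fix G assume G: "mono_map F G"
  then obtain d where d: "d \<in> S2" "closed_under G d"
    using S2(1) unfolding stat_def by blast
  then have "d \<in> F"
    using S2(1) unfolding stat_def by blast
  then have "mono_map {..<d} G"
    using G d(2) F unfolding mono_map_def closed_under_def down_closed_def by auto
  then obtain \<delta> where \<delta>: "\<delta> \<in> lim_points S (approx f i d) d" "closed_under G \<delta>"
    using S2(2)[OF d(1)] unfolding stat_def by blast
  then have "\<delta> \<in> S"
    by (simp add: lim_points_def)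
  from position(1)[of f i d, OF _ \<delta>(1) S(2)[OF this]] \<delta>(1)
  have "cofin {..<\<delta>} (approx f i \<delta>)"
    using S2(2)[OF d(1)] by (simp add: lim_points_def)
  then show "\<exists>\<delta>\<in>{\<delta> \<in> S. cofin {..<\<delta>} (approx f i \<delta>)}. closed_under G \<delta>"
    using \<delta>(2) \<open>\<delta> \<in> S\<close> by blast
qed (use S(1) in blast)

text \<open>Both parts of the theorem at once, with the successor cardinal presented as an initial
  segment \<open>F\<close> of a well-ordered type; \<open>split\<close> holds the two
  alternatives.\<close>

lemma ex_guessing:
  fixes \<Lambda> :: "'l rel" and \<theta>\<^sub>1 :: "'m rel" and \<theta> :: "'n rel"
  assumes F: "down_closed F" "cardSuc \<Lambda> =o order_rel F"
    and \<Lambda>: "Cinfinite \<Lambda>" "cf \<Lambda> =o \<Lambda>" and \<theta>\<^sub>1: "Cinfinite \<theta>\<^sub>1" "cardSuc \<theta>\<^sub>1 <o \<Lambda>" and \<theta>: "natLeq <o \<theta>"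
    and S: "S \<subseteq> cof_points (order_rel F) \<theta>"
    and S1: "stationary_in (order_rel F)
      {\<delta> \<in> F. cf (below (order_rel F) \<delta>) =o cardSuc \<theta>\<^sub>1 \<and>
        stationary_in (below (order_rel F) \<delta>) (S \<inter> underS (order_rel F) \<delta>)}"
    and split: "ctwo ^c natLeq \<le>o \<Lambda> \<or> S = cof_points (order_rel F) \<theta>"
  shows "\<exists>S' E. S' \<subseteq> S \<and> stationary_in (order_rel F) S' \<and>
     (\<forall>\<delta>\<in>S'. club_in (below (order_rel F) \<delta>) (E \<delta>) \<and>
        Restr (order_rel F) (E \<delta>) \<le>o ord_prod (ord_pow \<Lambda> natLeq) (cardSuc \<theta>\<^sub>1)) \<and>
     (\<forall>A. unbounded_in (order_rel F) A \<and> A \<subseteq> cof_points (order_rel F) \<Lambda> \<longrightarrow>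
        stationary_in (order_rel F)
          {\<delta> \<in> S'. \<delta> = wo_rel.supr (order_rel F) (A \<inter> nacc_points (order_rel F) (E \<delta>))})"
proof -
  have c\<Lambda>: "Card_order \<Lambda>" and w\<Lambda>: "Well_order \<Lambda>" and c\<theta>: "Card_order \<theta>\<^sub>1"
    using \<Lambda>(1) \<theta>\<^sub>1(1) by (auto simp: card_order_on_def)
  have CF: "Cinfinite (cardSuc \<Lambda>)" and C\<theta>: "Cinfinite (cardSuc \<theta>\<^sub>1)"
    using Cinfinite_cardSuc[OF \<Lambda>(1)] Cinfinite_cardSuc[OF \<theta>\<^sub>1(1)] .
  have "\<Lambda> <o order_rel F"
    using cardSuc_greater[OF c\<Lambda>] F(2) by (rule ordLess_ordIso_trans)
  from ordLess_order_rel_segment[OF w\<Lambda> F(1) this]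
  obtain l where l: "l \<in> F" "\<Lambda> =o order_rel {..<l}"
    by blast
  have wS: "Well_order (cardSuc \<theta>\<^sub>1)"
    using C\<theta> by (auto simp: card_order_on_def)
  from ordLess_order_rel_segment[OF wS down_closed_lessThan ordLess_ordIso_trans[OF \<theta>\<^sub>1(2) l(2)]]
  obtain k where k: "k < l" "cardSuc \<theta>\<^sub>1 =o order_rel {..<k}"
    by blast
  have card_l: "|{..<l}| =o \<Lambda>" and card_k: "|{..<k}| =o cardSuc \<theta>\<^sub>1"
    using card_order_rel[OF c\<Lambda> l(2)] card_order_rel[OF _ k(2)] C\<theta> by auto
  have l1: "|{..<i}| <o |{..<l}|" if "i < l" for i
    using card_lessThan_less[OF c\<Lambda> l(2) down_closed_lessThan, of i] that card_l
      ordIso_symmetric ordLess_ordIso_trans by blast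
  have k1: "|{..<x}| \<le>o \<theta>\<^sub>1" if "x < k" for x
  proof -
    have "|{..<x}| <o cardSuc \<theta>\<^sub>1"
      using card_lessThan_less[OF _ k(2) down_closed_lessThan, of x] that C\<theta> by simp
    then show ?thesis
      using cardSuc_ordLeq_ordLess[OF c\<theta> card_of_Card_order] by blast
  qed
  have \<theta>l: "\<theta>\<^sub>1 <o \<Lambda>"
    using cardSuc_greater[OF c\<theta>] \<theta>\<^sub>1(2) by (rule ordLess_transitive)
  have nat\<theta>: "natLeq \<le>o \<theta>\<^sub>1"
    using \<theta>\<^sub>1(1) by (simp add: natLeq_ordLeq_cinfinite)
  have eq_l: "\<Lambda> =o |{..<l}|"
    using card_l by (rule ordIso_symmetric)
  have \<theta>\<^sub>1_l: "\<theta>\<^sub>1 <o |{..<l}|"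
    using \<theta>l eq_l by (rule ordLess_ordIso_trans)
  have l3: "natLeq <o |{..<l}|"
    using nat\<theta> \<theta>\<^sub>1_l by (rule ordLeq_ordLess_trans)
  have l2: "cof_ge |{..<l}| {..<l}"
  proof -
    have reg: "regularCard (order_rel {..<l})"
      using regularCard_ordIso[OF l(2) \<Lambda>(1) regularCard_of_cf[OF c\<Lambda> \<Lambda>(2)]] .
    have "Cinfinite (order_rel {..<l})"
      using Cinfinite_cong[OF l(2) \<Lambda>(1)] .
    from cof_ge_of_regularCard[OF this reg] show ?thesis
      unfolding cof_ge_def using ordLess_ordIso_trans[OF _ ordIso_transitive[OF card_l l(2)]] by blast
  qed
  have F_card: "Cinfinite (order_rel F)"
    using Cinfinite_cong[OF F(2) CF] .
  have "cof_ge (order_rel F) F"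
    using cof_ge_of_regularCard[OF F_card regularCard_ordIso[OF F(2) CF infinite_cardSuc_regularCard]] \<Lambda>(1)
    by (auto simp: cinfinite_def)
  moreover have "|{..<l}| <o order_rel F"
    using card_l \<open>\<Lambda> <o order_rel F\<close> by (rule ordIso_ordLess_trans)
  ultimately have F1: "cof_gt |{..<l}| F"
    by (rule cof_ge_imp_gt)
  have F2: "cof_gt natLeq F"
    using F1 ordLess_imp_ordLeq[OF l3] by (rule cof_gt_mono)
  have "\<exists>g. inj_on g {..<\<alpha>} \<and> g ` {..<\<alpha>} \<subseteq> {..<l}" if "\<alpha> \<in> F" for \<alpha>
  proof -
    have "|{..<\<alpha>}| <o cardSuc \<Lambda>"
      using card_lessThan_less[OF _ F(2,1) that] CF by simp
    then have "|{..<\<alpha>}| \<le>o \<Lambda>"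
      using cardSuc_ordLeq_ordLess[OF c\<Lambda> card_of_Card_order] by blast
    then have "|{..<\<alpha>}| \<le>o |{..<l}|"
      using eq_l by (rule ordLeq_ordIso_trans)
    then show ?thesis
      by (simp only: card_of_ordLeq)
  qed
  then have "\<forall>\<alpha>\<in>F. \<exists>g. inj_on g {..<\<alpha>} \<and> g ` {..<\<alpha>} \<subseteq> {..<l}"
    by blast
  from bchoice[OF this] obtain f where f: "\<And>\<alpha>. \<alpha> \<in> F \<Longrightarrow> inj_on (f \<alpha>) {..<\<alpha>} \<and> f \<alpha> ` {..<\<alpha>} \<subseteq> {..<l}"
    by blast
  have SF: "S \<subseteq> F"
    using S by (auto simp: cof_points_def)
  have S_cf: "cf (order_rel {..<\<delta>}) =o \<theta>" if "\<delta> \<in> S" for \<delta>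
    using S SF that below_order_rel[OF F(1)] unfolding cof_points_def by auto
  have S_cof: "cof_gt natLeq {..<\<delta>}" if "\<delta> \<in> S" for \<delta>
    using cof_ge_imp_gt[OF cof_ge_of_cf(1)[OF S_cf[OF that]] \<theta>] .
  define S1 where "S1 = {\<delta> \<in> F. cf (below (order_rel F) \<delta>) =o cardSuc \<theta>\<^sub>1 \<and>
        stationary_in (below (order_rel F) \<delta>) (S \<inter> underS (order_rel F) \<delta>)}"
  have S1_stat: "stat F S1"
    using stat_of_stationary[OF F(1) F2 S1] by (simp add: S1_def)
  have S1_prop: "cof_gt \<theta>\<^sub>1 {..<d} \<and> stat {..<d} (S \<inter> {..<d}) \<and> (\<exists>Z. cofin {..<d} Z \<and> |Z| \<le>o |{..<k}| )"
    if d: "d \<in> S1" for d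
  proof -
    have dF: "d \<in> F"
      using d by (simp add: S1_def)
    have cf: "cf (order_rel {..<d}) =o cardSuc \<theta>\<^sub>1" and st: "stationary_in (order_rel {..<d}) (S \<inter> {..<d})"
      using d below_order_rel[OF F(1) dF] underS_order_rel[OF F(1) dF] by (auto simp: S1_def)
    have cof: "cof_gt \<theta>\<^sub>1 {..<d}"
      using cof_ge_of_cf(1)[OF cf] cardSuc_greater[OF c\<theta>] by (rule cof_ge_imp_gt)
    obtain Z where "cofin {..<d} Z" "|Z| =o cardSuc \<theta>\<^sub>1"
      using cof_ge_of_cf(2)[OF cf] by blast
    moreover from this(2) have "|Z| \<le>o |{..<k}|"
      using ordIso_transitive[OF _ ordIso_symmetric[OF card_k]] ordIso_imp_ordLeq by blast
    ultimately show ?thesis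
      using cof stat_of_stationary[OF down_closed_lessThan cof_gt_mono[OF cof nat\<theta>] st] by blast
  qed
  have "|UNIV :: (nat \<Rightarrow> bool) set| \<le>o |{..<l}| \<or>
    (\<forall>\<delta> X \<epsilon> \<phi>. \<delta> \<in> S \<longrightarrow> \<delta> \<in> F \<longrightarrow> \<epsilon> \<in> F \<longrightarrow> cofin {..<\<delta>} X \<longrightarrow> incr_on X \<phi> \<longrightarrow> cofin {..<\<epsilon>} (\<phi> ` X) \<longrightarrow> \<epsilon> \<in> S)"
    using split
  proof
    assume "ctwo ^c natLeq \<le>o \<Lambda>"
    then show ?thesis
      unfolding card_reals using eq_l ordLeq_ordIso_trans by blast
  next
    assume S_eq: "S = cof_points (order_rel F) \<theta>"
    \<comment> \<open>An order isomorphism between cofinal sets preserves cofinality, so the set of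
      all points of cofinality \<theta> is closed under it.\<close>
    have "\<epsilon> \<in> S" if *: "\<delta> \<in> S" "\<epsilon> \<in> F" "cofin {..<\<delta>} X" "incr_on X \<phi>" "cofin {..<\<epsilon>} (\<phi> ` X)" for \<delta> X \<epsilon> \<phi>
    proof -
      have "cf (order_rel {..<\<epsilon>}) =o \<theta>"
        using cf_order_rel_iso[OF *(3-5)] S_cf[OF *(1)] by (rule ordIso_transitive)
      then show ?thesis
        using *(2) below_order_rel[OF F(1)] unfolding S_eq cof_points_def by simp
    qed
    then show ?thesis
      by blast
  qed
  from ex_colouring[OF F(1) F1 f l1 l2 l3 ordLess_imp_ordLeq[OF \<theta>\<^sub>1_l] k(1) k1 \<theta>\<^sub>1(1) S_cof S1_stat S1_prop this]
  obtain i S2 h where i: "i < l" and S2: "stat F S2" "\<And>d. d \<in> S2 \<Longrightarrow> coherent f i d \<and> cof_gt natLeq {..<d}"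
    "\<And>d n. d \<in> S2 \<Longrightarrow> stat {..<d} {\<delta> \<in> lim_points S (approx f i d) d. h \<delta> = (n::nat)}"
    by blast
  \<comment> \<open>Only those \<delta> are kept whose approximation is cofinal, which makes
    \<open>D \<delta>\<close> and its closure unbounded.\<close>
  define S' where "S' = {\<delta> \<in> S. cofin {..<\<delta>} (approx f i \<delta>)}"
  define D where "D \<delta> = {x. x < \<delta> \<and> reach f (h \<delta>) (approx f i \<delta>) x}" for \<delta>
  define E where "E \<delta> = clos \<delta> (D \<delta>)" for \<delta>
  have S'F: "S' \<subseteq> F" and S'_cof: "\<And>\<delta>. \<delta> \<in> S' \<Longrightarrow> cof_gt natLeq {..<\<delta>}"
    using SF S_cof by (auto simp: S'_def)
  have pos: "\<exists>y. y < \<delta>" if "\<delta> \<in> S'" for \<delta>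
    by (rule cof_gt_lessThan_nonempty[OF S'_cof[OF that]])
  have "stat F S'"
    \<comment> \<open>One colour class already shows stationarity; colour 0 is taken.\<close>
    unfolding S'_def using S2 by (intro stat_lim_points[OF F(1) SF S_cof S2(1), where P = "\<lambda>\<delta>. h \<delta> = 0"]) auto
  then have "stationary_in (order_rel F) S'"
    using pos by (rule stationary_of_stat[OF F(1) F2])
  moreover have "club_in (below (order_rel F) \<delta>) (E \<delta>) \<and>
    Restr (order_rel F) (E \<delta>) \<le>o ord_prod (ord_pow \<Lambda> natLeq) (cardSuc \<theta>\<^sub>1)" if \<delta>: "\<delta> \<in> S'" for \<delta>
  proof
    have \<delta>F: "\<delta> \<in> F"
      using \<delta> S'F by blast
    have c: "cofin {..<\<delta>} (approx f i \<delta>)"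
      using \<delta> by (simp add: S'_def)
    have "approx f i \<delta> \<subseteq> D \<delta>"
      unfolding D_def using approx_subset by (cases "h \<delta>") auto
    then have "cofin {..<\<delta>} (D \<delta>)"
      using c unfolding cofin_def D_def by blast
    then show "club_in (below (order_rel F) \<delta>) (E \<delta>)"
      unfolding below_order_rel[OF F(1) \<delta>F] E_def by (rule club_clos)
    have "E \<delta> \<subseteq> F"
      using lessThan_subset[OF F(1) \<delta>F] by (auto simp: E_def clos_def)
    moreover have "|approx f i \<delta>| <o |{..<l}|"
      using f[OF \<delta>F] i l1 by (intro card_approx) auto
    moreover have "inj_on (f \<alpha>) {..<\<alpha>} \<and> f \<alpha> ` {..<\<alpha>} \<subseteq> {..<l}" if "\<alpha> \<le> \<delta>" for \<alpha>
      using F(1) \<delta>F that by (intro f) (auto simp: down_closed_def le_less)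
    moreover have "cof_gt natLeq {..<l}"
      by (rule cof_ge_imp_gt[OF l2 l3])
    moreover have "Field (cardSuc \<theta>\<^sub>1) \<noteq> {}"
      using C\<theta> by (auto simp: cinfinite_def)
    ultimately show "Restr (order_rel F) (E \<delta>) \<le>o ord_prod (ord_pow \<Lambda> natLeq) (cardSuc \<theta>\<^sub>1)"
      unfolding Restr_order_rel[OF \<open>E \<delta> \<subseteq> F\<close>] unfolding E_def D_def
      by (intro ordLeq_clos_reach[OF c S'_cof[OF \<delta>] _ _ w\<Lambda> l(2) _ wS])
  qed
  moreover have "stationary_in (order_rel F)
      {\<delta> \<in> S'. \<delta> = wo_rel.supr (order_rel F) (A \<inter> nacc_points (order_rel F) (E \<delta>))}"
    if A: "unbounded_in (order_rel F) A" "A \<subseteq> cof_points (order_rel F) \<Lambda>" for A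
  proof -
    have cA: "cofin F A"
      using A(1) by (simp add: unbounded_in_order_rel)
    have A_cof: "cof_ge |{..<l}| {..<\<beta>}" if \<beta>: "\<beta> \<in> A" for \<beta>
    proof -
      have "\<beta> \<in> F"
        using \<beta> cA by (auto simp: cofin_def)
      then have "cf (order_rel {..<\<beta>}) =o \<Lambda>"
        using \<beta> A(2) below_order_rel[OF F(1)] unfolding cof_points_def by auto
      from ordIso_transitive[OF this eq_l] show ?thesis
        by (rule cof_ge_of_cf(1))
    qed
    have S2': "stat {..<d} {\<delta> \<in> S. \<delta> < d \<and> cofin {..<\<delta>} (approx f i d \<inter> {..<\<delta>}) \<and> h \<delta> = n}" if "d \<in> S2" for d n
      using S2(3)[OF that, of n] by (simp add: lim_points_def conj_assoc)
    let ?W = "{\<delta> \<in> S. cofin {..<\<delta>} (approx f i \<delta>) \<and>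
      (\<forall>y<\<delta>. \<exists>x\<in>A. y < x \<and> x < \<delta> \<and> reach f (h \<delta>) (approx f i \<delta>) x \<and>
        \<not> lim_pt {x. x < \<delta> \<and> reach f (h \<delta>) (approx f i \<delta>) x} x)}"
    have "stat F ?W"
      by (rule stat_guess[OF F(1) F2 cA f l1 i SF S_cof S2(1,2) S2' A_cof])
    moreover have "?W \<subseteq> {\<delta> \<in> S'. \<delta> = wo_rel.supr (order_rel F) (A \<inter> nacc_points (order_rel F) (E \<delta>))}"
    proof
      fix \<delta> assume \<delta>: "\<delta> \<in> ?W"
      then have \<delta>S: "\<delta> \<in> S'" "\<delta> \<in> F"
        using SF by (auto simp: S'_def)
      have "\<exists>x\<in>A \<inter> nacc_points (order_rel F) (E \<delta>). y < x" if y: "y < \<delta>" for y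
      proof -
        obtain x where x: "x \<in> A" "y < x" "x < \<delta>" "x \<in> D \<delta>" "\<not> lim_pt (D \<delta>) x"
          using \<delta> y unfolding D_def by blast
        then show ?thesis
          using nacc_clos[OF F(1) \<delta>S(2) x(3-5)] unfolding E_def by blast
      qed
      moreover have "A \<inter> nacc_points (order_rel F) (E \<delta>) \<subseteq> {..<\<delta>}"
        by (auto simp: nacc_points_def E_def clos_def)
      ultimately have "\<delta> = wo_rel.supr (order_rel F) (A \<inter> nacc_points (order_rel F) (E \<delta>))"
        using eq_supr_iff[OF F(1) \<delta>S(2)] by blast
      then show "\<delta> \<in> {\<delta> \<in> S'. \<delta> = wo_rel.supr (order_rel F) (A \<inter> nacc_points (order_rel F) (E \<delta>))}"
        using \<delta>S(1) by blast
    qed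
    ultimately have "stat F {\<delta> \<in> S'. \<delta> = wo_rel.supr (order_rel F) (A \<inter> nacc_points (order_rel F) (E \<delta>))}"
      by (rule stat_mono) (use S'F in blast)
    then show ?thesis
      using pos by (intro stationary_of_stat[OF F(1) F2]) auto
  qed
  moreover have "S' \<subseteq> S"
    by (auto simp: S'_def)
  ultimately show ?thesis
    by blast
qed

end

text \<open>Points outside the field are put on top, in any order.\<close>

lemma Well_order_extension:
  assumes r: "Well_order (r :: 'x rel)"
  shows "\<exists>le lt. class.wellorder le lt \<and> (\<forall>x y. (x, y) \<in> r \<longleftrightarrow> x \<in> Field r \<and> y \<in> Field r \<and> le x y) \<and>
    (\<forall>x\<in>Field r. \<forall>y. lt y x \<longrightarrow> y \<in> Field r)"
proof -
  obtain w :: "'x rel" where w: "well_order_on UNIV w"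
    using well_order_on by blast
  define F where "F = Field r"
  define le where "le x y \<longleftrightarrow> (x, y) \<in> r \<or> x \<in> F \<and> y \<notin> F \<or> x \<notin> F \<and> y \<notin> F \<and> (x, y) \<in> w" for x y
  define lt where "lt x y \<longleftrightarrow> le x y \<and> x \<noteq> y" for x y
  have ro: "refl_on F r" "trans r" "antisym r" "total_on F r" "wf (r - Id)"
    using r by (auto simp: F_def order_on_defs)
  have wo: "refl w" "trans w" "antisym w" "total w" "wf (w - Id)"
    using w by (auto simp: order_on_defs)
  have rF: "x \<in> F" "y \<in> F" if "(x, y) \<in> r" for x y
    using that by (auto simp: F_def Field_def)
  have le_refl: "le x x" for x
    using ro(1) wo(1) by (auto simp: le_def refl_on_def)
  have le_trans: "le x z" if "le x y" "le y z" for x y z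
    using that rF ro(2) wo(2) unfolding le_def by (meson transD)
  have le_antisym: "x = y" if "le x y" "le y x" for x y
    using that rF ro(3) wo(3) unfolding le_def by (meson antisymD)
  have le_total: "le x y \<or> le y x" for x y
    using ro(1,4) wo(1,4) unfolding le_def total_on_def refl_on_def by (metis UNIV_I)
  \<comment> \<open>No point outside \<open>F\<close> precedes a point of \<open>F\<close>, so the
    induction runs through \<open>F\<close> first and along \<open>w\<close> afterwards.\<close>
  have F_ind: "P x" if "x \<in> F" and ind: "\<And>x. (\<And>y. lt y x \<Longrightarrow> P y) \<Longrightarrow> P x" for P x
    using \<open>x \<in> F\<close>
  proof (induction x rule: wf_induct_rule[OF ro(5)])
    case (1 x)
    show ?case
    proof (rule ind)
      fix y assume "lt y x"
      then have "(y, x) \<in> r - Id"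
        using "1.prems" by (auto simp: lt_def le_def)
      then show "P y"
        using "1.IH" rF by blast
    qed
  qed
  have "P x" if ind: "\<And>x. (\<And>y. lt y x \<Longrightarrow> P y) \<Longrightarrow> P x" for P x
  proof (induction x rule: wf_induct_rule[OF wo(5)])
    case (1 x)
    show ?case
    proof (rule ind)
      fix y assume y: "lt y x"
      show "P y"
      proof (cases "y \<in> F")
        case True
        then show ?thesis
          using ind by (rule F_ind)
      next
        case False
        then have "(y, x) \<in> w - Id"
          using y rF by (auto simp: lt_def le_def)
        then show ?thesis
          by (rule "1.IH")
      qed
    qed
  qed
  then have "class.wellorder le lt"
    using le_refl le_trans le_antisym le_total by unfold_locales (auto simp: lt_def)
  moreover have "(x, y) \<in> r \<longleftrightarrow> x \<in> F \<and> y \<in> F \<and> le x y" for x y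
    using rF by (auto simp: le_def)
  moreover have "y \<in> F" if "x \<in> F" "lt y x" for x y
    using that rF by (auto simp: lt_def le_def)
  ultimately show ?thesis
    unfolding F_def by blast
qed

theorem theorem0p3:
  fixes \<Lambda> :: "'a rel" and \<theta>\<^sub>1 :: "'b rel" and \<theta> :: "'c rel" and S :: "'a set set"
  assumes "Cinfinite \<Lambda>" and "Cinfinite \<theta>\<^sub>1" and "Cinfinite \<theta>"
    and "cf \<Lambda> =o \<Lambda>" and "cardSuc \<theta>\<^sub>1 <o \<Lambda>" and "\<theta>\<^sub>1 <o cardSuc \<theta>\<^sub>1" and "\<theta> \<le>o \<theta>\<^sub>1"
    and "cf \<theta> =o \<theta>" and "cardSuc natLeq <o \<theta>"
    and "S \<subseteq> cof_points (cardSuc \<Lambda>) \<theta>" and "stationary_in (cardSuc \<Lambda>) S"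
    and "stationary_in (cardSuc \<Lambda>)
           {\<delta> \<in> Field (cardSuc \<Lambda>). cf (below (cardSuc \<Lambda>) \<delta>) =o cardSuc \<theta>\<^sub>1 \<and>
              stationary_in (below (cardSuc \<Lambda>) \<delta>) (S \<inter> underS (cardSuc \<Lambda>) \<delta>)}"
  shows "(ctwo ^c natLeq \<le>o \<Lambda> \<longrightarrow>
            (\<exists>S' E. S' \<subseteq> S \<and> stationary_in (cardSuc \<Lambda>) S' \<and> guessing_sequence \<Lambda> \<theta>\<^sub>1 S' E)) \<and>
         (S = cof_points (cardSuc \<Lambda>) \<theta> \<longrightarrow>
            (\<exists>S' E. S' \<subseteq> S \<and> stationary_in (cardSuc \<Lambda>) S' \<and> guessing_sequence \<Lambda> \<theta>\<^sub>1 S' E))"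
proof -
  define R where "R = cardSuc \<Lambda>"
  have "Card_order R"
    unfolding R_def using assms(1) by (intro cardSuc_Card_order) simp
  then have wR: "Well_order R"
    by (simp add: card_order_on_def)
  \<comment> \<open>\<open>R\<close> orders only its field; extending it to the whole type, with the
    field as an initial segment, makes the results on well-ordered types applicable.\<close>
  obtain le lt where "class.wellorder le lt"
      and R: "\<And>x y. (x, y) \<in> R \<longleftrightarrow> x \<in> Field R \<and> y \<in> Field R \<and> le x y"
      and dc: "\<And>x y. x \<in> Field R \<Longrightarrow> lt y x \<Longrightarrow> y \<in> Field R"
    using Well_order_extension[OF wR] by blast
  interpret W: wellorder le lt
    by fact
  have R_eq: "W.order_rel (Field R) = R"
    using R by (auto simp: W.order_rel_def)
  have "W.down_closed (Field R)"
    using dc by (auto simp: W.down_closed_def)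
  moreover have "cardSuc \<Lambda> =o W.order_rel (Field R)"
    unfolding R_eq using wR by (simp add: R_def ordIso_reflexive)
  moreover have "natLeq <o \<theta>"
    using cardSuc_greater[OF natLeq_Card_order] assms(9) by (rule ordLess_transitive)
  ultimately have "\<exists>S' E. S' \<subseteq> S \<and> stationary_in R S' \<and> guessing_sequence \<Lambda> \<theta>\<^sub>1 S' E"
    if "ctwo ^c natLeq \<le>o \<Lambda> \<or> S = cof_points R \<theta>"
    using W.ex_guessing[of "Field R" \<Lambda> \<theta>\<^sub>1 \<theta> S] that assms(1,2,4,5,10,12)
    unfolding R_eq guessing_sequence_def by (simp add: R_def)
  then show ?thesis
    unfolding R_def by blast
qed

end
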